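(* Let $\mu\in\mathcal P(\mathcal X)$ and let $\gamma\in\mathcal P(\mathcal X\times\mathcal Y)$ be such that $\inf_{\tilde\pi\in\Pi_c(\mu,* )}D_{\rm KL}(\tilde\pi,\gamma)<\infty$. Recursively, define functions $f_t:\mathcal X_{1:t}\times\mathcal Y_{1:t}\to[0,\infty]$ and a measure $\pi\in\mathcal P(\mathcal X\times\mathcal Y)$ through its disintegrations: set $f_N\equiv0$ and, for $t=N-1,\dots,1$, $$\pi_{t+1,0}^{X_{1:t},Y_{1:t}}:=\mu_{t+1}^{X_{1:t}},\qquad \frac{d\pi_{0,t+1}^{X_{1:t+1},Y_{1:t}}}{d\gamma_{0,t+1}^{X_{1:t+1},Y_{1:t}}}:=\frac{\exp(-f_{t+1})}{\int\exp(-f_{t+1})\,d\gamma_{0,t+1}^{X_{1:t+1},Y_{1:t}}},$$ $$f_t:=D_{\rm KL}\big(\pi_{t+1,t+1}^{X_{1:t},Y_{1:t}},\gamma_{t+1,t+1}^{X_{1:t},Y_{1:t}}\big)+\int f_{t+1}\,d\pi_{t+1,t+1}^{X_{1:t},Y_{1:t}},$$ and $$\pi_{1,0}:=\mu_1,\qquad \frac{d\pi_{0,1}^{X_1,Y_0}}{d\gamma_{0,1}^{X_1,Y_0}}:=\frac{\exp(-f_1)}{\int\exp(-f_1)\,d\gamma_{0,1}^{X_1,Y_0}}.$$ Then $$\pi=\arg\min_{\tilde\pi\in\Pi_c(\mu,* )}D_{\rm KL}(\tilde\pi,\gamma).$$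
   Context: $N\in\mathbb N$; $\mathcal X=\mathcal X_1\times\dots\times\mathcal X_N$ and $\mathcal Y=\mathcal Y_1\times\dots\times\mathcal Y_N$ are products of Polish spaces; $X_t,Y_t$ are coordinate projections, $X_{1:t}=(X_1,\dots,X_t)$, $\mathcal X_{1:t}=\mathcal X_1\times\dots\times\mathcal X_t$, etc. $\mu_1$ is the law of $X_1$ under $\mu$ and $\mu_{t+1}^{X_{1:t}}$ the regular conditional law of $X_{t+1}$ given $X_{1:t}$ under $\mu$. For a measure $\pi$ (or $\gamma$) on $\mathcal X\times\mathcal Y$: $\pi_{1,0}$ is the law of $X_1$; $\pi_{0,1}^{X_1,Y_0}$ the conditional law of $Y_1$ given $X_1$; $\pi_{t+1,0}^{X_{1:t},Y_{1:t}}$ the conditional law of $X_{t+1}$ given $(X_{1:t},Y_{1:t})$; $\pi_{0,t+1}^{X_{1:t+1},Y_{1:t}}$ the conditional law of $Y_{t+1}$ given $(X_{1:t+1},Y_{1:t})$; $\pi_{t+1,t+1}^{X_{1:t},Y_{1:t}}$ the conditional law of $(X_{t+1},Y_{t+1})$ given $(X_{1:t},Y_{1:t})$, i.e. $\pi_{t+1,t+1}^{X_{1:t},Y_{1:t}}=\pi_{t+1,0}^{X_{1:t},Y_{1:t}}\otimes\pi_{0,t+1}^{X_{1:t+1},Y_{1:t}}$. Thus $\pi=(\pi_{1,0}\otimes\pi_{0,1}^{X_1,Y_0})\otimes\bigotimes_{t=1}^{N-1}(\pi_{t+1,0}^{X_{1:t},Y_{1:t}}\otimes\pi_{0,t+1}^{X_{1:t+1},Y_{1:t}})$.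 Versions of the conditional laws of $\mu$ and $\gamma$ are fixed; the conventions are $\exp(-\infty)=0$ and, at points where the normalizing integral $\int\exp(-f_{t})\,d\gamma_{0,t}^{X_{1:t},Y_{1:t-1}}$ vanishes, the kernel $\pi_{0,t}^{X_{1:t},Y_{1:t-1}}$ is set equal to $\gamma_{0,t}^{X_{1:t},Y_{1:t-1}}$. A measure $\pi\in\mathcal P(\mathcal X\times\mathcal Y)$ is causal if under $\pi$, for all $t=1,\dots,N-1$, $X_{t+1}$ is conditionally independent of $Y_{1:t}$ given $X_{1:t}$. $\Pi_c(\mu,* )$ is the set of causal measures on $\mathcal X\times\mathcal Y$ with $\mathcal X$-marginal $\mu$ (and arbitrary $\mathcal Y$-marginal). $D_{\rm KL}(\pi,\tilde\pi)=\int\log\frac{d\pi}{d\tilde\pi}\,d\pi$ if $\pi\ll\tilde\pi$ and $+\infty$ otherwise (also for conditional laws, pointwise in the conditioning variables). The notation $\pi=\arg\min$ means that $\pi$ is the (unique) minimizer. *)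

theory Defs
  imports "HOL-Probability.Probability"
begin

text \<open>
  The spaces \<open>\<X>\<^sub>1, \<dots>, \<X>\<^sub>N\<close> may all differ; they are given by a family of abstract topologies on
  subsets of one carrier type, which is no restriction, since any sequence of sets embeds into
  a common type.
\<close>

definition polish :: "'a topology \<Rightarrow> bool" where
  "polish S \<longleftrightarrow> separable_space S \<and> completely_metrizable_space S"

definition borel_of :: "'a topology \<Rightarrow> 'a measure" where
  "borel_of S = sigma (topspace S) {U. openin S U}"

text \<open>
  A path \<open>x\<^sub>1\<^sub>:\<^sub>t\<close> is an extensional function on \<open>{1..t}\<close>, so that \<open>x(Suc t := x')\<close> is the
  path \<open>x\<^sub>1\<^sub>:\<^sub>t\<close> prolonged by \<open>x'\<close>. For \<open>t = 0\<close> there is exactly one path, and conditioning on it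
  is no conditioning at all. As the factors are second countable, the product \<open>\<sigma>\<close>-algebra
  is the Borel \<open>\<sigma>\<close>-algebra of the product topology.
\<close>

definition paths :: "(nat \<Rightarrow> 'a topology) \<Rightarrow> nat \<Rightarrow> (nat \<Rightarrow> 'a) measure" where
  "paths X t = PiM {1..t} (\<lambda>i. borel_of (X i))"

abbreviation upto_time :: "nat \<Rightarrow> (nat \<Rightarrow> 'a) \<Rightarrow> nat \<Rightarrow> 'a" where
  "upto_time t x \<equiv> restrict x {1..t}"

definition regular_cond_law ::
  "'w measure \<Rightarrow> 's measure \<Rightarrow> 't measure \<Rightarrow> ('w \<Rightarrow> 's) \<Rightarrow> ('w \<Rightarrow> 't) \<Rightarrow> ('s \<Rightarrow> 't measure) \<Rightarrow> bool" where
  \<comment> \<open>\<open>K\<close> is a version of the conditional law of \<open>B\<close> given \<open>A\<close> under \<open>M\<close>\<close>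
  "regular_cond_law M S T A B K \<longleftrightarrow>
     A \<in> measurable M S \<and> B \<in> measurable M T \<and> K \<in> measurable S (prob_algebra T) \<and>
     (\<forall>E\<in>sets S. \<forall>F\<in>sets T.
        emeasure M {\<omega> \<in> space M. A \<omega> \<in> E \<and> B \<omega> \<in> F}
        = (\<integral>\<^sup>+\<omega>. indicator E (A \<omega>) * emeasure (K (A \<omega>)) F \<partial>M))"

definition cond_indep ::
  "'w measure \<Rightarrow> 's measure \<Rightarrow> 't measure \<Rightarrow> 'u measure \<Rightarrow> ('w \<Rightarrow> 's) \<Rightarrow> ('w \<Rightarrow> 't) \<Rightarrow> ('w \<Rightarrow> 'u) \<Rightarrow> bool" where
  \<comment> \<open>\<open>A\<close> and \<open>B\<close> are conditionally independent given \<open>C\<close> under \<open>M\<close>\<close>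
  "cond_indep M S T U A B C \<longleftrightarrow>
     (let \<G> = vimage_algebra (space M) C U in
      \<forall>E\<in>sets S. \<forall>F\<in>sets T. AE \<omega> in M.
        real_cond_exp M \<G> (\<lambda>\<omega>. indicator E (A \<omega>) * indicator F (B \<omega>)) \<omega>
        = real_cond_exp M \<G> (\<lambda>\<omega>. indicator E (A \<omega>)) \<omega>
          * real_cond_exp M \<G> (\<lambda>\<omega>. indicator F (B \<omega>)) \<omega>)"

definition causal ::
  "nat \<Rightarrow> (nat \<Rightarrow> 'a topology) \<Rightarrow> (nat \<Rightarrow> 'b topology) \<Rightarrow> ((nat \<Rightarrow> 'a) \<times> (nat \<Rightarrow> 'b)) measure \<Rightarrow> bool" where
  "causal N X Y \<pi> \<longleftrightarrow>
     (\<forall>t\<in>{1..<N}. cond_indep \<pi> (borel_of (X (Suc t))) (paths Y t) (paths X t)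
        (\<lambda>(x, y). x (Suc t)) (\<lambda>(x, y). upto_time t y) (\<lambda>(x, y). upto_time t x))"

definition causal_couplings ::
  "nat \<Rightarrow> (nat \<Rightarrow> 'a topology) \<Rightarrow> (nat \<Rightarrow> 'b topology) \<Rightarrow> (nat \<Rightarrow> 'a) measure
    \<Rightarrow> ((nat \<Rightarrow> 'a) \<times> (nat \<Rightarrow> 'b)) measure set" where
  \<comment> \<open>\<open>\<Pi>\<^sub>c(\<mu>, *)\<close>\<close>
  "causal_couplings N X Y \<mu> =
     {\<pi> \<in> space (prob_algebra (paths X N \<Otimes>\<^sub>M paths Y N)).
        distr \<pi> (paths X N) fst = \<mu> \<and> causal N X Y \<pi>}"

text \<open>
  For probability measures \<open>P \<lless> Q\<close> the negative part of \<open>ln (dP/dQ)\<close> is always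
  \<open>P\<close>-integrable, so if \<open>ln (dP/dQ)\<close> is not integrable, then its integral is \<open>\<infinity>\<close>; the library's
  real-valued \<^const>\<open>KL_divergence\<close> would be \<open>0\<close> there. The divergence is nonnegative, hence
  \<^const>\<open>ennreal\<close> truncates nothing. Note that the library takes the reference measure first.
\<close>

definition D_KL :: "'a measure \<Rightarrow> 'a measure \<Rightarrow> ennreal" where
  "D_KL P Q =
     (if absolutely_continuous Q P \<and> integrable P (entropy_density (exp 1) Q P)
      then ennreal (KL_divergence (exp 1) Q P) else \<infinity>)"

definition exp_neg :: "ennreal \<Rightarrow> ennreal" where
  "exp_neg a = (if a = \<infinity> then 0 else ennreal (exp (- enn2real a)))"

definition gibbs :: "'a measure \<Rightarrow> ('a \<Rightarrow> ennreal) \<Rightarrow> 'a measure" where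
  "gibbs \<nu> g =
     (let Z = \<integral>\<^sup>+y. exp_neg (g y) \<partial>\<nu> in
      if Z = 0 then \<nu> else density \<nu> (\<lambda>y. exp_neg (g y) / Z))"

text \<open>
  Kernels are indexed by the time of the variable whose law they give: \<open>kX t (x\<^sub>1\<^sub>:\<^sub>t\<^sub>-\<^sub>1, y\<^sub>1\<^sub>:\<^sub>t\<^sub>-\<^sub>1)\<close>
  is a law of \<open>X\<^sub>t\<close>, and \<open>kY t (x\<^sub>1\<^sub>:\<^sub>t, y\<^sub>1\<^sub>:\<^sub>t\<^sub>-\<^sub>1)\<close> a law of \<open>Y\<^sub>t\<close>. Their product
  \<open>joint_kernel Y kX kY t (x\<^sub>1\<^sub>:\<^sub>t\<^sub>-\<^sub>1, y\<^sub>1\<^sub>:\<^sub>t\<^sub>-\<^sub>1)\<close> is a law of \<open>(X\<^sub>t, Y\<^sub>t)\<close>.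
\<close>

type_synonym ('a, 'b, 'c) kernels = "nat \<Rightarrow> (nat \<Rightarrow> 'a) \<times> (nat \<Rightarrow> 'b) \<Rightarrow> 'c measure"

definition semidirect :: "'b measure \<Rightarrow> 'a measure \<Rightarrow> ('a \<Rightarrow> 'b measure) \<Rightarrow> ('a \<times> 'b) measure" where
  \<comment> \<open>\<open>M \<otimes> K\<close> for a kernel \<open>K\<close> into the measurable space of \<open>T\<close>\<close>
  "semidirect T M K = M \<bind> (\<lambda>x. distr (K x) (M \<Otimes>\<^sub>M T) (\<lambda>y. (x, y)))"

definition joint_kernel ::
  "(nat \<Rightarrow> 'b topology) \<Rightarrow> ('a, 'b, 'a) kernels \<Rightarrow> ('a, 'b, 'b) kernels \<Rightarrow> ('a, 'b, 'a \<times> 'b) kernels" where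
  "joint_kernel Y kX kY t p =
     semidirect (borel_of (Y t)) (kX t p) (\<lambda>x'. kY t ((fst p)(t := x'), snd p))"

primrec law_of_kernels ::
  "(nat \<Rightarrow> 'a topology) \<Rightarrow> (nat \<Rightarrow> 'b topology) \<Rightarrow> ('a, 'b, 'a) kernels \<Rightarrow> ('a, 'b, 'b) kernels
    \<Rightarrow> nat \<Rightarrow> ((nat \<Rightarrow> 'a) \<times> (nat \<Rightarrow> 'b)) measure" where
  "law_of_kernels X Y kX kY 0 =
     return (paths X 0 \<Otimes>\<^sub>M paths Y 0) (\<lambda>_. undefined, \<lambda>_. undefined)"
| "law_of_kernels X Y kX kY (Suc t) =
     law_of_kernels X Y kX kY t \<bind> (\<lambda>(x, y).
       distr (joint_kernel Y kX kY (Suc t) (x, y)) (paths X (Suc t) \<Otimes>\<^sub>M paths Y (Suc t))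
         (\<lambda>(x', y'). (x(Suc t := x'), y(Suc t := y'))))"

text \<open>
  In the following \<open>m t x\<^sub>1\<^sub>:\<^sub>t\<^sub>-\<^sub>1\<close> stands for \<open>\<mu>\<^sub>t\<close>, the conditional law of \<open>X\<^sub>t\<close> under \<open>\<mu>\<close>, and \<open>gX\<close>,
  \<open>gY\<close> for the kernels \<open>\<gamma>\<^sub>t\<^sub>,\<^sub>0\<close>, \<open>\<gamma>\<^sub>0\<^sub>,\<^sub>t\<close>.
\<close>

definition opt_X :: "(nat \<Rightarrow> (nat \<Rightarrow> 'a) \<Rightarrow> 'a measure) \<Rightarrow> ('a, 'b, 'a) kernels" where
  \<comment> \<open>\<open>\<pi>\<^sub>t\<^sub>,\<^sub>0\<close>\<close>
  "opt_X m t = (\<lambda>(x, y). m t x)"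

definition opt_Y ::
  "('a, 'b, 'b) kernels \<Rightarrow> (nat \<Rightarrow> (nat \<Rightarrow> 'a) \<times> (nat \<Rightarrow> 'b) \<Rightarrow> ennreal) \<Rightarrow> ('a, 'b, 'b) kernels" where
  \<comment> \<open>\<open>\<pi>\<^sub>0\<^sub>,\<^sub>t\<close>, as a function of the cost functions \<open>f\<close>\<close>
  "opt_Y gY f t = (\<lambda>(x, y). gibbs (gY t (x, y)) (\<lambda>y'. f t (x, y(t := y'))))"

text \<open>The functions \<open>f\<^sub>t\<close>. Only those with \<open>1 \<le> t \<le> N\<close> are of interest.\<close>

function cost ::
  "nat \<Rightarrow> (nat \<Rightarrow> 'b topology) \<Rightarrow> (nat \<Rightarrow> (nat \<Rightarrow> 'a) \<Rightarrow> 'a measure) \<Rightarrow> ('a, 'b, 'a) kernels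
    \<Rightarrow> ('a, 'b, 'b) kernels \<Rightarrow> nat \<Rightarrow> (nat \<Rightarrow> 'a) \<times> (nat \<Rightarrow> 'b) \<Rightarrow> ennreal" where
  "cost N Y m gX gY t =
     (if t < N then
        (\<lambda>(x, y).
           let f' = cost N Y m gX gY (Suc t);
               \<pi>' = joint_kernel Y (opt_X m) (opt_Y gY (\<lambda>_. f')) (Suc t) (x, y);
               \<gamma>' = joint_kernel Y gX gY (Suc t) (x, y)
           in D_KL \<pi>' \<gamma>' + (\<integral>\<^sup>+(x', y'). f' (x(Suc t := x'), y(Suc t := y')) \<partial>\<pi>'))
      else (\<lambda>_. 0))"
  by pat_completeness auto
termination
  by (relation "Wellfounded.measure (\<lambda>(N, Y, m, gX, gY, t). N - t)") auto

declare cost.simps [simp del]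

definition opt_law ::
  "nat \<Rightarrow> (nat \<Rightarrow> 'a topology) \<Rightarrow> (nat \<Rightarrow> 'b topology) \<Rightarrow> (nat \<Rightarrow> (nat \<Rightarrow> 'a) \<Rightarrow> 'a measure)
    \<Rightarrow> ('a, 'b, 'a) kernels \<Rightarrow> ('a, 'b, 'b) kernels \<Rightarrow> ((nat \<Rightarrow> 'a) \<times> (nat \<Rightarrow> 'b)) measure" where
  \<comment> \<open>\<open>\<pi>\<close>\<close>
  "opt_law N X Y m gX gY =
     law_of_kernels X Y (opt_X m) (opt_Y gY (cost N Y m gX gY)) N"

end

theory Submission
  imports Defs
begin

text \<open>
  Truncate a law \<open>\<rho>\<close> and \<open>\<gamma>\<close> at time \<open>t\<close> and put
  \<open>\<Phi>\<^sub>t(\<rho>) = D(\<rho>\<^sub>1\<^sub>:\<^sub>t, \<gamma>\<^sub>1\<^sub>:\<^sub>t) + \<integral> f\<^sub>t d\<rho>\<close>. If \<open>\<rho>\<close> is causal with first marginal \<open>\<mu>\<close>, then the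
  chain rule, applied once to \<open>X\<^sub>t\<^sub>+\<^sub>1\<close> and once to \<open>Y\<^sub>t\<^sub>+\<^sub>1\<close>, and the Gibbs variational identity give
  \<open>\<Phi>\<^sub>t\<^sub>+\<^sub>1(\<rho>) = \<Phi>\<^sub>t(\<rho>) + \<delta>\<^sub>t(\<rho>)\<close>, where \<open>\<delta>\<^sub>t(\<rho>) \<ge> 0\<close> is the divergence of \<open>\<rho>\<^sub>1\<^sub>:\<^sub>t\<^sub>+\<^sub>1\<close> from the law that
  differs from it only in that \<open>Y\<^sub>t\<^sub>+\<^sub>1\<close> is drawn from \<open>\<pi>\<^sub>0\<^sub>,\<^sub>t\<^sub>+\<^sub>1\<close>. As \<open>f\<^sub>N = 0\<close> and \<open>\<Phi>\<^sub>0\<close> is a constant \<open>f\<^sub>0\<close>,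
  this yields \<open>D(\<rho>, \<gamma>) = f\<^sub>0 + \<Sum>\<^sub>t \<delta>\<^sub>t(\<rho>)\<close>, and \<open>\<pi>\<close> is the only causal law all of whose \<open>\<delta>\<^sub>t\<close> vanish.

  All identities hold in \<open>[0, \<infinity>]\<close>, so no integrability is ever needed, and conditional laws of \<open>\<rho>\<close>
  other than \<open>\<mu>\<^sub>t\<close> are avoided by working with densities.
\<close>

subsection \<open>The Kullback-Leibler divergence\<close>

text \<open>The Y-part of a competitor is never disintegrated: its conditional divergence is
  expressed as D(P, M \<otimes> K), with P a joint law, M the first marginal of P itself and K the
  reference kernel, so that only divergences between plain measures occur. Causality enters as the
  statement that the next X-coordinate, given both pasts, has law \<open>m (Suc t)\<close>. The
  X-step therefore costs the same integrand \<open>D_KL (kX (Suc t) z) (gX (Suc t) z)\<close> for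
  every competitor, and only the Y-step leaves a choice. The sum telescopes because f has a closed
  form: applied to its own Gibbs law, the variational identity has divergence 0 and leaves minus the
  logarithm of the normalizer. If normalizers vanish with positive probability, both sides of that
  identity are infinite, whichever kernel the convention selects. The analytic obstacle is the
  measurability of f, since a divergence of two kernels must be measurable in the conditioning path.
  Finiteness of the infimum is what allows the constant value at time 0 to be cancelled in the
  uniqueness argument.\<close>

lemma nn_integral_neg_ln_le_1:
  assumes Q: "prob_space Q" and h [measurable]: "h \<in> borel_measurable Q" and h0: "\<And>x. 0 \<le> h x"
  shows "(\<integral>\<^sup>+x. ennreal (- ln (h x)) \<partial>density Q (\<lambda>x. ennreal (h x))) \<le> 1"
proof -
  interpret Q: prob_space Q by fact
  \<comment> \<open>The bound ln u \<le> u - 1 at u = 1/h gives - h ln h \<le> 1 - h. The density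
    turns the integral of - ln h over P into that of - h ln h over the probability measure
    Q.\<close>
  have *: "h x * - ln (h x) \<le> 1" for x
  proof (cases "h x = 0")
    case False
    then have pos: "0 < h x" using h0[of x] by simp
    then have "- ln (h x) \<le> 1 / h x - 1"
      using ln_le_minus_one[of "1 / h x"] by (simp add: ln_div)
    then have "h x * - ln (h x) \<le> h x * (1 / h x - 1)"
      using pos by (intro mult_left_mono) auto
    also have "\<dots> = 1 - h x" using pos by (simp add: field_simps)
    finally show ?thesis using pos by simp
  qed simp
  have "(\<integral>\<^sup>+x. ennreal (- ln (h x)) \<partial>density Q (\<lambda>x. ennreal (h x)))
      = (\<integral>\<^sup>+x. ennreal (h x) * ennreal (- ln (h x)) \<partial>Q)"
    by (intro nn_integral_density) auto
  also have "\<dots> = (\<integral>\<^sup>+x. ennreal (h x * - ln (h x)) \<partial>Q)"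
    using h0 by (simp add: ennreal_mult'[symmetric])
  also have "\<dots> \<le> (\<integral>\<^sup>+x. 1 \<partial>Q)"
    using * by (intro nn_integral_mono) (auto simp: ennreal_le_1)
  also have "\<dots> = 1" by (simp add: Q.emeasure_space_1)
  finally show ?thesis .
qed

lemma nn_integral_neg_ln_less_top:
  assumes "prob_space Q" and "h \<in> borel_measurable Q" and "\<And>x. 0 \<le> h x"
    and "P = density Q (\<lambda>x. ennreal (h x))"
  shows "(\<integral>\<^sup>+x. ennreal (- ln (h x)) \<partial>P) < \<infinity>"
  using nn_integral_neg_ln_le_1[OF assms(1-3)] unfolding assms(4) by (rule le_less_trans) simp

text \<open>\<open>RN_deriv\<close> is determined only up to Q-null sets, so uniqueness of the
  derivative identifies it with h almost everywhere under Q, hence under P. From here on a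
  conveniently chosen real version h replaces \<open>entropy_density\<close>.\<close>

lemma AE_entropy_density:
  assumes "prob_space Q" and [measurable]: "h \<in> borel_measurable Q" and h0: "\<And>x. 0 \<le> h x"
    and Ph: "P = density Q (\<lambda>x. ennreal (h x))"
  shows "AE x in P. entropy_density (exp 1) Q P x = ln (h x)"
    and "integrable P (entropy_density (exp 1) Q P) \<longleftrightarrow> integrable P (\<lambda>x. ln (h x))"
proof -
  interpret Q: prob_space Q by fact
  have setsP: "sets P = sets Q" by (simp add: Ph)
  have [measurable]: "h \<in> borel_measurable P" by (simp add: Ph)
  have ac: "absolutely_continuous Q P"
    unfolding Ph by (intro absolutely_continuousI_density) auto
  have "AE x in Q. ennreal (h x) = RN_deriv Q P x"
    by (rule Q.RN_deriv_unique) (auto simp: Ph)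
  then have "AE x in P. ennreal (h x) = RN_deriv Q P x"
    by (rule absolutely_continuous_AE[OF setsP ac])
  then show ed: "AE x in P. entropy_density (exp 1) Q P x = ln (h x)"
    by eventually_elim (simp add: entropy_density_def log_def, metis enn2real_ennreal h0)
  have [measurable]: "entropy_density (exp 1) Q P \<in> borel_measurable P"
    unfolding measurable_cong_sets[OF setsP refl] by measurable
  show "integrable P (entropy_density (exp 1) Q P) \<longleftrightarrow> integrable P (\<lambda>x. ln (h x))"
    using ed by (intro integrable_cong_AE) auto
qed

lemma KL_divergence_nonneg:
  assumes Q: "prob_space Q" and P: "prob_space P"
    and "h \<in> borel_measurable Q" and h0: "\<And>x. 0 \<le> h x" and Ph: "P = density Q (\<lambda>x. ennreal (h x))"
    and int: "integrable P (\<lambda>x. ln (h x))"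
  shows "0 \<le> KL_divergence (exp 1) Q P"
proof -
  interpret Q: prob_space Q by fact
  interpret Q: information_space Q "exp 1" by standard simp
  have "integrable Q (\<lambda>x. h x * ln (h x))"
    using int h0 assms(3) unfolding Ph by (subst (asm) integrable_density) auto
  then show ?thesis
    unfolding Ph using P Ph h0 assms(3) by (intro Q.KL_nonneg) (auto simp: log_def)
qed

text \<open>
  The positive and the negative part of \<open>ln h\<close> are kept apart because the divergence may be infinite;
  the integral of the negative part is finite and can always be cancelled.
\<close>

lemma D_KL_density:
  assumes Q: "prob_space Q" and P: "prob_space P"
    and h [measurable]: "h \<in> borel_measurable Q" and h0: "\<And>x. 0 \<le> h x"
    and Ph: "P = density Q (\<lambda>x. ennreal (h x))"
  shows "D_KL P Q + (\<integral>\<^sup>+x. ennreal (- ln (h x)) \<partial>P) = (\<integral>\<^sup>+x. ennreal (ln (h x)) \<partial>P)"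
proof -
  interpret Q: prob_space Q by fact
  interpret P: prob_space P by fact
  define n where "n = (\<integral>\<^sup>+x. ennreal (- ln (h x)) \<partial>P)"
  define p where "p = (\<integral>\<^sup>+x. ennreal (ln (h x)) \<partial>P)"
  have n_fin: "n < \<infinity>"
    unfolding n_def using Q h h0 Ph by (rule nn_integral_neg_ln_less_top)
  have setsP: "sets P = sets Q" by (simp add: Ph)
  have [measurable]: "h \<in> borel_measurable P" by (simp add: Ph)
  have ac: "absolutely_continuous Q P"
    unfolding Ph by (intro absolutely_continuousI_density) auto
  have [measurable]: "entropy_density (exp 1) Q P \<in> borel_measurable P"
    unfolding measurable_cong_sets[OF setsP refl] by measurable
  note ed = AE_entropy_density(1)[OF Q h h0 Ph] and int_iff = AE_entropy_density(2)[OF Q h h0 Ph]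
  show ?thesis
  proof (cases "integrable P (\<lambda>x. ln (h x))")
    case True
    have KL: "KL_divergence (exp 1) Q P = (\<integral>x. ln (h x) \<partial>P)"
      unfolding KL_divergence_def using ed by (intro integral_cong_AE) auto
    have i0: "0 \<le> (\<integral>x. ln (h x) \<partial>P)"
      using KL_divergence_nonneg[OF Q P h h0 Ph True] by (simp add: KL)
    have fin: "p < \<infinity>" "n < \<infinity>"
      using True unfolding real_integrable_def p_def n_def by (auto simp: less_top)
    have "(\<integral>x. ln (h x) \<partial>P) = enn2real p - enn2real n"
      using True unfolding p_def n_def by (rule real_lebesgue_integral_def)
    then have "ennreal (\<integral>x. ln (h x) \<partial>P) + n = p"
      using i0 fin by (cases p; cases n) (auto simp: ennreal_plus[symmetric] simp del: ennreal_plus)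
    then show ?thesis
      using ac int_iff True by (simp add: D_KL_def KL n_def p_def)
  next
    case False
    \<comment> \<open>As n is finite, only the positive part can destroy integrability; this matches
      the infinite branch of \<open>D_KL\<close>.\<close>
    then have "p = \<infinity>"
      using n_fin unfolding real_integrable_def p_def n_def by (auto simp: top_unique)
    then show ?thesis
      using False int_iff unfolding p_def n_def D_KL_def by auto
  qed
qed

text \<open>A density that is real and nonnegative everywhere can be put under \<open>ln\<close>
  without side conditions. Positivity P-almost everywhere suffices, because logarithms of densities
  are always integrated against P.\<close>

lemma RN_deriv_realE:
  assumes "prob_space Q" "prob_space P" "absolutely_continuous Q P" "sets P = sets Q"
  obtains h :: "'a \<Rightarrow> real" where "h \<in> borel_measurable Q" "\<And>x. 0 \<le> h x"
    "P = density Q (\<lambda>x. ennreal (h x))" "AE x in P. 0 < h x"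
proof -
  interpret Q: prob_space Q by fact
  interpret P: prob_space P by fact
  from Q.real_RN_deriv[OF P.finite_measure_axioms assms(3,4)] obtain D
    where D: "D \<in> borel_measurable Q" "AE x in Q. RN_deriv Q P x = ennreal (D x)"
      "AE x in P. 0 < D x" "\<And>x. 0 \<le> D x"
    by this auto
  have "P = density Q (RN_deriv Q P)"
    using assms by (intro Q.density_RN_deriv[symmetric])
  also have "\<dots> = density Q D"
    using D by (intro density_cong) auto
  finally show ?thesis using D that by blast
qed

lemma D_KL_not_ac: "\<not> absolutely_continuous Q P \<Longrightarrow> D_KL P Q = \<infinity>"
  by (simp add: D_KL_def)

lemma D_KL_self: "prob_space P \<Longrightarrow> D_KL P P = 0"
  using D_KL_density[of P P "\<lambda>_. 1"] by (simp add: density_1)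

lemma D_KL_eq_0_imp_eq:
  assumes "prob_space Q" "prob_space P" "sets P = sets Q" "D_KL P Q = 0"
  shows "P = Q"
proof -
  interpret Q: prob_space Q by fact
  interpret P: prob_space P by fact
  interpret Q: information_space Q "exp 1" by standard simp
  have ac: "absolutely_continuous Q P" and int: "integrable P (entropy_density (exp 1) Q P)"
    and "KL_divergence (exp 1) Q P \<le> 0"
    using assms(4) by (auto simp: D_KL_def ennreal_eq_0_iff split: if_splits)
  from RN_deriv_realE[OF assms(1,2) ac assms(3)] obtain h where h:
    "h \<in> borel_measurable Q" "\<And>x. 0 \<le> h x" "P = density Q (\<lambda>x. ennreal (h x))" "AE x in P. 0 < h x"
    by blast
  have "integrable P (\<lambda>x. ln (h x))"
    using int AE_entropy_density(2)[OF assms(1) h(1-3)] by simp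
  \<comment> \<open>\<open>ennreal\<close> sends every nonpositive real to 0, so divergence 0 only
    yields an upper bound on the real number; nonnegativity turns it into an equality.\<close>
  from KL_divergence_nonneg[OF assms(1,2) h(1-3) this] \<open>KL_divergence (exp 1) Q P \<le> 0\<close>
  have "KL_divergence (exp 1) Q P = 0" by simp
  then show ?thesis
    using Q.KL_eq_0_iff_eq_ac[OF assms(2) ac assms(3) int] by simp
qed

text \<open>The \<open>AE\<close> form lets the non-absolutely-continuous cases below be settled
  with the \<open>AE\<close> rules for densities, images and semidirect products.\<close>

lemma absolutely_continuous_AE_iff:
  assumes "sets P = sets Q"
  shows "absolutely_continuous Q P \<longleftrightarrow> (\<forall>A\<in>sets Q. (AE x in Q. x \<notin> A) \<longrightarrow> (AE x in P. x \<notin> A))"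
proof -
  have "(A \<in> null_sets R) \<longleftrightarrow> A \<in> sets R \<and> (AE x in R. x \<notin> A)" for A and R :: "'a measure"
    using AE_iff_null_sets[of A R] by (auto simp: null_sets_def)
  then show ?thesis
    using assms unfolding absolutely_continuous_def by blast
qed

text \<open>Since \<open>ennreal\<close> truncates at 0, \<open>ennreal b\<close> and
  \<open>ennreal (- b)\<close> are the positive and the negative part of b. This is additivity of
  the logarithm of a product of densities, arranged without subtraction so that it can be integrated
  termwise.\<close>

lemma ennreal_signed_add:
  fixes b c :: real
  shows "ennreal (b + c) + ennreal (- b) + ennreal (- c) = ennreal (- (b + c)) + ennreal b + ennreal c"
proof -
  have *: "ennreal x = ennreal (max 0 x)" for x by (auto simp: max_def ennreal_neg)
  have "max 0 (b + c) + max 0 (- b) + max 0 (- c) = max 0 (- (b + c)) + max 0 b + max 0 c" by auto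
  then have "ennreal (max 0 (b + c) + max 0 (- b) + max 0 (- c)) = ennreal (max 0 (- (b + c)) + max 0 b + max 0 c)"
    by simp
  then show ?thesis
    by (simp only: ennreal_plus[OF add_nonneg_nonneg] ennreal_plus max.cobounded1 *[symmetric])
qed

lemma ennreal_add_cancel_right:
  fixes a b c :: ennreal
  assumes "a + c = b + c" "c < \<infinity>"
  shows "a = b"
  using assms by (metis add.commute ennreal_add_left_cancel infinity_ennreal_def less_irrefl)

text \<open>A left inverse g of f suffices: f loses no information, and if h is the density of P
  then h \<circ> g is the density of the image. It serves to switch between a path and the pair of
  its past and its last coordinate.\<close>

lemma D_KL_distr:
  assumes P: "prob_space P" and Q: "prob_space Q" and sets: "sets P = sets Q"
    and f [measurable]: "f \<in> measurable Q N" and g [measurable]: "g \<in> measurable N Q"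
    and gf: "\<And>x. x \<in> space Q \<Longrightarrow> g (f x) = x"
  shows "D_KL (distr P N f) (distr Q N f) = D_KL P Q"
proof -
  let ?P = "distr P N f" and ?Q = "distr Q N f"
  interpret Q: prob_space Q by fact
  interpret P: prob_space P by fact
  note [measurable_cong] = sets
  have sp: "space P = space Q" using sets by (rule sets_eq_imp_space_eq)
  have P': "prob_space ?P" by (rule P.prob_space_distr) measurable
  have Q': "prob_space ?Q" by (rule Q.prob_space_distr) measurable
  show ?thesis
  proof (cases "absolutely_continuous Q P")
    case True
    from RN_deriv_realE[OF Q P True sets] obtain h :: "'a \<Rightarrow> real" where
      h [measurable]: "h \<in> borel_measurable Q" and h0: "\<And>x. 0 \<le> h x"
      and Ph: "P = density Q (\<lambda>x. ennreal (h x))" by blast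
    let ?n = "\<integral>\<^sup>+x. ennreal (- ln (h x)) \<partial>P"
    let ?p = "\<integral>\<^sup>+x. ennreal (ln (h x)) \<partial>P"
    have "?P = density ?Q (\<lambda>x. ennreal (h (g x)))"
    proof (rule measure_eqI)
      fix A assume A [measurable]: "A \<in> sets ?P"
      then have [measurable]: "A \<in> sets N" by simp
      have "emeasure ?P A = (\<integral>\<^sup>+y. indicator A y \<partial>?P)" by simp
      also have "\<dots> = (\<integral>\<^sup>+x. indicator A (f x) \<partial>P)"
        by (rule nn_integral_distr) auto
      also have "\<dots> = (\<integral>\<^sup>+x. ennreal (h x) * indicator A (f x) \<partial>Q)"
        unfolding Ph by (rule nn_integral_density) auto
      also have "\<dots> = (\<integral>\<^sup>+x. ennreal (h (g (f x))) * indicator A (f x) \<partial>Q)"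
        by (intro nn_integral_cong) (simp add: gf)
      also have "\<dots> = emeasure (density ?Q (\<lambda>x. ennreal (h (g x)))) A"
        by (simp add: emeasure_density nn_integral_distr)
      finally show "emeasure ?P A = \<dots>" .
    qed simp
    from D_KL_density[OF Q' P' _ _ this] h0
    have "D_KL ?P ?Q + (\<integral>\<^sup>+x. ennreal (- ln (h (g x))) \<partial>?P)
        = (\<integral>\<^sup>+x. ennreal (ln (h (g x))) \<partial>?P)" by simp
    moreover have "(\<integral>\<^sup>+x. ennreal (- ln (h (g x))) \<partial>?P) = ?n"
      by (auto simp: nn_integral_distr gf sp intro!: nn_integral_cong)
    moreover have "(\<integral>\<^sup>+x. ennreal (ln (h (g x))) \<partial>?P) = ?p"
      by (auto simp: nn_integral_distr gf sp intro!: nn_integral_cong)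
    ultimately have "D_KL ?P ?Q + ?n
        = D_KL P Q + ?n"
      using D_KL_density[OF Q P h h0 Ph] by simp
    moreover have "?n < \<infinity>"
      using Q h h0 Ph by (rule nn_integral_neg_ln_less_top)
    ultimately show ?thesis by (rule ennreal_add_cancel_right)
  next
    case False
    have "\<not> absolutely_continuous ?Q ?P"
    proof
      assume ac: "absolutely_continuous ?Q ?P"
      have "absolutely_continuous Q P"
        unfolding absolutely_continuous_AE_iff[OF sets]
      proof (intro ballI impI)
        fix A assume A [measurable]: "A \<in> sets Q" and AE: "AE x in Q. x \<notin> A"
        have "AE x in ?Q. g x \<notin> A"
          using AE by (subst AE_distr_iff) (auto simp: gf elim: AE_mp)
        then have "AE x in ?P. g x \<notin> A"
          by (rule absolutely_continuous_AE[OF _ ac, rotated]) simp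
        then show "AE x in P. x \<notin> A"
          by (subst (asm) AE_distr_iff) (auto simp: gf sp cong: AE_cong)
      qed
      with False show False ..
    qed
    with False show ?thesis by (simp add: D_KL_not_ac)
  qed
qed

text \<open>If P has density k with respect to R', then it has density w k with respect to R, and
  the logarithms add. The integrals of both parts of ln w may be infinite and stay in the statement;
  only the negative parts of ln k and ln (w k) are known to be finite, and they are
  cancelled.\<close>

lemma D_KL_change_reference:
  assumes P: "prob_space P" and R: "prob_space R" and R': "prob_space R'"
    and w [measurable]: "w \<in> borel_measurable R" and w0: "\<And>x. 0 \<le> w x"
    and R'w: "R' = density R (\<lambda>x. ennreal (w x))"
    and sets: "sets P = sets R" and ac: "absolutely_continuous R' P"
  shows "D_KL P R + (\<integral>\<^sup>+x. ennreal (- ln (w x)) \<partial>P) = D_KL P R' + (\<integral>\<^sup>+x. ennreal (ln (w x)) \<partial>P)"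
proof -
  note [measurable_cong] = sets
  have sets': "sets P = sets R'" by (simp add: R'w sets)
  have [measurable_cong]: "sets R' = sets R" by (simp add: R'w)
  from RN_deriv_realE[OF R' P ac sets'] obtain k :: "'a \<Rightarrow> real" where
    k': "k \<in> borel_measurable R'" and k0: "\<And>x. 0 \<le> k x"
    and Pk: "P = density R' (\<lambda>x. ennreal (k x))" and kpos: "AE x in P. 0 < k x" by blast
  have k [measurable]: "k \<in> borel_measurable R" using k' by simp
  have Pwk: "P = density R (\<lambda>x. ennreal (w x * k x))"
    unfolding Pk R'w using w0 k0 by (subst density_density_eq) (auto simp: ennreal_mult)
  have "AE x in R'. 0 < w x"
    unfolding R'w using w0 by (subst AE_density) (auto simp: less_le)
  then have wpos: "AE x in P. 0 < w x" by (rule absolutely_continuous_AE[OF sets' ac])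
  define nw where "nw = (\<integral>\<^sup>+x. ennreal (- ln (w x)) \<partial>P)"
  define pw where "pw = (\<integral>\<^sup>+x. ennreal (ln (w x)) \<partial>P)"
  define nk where "nk = (\<integral>\<^sup>+x. ennreal (- ln (k x)) \<partial>P)"
  define pk where "pk = (\<integral>\<^sup>+x. ennreal (ln (k x)) \<partial>P)"
  define n where "n = (\<integral>\<^sup>+x. ennreal (- ln (w x * k x)) \<partial>P)"
  define p where "p = (\<integral>\<^sup>+x. ennreal (ln (w x * k x)) \<partial>P)"
  have "p + nw + nk = (\<integral>\<^sup>+x. ennreal (ln (w x * k x)) + ennreal (- ln (w x)) + ennreal (- ln (k x)) \<partial>P)"
    unfolding p_def nw_def nk_def by (simp add: nn_integral_add)
  also have "\<dots> = (\<integral>\<^sup>+x. ennreal (- ln (w x * k x)) + ennreal (ln (w x)) + ennreal (ln (k x)) \<partial>P)"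
    using wpos kpos
    by (intro nn_integral_cong_AE, eventually_elim) (simp add: ln_mult ennreal_signed_add[simplified])
  also have "\<dots> = n + pw + pk"
    unfolding n_def pw_def pk_def by (simp add: nn_integral_add)
  finally have eq: "p + nw + nk = n + pw + pk" .
  have "D_KL P R + n = p"
    unfolding n_def p_def by (rule D_KL_density[OF R P _ _ Pwk]) (use w0 k0 in auto)
  moreover have "D_KL P R' + nk = pk"
    unfolding nk_def pk_def by (rule D_KL_density[OF R' P k' k0 Pk])
  ultimately have "(D_KL P R + n) + nw + nk = n + pw + (D_KL P R' + nk)"
    using eq by simp
  then have "(D_KL P R + nw) + (n + nk) = (D_KL P R' + pw) + (n + nk)"
    by (simp only: ac_simps)
  moreover have "n < \<infinity>"
    unfolding n_def by (rule nn_integral_neg_ln_less_top[OF R _ _ Pwk]) (use w0 k0 in auto)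
  moreover have "nk < \<infinity>"
    unfolding nk_def by (rule nn_integral_neg_ln_less_top[OF R' k' k0 Pk])
  ultimately show ?thesis unfolding nw_def pw_def
    by (elim ennreal_add_cancel_right) auto
qed

subsection \<open>Kernels and chain rules\<close>

context
  fixes M :: "'a measure" and T :: "'b measure" and K :: "'a \<Rightarrow> 'b measure"
  assumes K [measurable]: "K \<in> measurable M (prob_algebra T)"
begin

lemma kernel_subprob [measurable]: "K \<in> measurable M (subprob_algebra T)"
  using K by (rule measurable_prob_algebraD)

lemma kernel_prob_space: "x \<in> space M \<Longrightarrow> prob_space (K x)"
  and kernel_sets: "x \<in> space M \<Longrightarrow> sets (K x) = sets T"
  and kernel_space: "x \<in> space M \<Longrightarrow> space (K x) = space T"
  using measurable_space[OF K] by (auto simp: space_prob_algebra dest: sets_eq_imp_space_eq)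

lemma kernel_emeasure_space: "x \<in> space M \<Longrightarrow> emeasure (K x) (space T) = 1"
  using prob_space.emeasure_space_1[OF kernel_prob_space] kernel_space by metis

lemma semidirect_kernel: "(\<lambda>x. distr (K x) (M \<Otimes>\<^sub>M T) (\<lambda>y. (x, y))) \<in> measurable M (prob_algebra (M \<Otimes>\<^sub>M T))"
  by (rule measurable_distr_prob_space2[OF K]) simp

lemma nn_integral_semidirect:
  assumes f [measurable]: "f \<in> borel_measurable (M \<Otimes>\<^sub>M T)"
  shows "(\<integral>\<^sup>+z. f z \<partial>semidirect T M K) = (\<integral>\<^sup>+x. \<integral>\<^sup>+y. f (x, y) \<partial>K x \<partial>M)"
proof -
  have "(\<integral>\<^sup>+z. f z \<partial>semidirect T M K) = (\<integral>\<^sup>+x. \<integral>\<^sup>+z. f z \<partial>distr (K x) (M \<Otimes>\<^sub>M T) (\<lambda>y. (x, y)) \<partial>M)"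
    unfolding semidirect_def
    by (rule nn_integral_bind[OF f]) (rule measurable_prob_algebraD[OF semidirect_kernel])
  also have "\<dots> = (\<integral>\<^sup>+x. \<integral>\<^sup>+y. f (x, y) \<partial>K x \<partial>M)"
    by (intro nn_integral_cong nn_integral_distr)
      (auto simp: measurable_cong_sets[OF kernel_sets refl])
  finally show ?thesis .
qed

lemma AE_semidirect:
  assumes [measurable]: "Measurable.pred (M \<Otimes>\<^sub>M T) Q"
  shows "(AE z in semidirect T M K. Q z) \<longleftrightarrow> (AE x in M. AE y in K x. Q (x, y))"
proof -
  have "(AE z in semidirect T M K. Q z)
      \<longleftrightarrow> (AE x in M. AE z in distr (K x) (M \<Otimes>\<^sub>M T) (\<lambda>y. (x, y)). Q z)"
    unfolding semidirect_def
    by (rule AE_bind[OF measurable_prob_algebraD[OF semidirect_kernel]]) simp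
  also have "\<dots> \<longleftrightarrow> (AE x in M. AE y in K x. Q (x, y))"
    by (intro AE_cong AE_distr_iff) (auto simp: measurable_cong_sets[OF kernel_sets refl])
  finally show ?thesis .
qed

lemma measurable_kernel_nn_integral:
  assumes [measurable]: "f \<in> borel_measurable (M \<Otimes>\<^sub>M T)"
  shows "(\<lambda>x. \<integral>\<^sup>+y. f (x, y) \<partial>K x) \<in> borel_measurable M"
  by (rule nn_integral_measurable_subprob_algebra2[where N = T]) auto

context
  assumes M: "prob_space M"
begin

lemma semidirect_in_prob_algebra: "semidirect T M K \<in> space (prob_algebra (M \<Otimes>\<^sub>M T))"
  unfolding semidirect_def
  using prob_space_bind'[OF _ semidirect_kernel] sets_bind'[OF _ semidirect_kernel] M
  by (simp add: space_prob_algebra)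

lemma sets_semidirect [measurable_cong]: "sets (semidirect T M K) = sets (M \<Otimes>\<^sub>M T)"
  and prob_space_semidirect: "prob_space (semidirect T M K)"
  using semidirect_in_prob_algebra by (auto simp: space_prob_algebra)

lemma space_semidirect: "space (semidirect T M K) = space (M \<Otimes>\<^sub>M T)"
  using sets_semidirect by (rule sets_eq_imp_space_eq)

lemma emeasure_semidirect:
  assumes A [measurable]: "A \<in> sets (M \<Otimes>\<^sub>M T)"
  shows "emeasure (semidirect T M K) A = (\<integral>\<^sup>+x. \<integral>\<^sup>+y. indicator A (x, y) \<partial>K x \<partial>M)"
  by (subst nn_integral_semidirect[symmetric]) (auto simp: sets_semidirect)

lemma emeasure_semidirect_Times:
  assumes [measurable]: "A \<in> sets M" "B \<in> sets T"
  shows "emeasure (semidirect T M K) (A \<times> B) = (\<integral>\<^sup>+x. indicator A x * emeasure (K x) B \<partial>M)"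
proof -
  have "emeasure (semidirect T M K) (A \<times> B) = (\<integral>\<^sup>+x. \<integral>\<^sup>+y. indicator (A \<times> B) (x, y) \<partial>K x \<partial>M)"
    by (rule emeasure_semidirect) auto
  also have "\<dots> = (\<integral>\<^sup>+x. \<integral>\<^sup>+y. indicator A x * indicator B y \<partial>K x \<partial>M)"
    by (simp add: indicator_times)
  also have "\<dots> = (\<integral>\<^sup>+x. indicator A x * emeasure (K x) B \<partial>M)"
    by (intro nn_integral_cong) (simp add: kernel_sets nn_integral_cmult)
  finally show ?thesis .
qed

lemma distr_semidirect_fst: "distr (semidirect T M K) M fst = M"
proof (rule measure_eqI)
  fix A assume "A \<in> sets (distr (semidirect T M K) M fst)"
  then have A [measurable]: "A \<in> sets M" by simp
  have "emeasure (distr (semidirect T M K) M fst) A = emeasure (semidirect T M K) (A \<times> space T)"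
    using sets.sets_into_space[OF A]
    by (subst emeasure_distr) (auto simp: space_semidirect space_pair_measure intro!: arg_cong2[where f = emeasure])
  also have "\<dots> = (\<integral>\<^sup>+x. indicator A x \<partial>M)"
    by (subst emeasure_semidirect_Times)
      (auto intro!: nn_integral_cong simp: kernel_emeasure_space simp del: nn_integral_indicator)
  finally show "emeasure (distr (semidirect T M K) M fst) A = emeasure M A" by simp
qed simp

end
end

lemma semidirect_density_fst:
  assumes M: "prob_space M" and M': "prob_space M'" and K': "K \<in> measurable M' (prob_algebra T)"
    and u [measurable]: "u \<in> borel_measurable M'" and Mu: "M = density M' u"
  shows "semidirect T M K = density (semidirect T M' K) (\<lambda>z. u (fst z))"
proof (rule measure_eqI)
  note [measurable] = K' kernel_subprob[OF K'] and [measurable_cong] = sets_semidirect[OF K' M']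
  have [measurable_cong]: "sets M = sets M'" by (simp add: Mu)
  have K: "K \<in> measurable M (prob_algebra T)" by measurable
  show "sets (semidirect T M K) = sets (density (semidirect T M' K) (\<lambda>z. u (fst z)))"
    unfolding sets_density sets_semidirect[OF K M] sets_semidirect[OF K' M']
    by (rule sets_pair_measure_cong) (simp_all add: Mu)
  fix A assume "A \<in> sets (semidirect T M K)"
  then have A': "A \<in> sets (M \<Otimes>\<^sub>M T)" by (simp add: sets_semidirect[OF K M])
  have A [measurable]: "A \<in> sets (M' \<Otimes>\<^sub>M T)"
    using A' by (simp add: Mu cong: sets_pair_measure_cong)
  note mK [measurable] = measurable_kernel_nn_integral[OF K']
  have "emeasure (semidirect T M K) A = (\<integral>\<^sup>+x. \<integral>\<^sup>+y. indicator A (x, y) \<partial>K x \<partial>M)"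
    by (rule emeasure_semidirect[OF K M A'])
  also have "\<dots> = (\<integral>\<^sup>+x. u x * (\<integral>\<^sup>+y. indicator A (x, y) \<partial>K x) \<partial>M')"
    unfolding Mu by (rule nn_integral_density) (auto intro!: mK)
  also have "\<dots> = (\<integral>\<^sup>+x. \<integral>\<^sup>+y. u x * indicator A (x, y) \<partial>K x \<partial>M')"
    by (intro nn_integral_cong nn_integral_cmult[symmetric])
      (auto simp: measurable_cong_sets[OF kernel_sets[OF K'] refl])
  also have "\<dots> = (\<integral>\<^sup>+z. u (fst z) * indicator A z \<partial>semidirect T M' K)"
    by (subst nn_integral_semidirect[OF K']) auto
  also have "\<dots> = emeasure (density (semidirect T M' K) (\<lambda>z. u (fst z))) A"
    by (rule emeasure_density[symmetric]) auto
  finally show "emeasure (semidirect T M K) A = \<dots>" .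
qed

lemma semidirect_density_kernel:
  assumes M: "prob_space M" and K: "K \<in> measurable M (prob_algebra T)" and G: "G \<in> measurable M (prob_algebra T)"
    and w [measurable]: "w \<in> borel_measurable (M \<Otimes>\<^sub>M T)"
    and Gw: "\<And>x. x \<in> space M \<Longrightarrow> G x = density (K x) (\<lambda>y. w (x, y))"
  shows "semidirect T M G = density (semidirect T M K) w"
proof (rule measure_eqI)
  note [measurable] = K G and [measurable_cong] = sets_semidirect[OF K M]
  show "sets (semidirect T M G) = sets (density (semidirect T M K) w)"
    by (simp add: sets_semidirect K M G)
  fix A assume "A \<in> sets (semidirect T M G)"
  then have A [measurable]: "A \<in> sets (M \<Otimes>\<^sub>M T)" by (simp add: sets_semidirect[OF G M])
  have "emeasure (semidirect T M G) A = (\<integral>\<^sup>+x. \<integral>\<^sup>+y. indicator A (x, y) \<partial>G x \<partial>M)"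
    by (rule emeasure_semidirect[OF G M A])
  also have "\<dots> = (\<integral>\<^sup>+x. \<integral>\<^sup>+y. w (x, y) * indicator A (x, y) \<partial>K x \<partial>M)"
    by (intro nn_integral_cong, subst Gw, simp, intro nn_integral_density)
      (auto simp: measurable_cong_sets[OF kernel_sets[OF K] refl])
  also have "\<dots> = (\<integral>\<^sup>+z. w z * indicator A z \<partial>semidirect T M K)"
    by (subst nn_integral_semidirect[OF K]) auto
  also have "\<dots> = emeasure (density (semidirect T M K) w) A"
    by (rule emeasure_density[symmetric]) auto
  finally show "emeasure (semidirect T M G) A = \<dots>" .
qed

text \<open>Chain rule in which the conditional term is a divergence from M \<otimes> K, so that P
  needs no conditional law. With u = dM/dM', the measure M \<otimes> K has density u(x) with respect
  to M' \<otimes> K, and changing the reference between them costs the integral of ln u over M,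
  which is D(M, M'). If absolute continuity fails anywhere, both sides are infinite.\<close>

lemma D_KL_semidirect_marginal:
  assumes M': "prob_space M'" and K': "K \<in> measurable M' (prob_algebra T)"
    and P: "prob_space P" and sets: "sets P = sets (M' \<Otimes>\<^sub>M T)" and M_def: "M = distr P M' fst"
  shows "D_KL P (semidirect T M' K) = D_KL M M' + D_KL P (semidirect T M K)"
    (is "D_KL P ?R = _ + D_KL P ?R'")
proof -
  interpret P: prob_space P by fact
  note [measurable_cong] = sets sets_semidirect[OF K' M']
  have sM [measurable_cong]: "sets M = sets M'" by (simp add: M_def)
  have M: "prob_space M" unfolding M_def by (rule P.prob_space_distr) simp
  note [measurable] = K'
  have K: "K \<in> measurable M (prob_algebra T)" by measurable
  have R: "prob_space ?R" by (rule prob_space_semidirect[OF K' M'])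
  have R': "prob_space ?R'" by (rule prob_space_semidirect[OF K M])
  have setsR: "sets P = sets ?R" by (simp add: sets sets_semidirect[OF K' M'])
  have setsR': "sets P = sets ?R'" 
    by (simp add: sets sets_semidirect[OF K M] sM cong: sets_pair_measure_cong)
  have AE_M: "(AE x in M. Q x) \<longleftrightarrow> (AE z in P. Q (fst z))" if [measurable]: "Measurable.pred M' Q" for Q
    unfolding M_def by (rule AE_distr_iff) auto
  show ?thesis
  proof (cases "absolutely_continuous M' M")
    case True
    from RN_deriv_realE[OF M' M True sM] obtain u :: "'a \<Rightarrow> real" where
      u [measurable]: "u \<in> borel_measurable M'" and u0: "\<And>x. 0 \<le> u x"
      and Mu: "M = density M' (\<lambda>x. ennreal (u x))" and upos: "AE x in M. 0 < u x" by blast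
    have upos': "AE z in P. 0 < u (fst z)" using upos by (subst (asm) AE_M) auto
    have R'u: "?R' = density ?R (\<lambda>z. ennreal (u (fst z)))"
      by (rule semidirect_density_fst[OF M M' K' _ Mu]) simp
    show ?thesis
    proof (cases "absolutely_continuous ?R' P")
      case True
      let ?n = "\<integral>\<^sup>+x. ennreal (- ln (u x)) \<partial>M"
      let ?p = "\<integral>\<^sup>+x. ennreal (ln (u x)) \<partial>M"
      have "D_KL P ?R + (\<integral>\<^sup>+z. ennreal (- ln (u (fst z))) \<partial>P) = D_KL P ?R' + (\<integral>\<^sup>+z. ennreal (ln (u (fst z))) \<partial>P)"
        by (rule D_KL_change_reference[OF P R R' _ _ R'u setsR True]) (use u0 in auto)
      moreover have "(\<integral>\<^sup>+z. ennreal (- ln (u (fst z))) \<partial>P) = ?n"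
        unfolding M_def by (rule nn_integral_distr[symmetric]) auto
      moreover have "(\<integral>\<^sup>+z. ennreal (ln (u (fst z))) \<partial>P) = ?p"
        unfolding M_def by (rule nn_integral_distr[symmetric]) auto
      moreover have "D_KL M M' + ?n = ?p"
        by (rule D_KL_density[OF M' M u u0 Mu])
      ultimately have "D_KL P ?R + ?n
          = D_KL M M' + D_KL P ?R' + ?n"
        by (metis add.assoc add.commute)
      moreover have "?n < \<infinity>"
        by (rule nn_integral_neg_ln_less_top[OF M' u u0 Mu])
      ultimately show ?thesis by (rule ennreal_add_cancel_right)
    next
      case False
      have "\<not> absolutely_continuous ?R P"
      proof
        assume ac: "absolutely_continuous ?R P"
        have "absolutely_continuous ?R' P"
          unfolding absolutely_continuous_AE_iff[OF setsR']
        proof (intro ballI impI)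
          fix A assume "A \<in> sets ?R'" and AE: "AE z in ?R'. z \<notin> A"
          then have [measurable]: "A \<in> sets ?R" using setsR setsR' by simp
          \<comment> \<open>A null set of \<open>?R'\<close> is a null set of \<open>?R\<close>
            where u is positive, and P is concentrated there.\<close>
          have "AE z in ?R. 0 < u (fst z) \<longrightarrow> z \<notin> A"
            using AE unfolding R'u by (subst (asm) AE_density) auto
          then have "AE z in P. 0 < u (fst z) \<longrightarrow> z \<notin> A"
            by (rule absolutely_continuous_AE[OF setsR ac])
          with upos' show "AE z in P. z \<notin> A" by eventually_elim auto
        qed
        with False show False ..
      qed
      with False show ?thesis by (simp add: D_KL_not_ac)
    qed
  next
    case False
    have "\<not> absolutely_continuous ?R P"
    proof
      assume ac: "absolutely_continuous ?R P"
      have "absolutely_continuous M' M"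
        unfolding absolutely_continuous_AE_iff[OF sM]
      proof (intro ballI impI)
        fix A assume [measurable]: "A \<in> sets M'" and AE: "AE z in M'. z \<notin> A"
        have "AE z in ?R. fst z \<notin> A"
          using AE by (subst AE_semidirect[OF K']) auto
        then have "AE z in P. fst z \<notin> A"
          by (rule absolutely_continuous_AE[OF setsR ac])
        then show "AE x in M. x \<notin> A" by (subst AE_M) auto
      qed
      with False show False ..
    qed
    with False show ?thesis by (simp add: D_KL_not_ac)
  qed
qed

section \<open>Gibbs kernels and the variational identity\<close>

lemma measurable_exp_neg [measurable]: "exp_neg \<in> borel_measurable borel"
  unfolding exp_neg_def[abs_def] by measurable

lemma exp_neg_le_1: "exp_neg a \<le> 1"
  by (simp add: exp_neg_def)

lemma exp_neg_eq_0_iff: "exp_neg a = 0 \<longleftrightarrow> a = \<infinity>"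
  by (simp add: exp_neg_def)

text \<open>The value \<infinity> at 0 encodes - ln 0. Arguments above 1 would be truncated to 0,
  but it is meant for normalizing integrals over probability measures, which are at most 1.\<close>

definition neg_ln :: "ennreal \<Rightarrow> ennreal" where
  "neg_ln a = (if a = 0 then \<infinity> else ennreal (- ln (enn2real a)))"

lemma measurable_neg_ln [measurable]: "neg_ln \<in> borel_measurable borel"
  unfolding neg_ln_def[abs_def] by measurable

text \<open>Both branches of the convention become one density, constantly 1 when the normalizer
  vanishes; in this form joint measurability in a parameter can be checked.\<close>

lemma gibbs_eq_density:
  "gibbs \<nu> g = density \<nu> (\<lambda>y. if (\<integral>\<^sup>+y. exp_neg (g y) \<partial>\<nu>) = 0 then 1 else exp_neg (g y) / (\<integral>\<^sup>+y. exp_neg (g y) \<partial>\<nu>))"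
  by (simp add: gibbs_def Let_def density_1)

lemma nn_integral_exp_neg_le_1:
  assumes "prob_space \<nu>"
  shows "(\<integral>\<^sup>+y. exp_neg (g y) \<partial>\<nu>) \<le> 1"
proof -
  interpret prob_space \<nu> by fact
  have "(\<integral>\<^sup>+y. exp_neg (g y) \<partial>\<nu>) \<le> (\<integral>\<^sup>+y. 1 \<partial>\<nu>)"
    by (intro nn_integral_mono exp_neg_le_1)
  then show ?thesis by (simp add: emeasure_space_1)
qed

lemma prob_space_gibbs:
  assumes "prob_space \<nu>" and [measurable]: "g \<in> borel_measurable \<nu>"
  shows "prob_space (gibbs \<nu> g)"
proof (cases "(\<integral>\<^sup>+y. exp_neg (g y) \<partial>\<nu>) = 0")
  case True
  then show ?thesis using assms by (simp add: gibbs_def Let_def)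
next
  case False
  have "(\<integral>\<^sup>+y. exp_neg (g y) \<partial>\<nu>) < \<infinity>"
    using nn_integral_exp_neg_le_1[OF assms(1), of g] by (rule le_less_trans) simp
  then show ?thesis
    using False
    by (intro prob_spaceI) (simp add: gibbs_def Let_def emeasure_density nn_integral_divide ennreal_divide_self
        cong: nn_integral_cong)
qed

lemma measurable_gibbs:
  assumes K [measurable]: "K \<in> measurable M (prob_algebra T)" and f [measurable]: "f \<in> borel_measurable (M \<Otimes>\<^sub>M T)"
  shows "(\<lambda>x. gibbs (K x) (\<lambda>y. f (x, y))) \<in> measurable M (prob_algebra T)"
proof -
  have KT: "measurable (K x) N = measurable T N" if "x \<in> space M" for x and N :: "ennreal measure"
    using kernel_sets[OF K that] by (rule measurable_cong_sets) simp
  define Z where "Z x = (\<integral>\<^sup>+y. exp_neg (f (x, y)) \<partial>K x)" for x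
  have Z [measurable]: "Z \<in> borel_measurable M"
    unfolding Z_def using measurable_kernel_nn_integral[OF K, of "\<lambda>z. exp_neg (f z)"] by simp
  have prob: "prob_space (gibbs (K x) (\<lambda>y. f (x, y)))" if "x \<in> space M" for x
    using that by (intro prob_space_gibbs kernel_prob_space[OF K]) (simp_all add: KT)
  show ?thesis
  proof (rule measurable_prob_algebraI[OF prob measurable_subprob_algebra])
    fix x assume x: "x \<in> space M"
    then show "subprob_space (gibbs (K x) (\<lambda>y. f (x, y)))"
      by (intro prob_space_imp_subprob_space prob)
    show "sets (gibbs (K x) (\<lambda>y. f (x, y))) = sets T"
      using kernel_sets[OF K x] by (simp add: gibbs_eq_density)
  next
    fix A assume [measurable]: "A \<in> sets T"
    let ?g = "\<lambda>(x, y). (if Z x = 0 then 1 else exp_neg (f (x, y)) / Z x) * indicator A y"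
    have "emeasure (gibbs (K x) (\<lambda>y. f (x, y))) A
      = (\<integral>\<^sup>+y. ?g (x, y) \<partial>K x)"
      if "x \<in> space M" for x
      using that unfolding gibbs_eq_density Z_def
      by (subst emeasure_density) (auto simp: KT kernel_sets[OF K])
    moreover have "(\<lambda>x. \<integral>\<^sup>+y. ?g (x, y) \<partial>K x)
      \<in> borel_measurable M"
      by (rule measurable_kernel_nn_integral[OF K]) measurable
    ultimately show "(\<lambda>x. emeasure (gibbs (K x) (\<lambda>y. f (x, y))) A) \<in> borel_measurable M"
      by (simp cong: measurable_cong)
  qed auto
qed

text \<open>The Gibbs density w = exp(-f)/Z satisfies f + ln w = - ln Z, so changing the reference
  from M \<otimes> K to the Gibbs law exchanges the integral of f for that of - ln Z. The last term
  depends on P only through its marginal M, which makes the Gibbs law the minimizer of the left-hand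
  side. The case distinctions establish the identity when terms are infinite.\<close>

lemma D_KL_gibbs:
  assumes M: "prob_space M" and K: "K \<in> measurable M (prob_algebra T)"
    and f [measurable]: "f \<in> borel_measurable (M \<Otimes>\<^sub>M T)"
    and P: "prob_space P" and sets: "sets P = sets (M \<Otimes>\<^sub>M T)" and marginal: "distr P M fst = M"
  shows "D_KL P (semidirect T M K) + (\<integral>\<^sup>+z. f z \<partial>P)
    = D_KL P (semidirect T M (\<lambda>x. gibbs (K x) (\<lambda>y. f (x, y))))
      + (\<integral>\<^sup>+x. neg_ln (\<integral>\<^sup>+y. exp_neg (f (x, y)) \<partial>K x) \<partial>M)"
    (is "D_KL P ?R + ?F = D_KL P ?R' + _")
proof -
  define Z where "Z x = (\<integral>\<^sup>+y. exp_neg (f (x, y)) \<partial>K x)" for x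
  have Z [measurable]: "Z \<in> borel_measurable M"
    unfolding Z_def using measurable_kernel_nn_integral[OF K, of "\<lambda>z. exp_neg (f z)"] by simp
  have Z1: "Z x \<le> 1" if "x \<in> space M" for x
    unfolding Z_def by (intro nn_integral_exp_neg_le_1 kernel_prob_space[OF K that])
  note [measurable] = K and [measurable_cong] = sets sets_semidirect[OF K M]
  define G where "G x = gibbs (K x) (\<lambda>y. f (x, y))" for x
  have G: "G \<in> measurable M (prob_algebra T)"
    unfolding G_def by (rule measurable_gibbs[OF K f])
  define w where "w z = (if Z (fst z) = 0 then 1 else enn2real (exp_neg (f z) / Z (fst z)))" for z
  have [measurable]: "w \<in> borel_measurable (M \<Otimes>\<^sub>M T)" unfolding w_def by measurable
  have w0: "0 \<le> w z" for z by (simp add: w_def)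
  have w_eq: "ennreal (w z) = (if Z (fst z) = 0 then 1 else exp_neg (f z) / Z (fst z))" for z
    using exp_neg_le_1[of "f z"]
    by (auto simp: w_def ennreal_divide_eq_top_iff less_top[symmetric] top_unique intro!: ennreal_enn2real)
  let ?G = "semidirect T M G"
  have R: "prob_space ?R" by (rule prob_space_semidirect[OF K M])
  have R': "prob_space ?G" by (rule prob_space_semidirect[OF G M])
  have wm: "(\<lambda>z. ennreal (w z)) \<in> borel_measurable (M \<Otimes>\<^sub>M T)" by measurable
  have R'w: "?G = density ?R (\<lambda>z. ennreal (w z))"
    by (rule semidirect_density_kernel[OF M K G wm]) (simp add: G_def gibbs_eq_density w_eq Z_def cong: if_cong)
  have setsR: "sets P = sets ?R" by (simp add: sets sets_semidirect[OF K M])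
  have setsR': "sets P = sets ?G" by (simp add: setsR R'w)
  have spP: "space P = space (M \<Otimes>\<^sub>M T)" using sets by (rule sets_eq_imp_space_eq)
  have AE_M: "(AE x in M. Q x) \<longleftrightarrow> (AE z in P. Q (fst z))" if [measurable]: "Measurable.pred M Q" for Q
    by (subst marginal[symmetric], rule AE_distr_iff) auto
  define V where "V = (\<integral>\<^sup>+x. neg_ln (Z x) \<partial>M)"
  have V_P: "V = (\<integral>\<^sup>+z. neg_ln (Z (fst z)) \<partial>P)"
    unfolding V_def by (subst marginal[symmetric], rule nn_integral_distr) auto
  have AE_f: "AE z in P. f z \<noteq> \<infinity>" if "?F \<noteq> \<infinity>"
    using that by (intro nn_integral_PInf_AE) auto
  have "D_KL P ?R + ?F = D_KL P ?G + V"
  proof (cases "AE x in M. Z x \<noteq> 0")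
    case True
    then have Zpos: "AE z in P. Z (fst z) \<noteq> 0" by (subst (asm) AE_M) auto
    show ?thesis
    proof (cases "absolutely_continuous ?G P")
      case True
      define nw where "nw = (\<integral>\<^sup>+z. ennreal (- ln (w z)) \<partial>P)"
      define pw where "pw = (\<integral>\<^sup>+z. ennreal (ln (w z)) \<partial>P)"
      have eq: "D_KL P ?R + nw = D_KL P ?G + pw"
        unfolding nw_def pw_def
        by (rule D_KL_change_reference[OF P R R' _ w0 R'w setsR True]) simp
      have "AE z in ?G. w z \<noteq> 0"
        unfolding R'w by (subst AE_density) auto
      then have "AE z in P. w z \<noteq> 0"
        by (rule absolutely_continuous_AE[OF setsR' True])
      \<comment> \<open>With f = a and Z = c in (0, 1], ln w = - ln c - a is a difference of two
        nonnegative numbers. The two inequalities bound its positive and negative parts by these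
        numbers; they are needed when the negative part has infinite integral.\<close>
      then have pw_ae: "AE z in P. ennreal (ln (w z)) + f z = ennreal (- ln (w z)) + neg_ln (Z (fst z))
          \<and> ennreal (ln (w z)) \<le> neg_ln (Z (fst z)) \<and> ennreal (- ln (w z)) \<le> f z"
        using Zpos AE_space
      proof eventually_elim
        fix z assume wz: "w z \<noteq> 0" and Zz: "Z (fst z) \<noteq> 0" and "z \<in> space P"
        then have "Z (fst z) \<le> 1" by (intro Z1) (auto simp: spP space_pair_measure)
        then obtain c where c: "Z (fst z) = ennreal c" "0 < c" "c \<le> 1"
          using Zz by (cases "Z (fst z)") (auto simp: top_unique)
        have "f z \<noteq> \<infinity>" using wz Zz by (auto simp: w_def exp_neg_def)
        then obtain a where a: "f z = ennreal a" "0 \<le> a" by (cases "f z") auto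
        have "w z = exp (- a) / c"
          using a c by (simp add: w_def exp_neg_def divide_ennreal)
        then have lnw: "ln (w z) = - ln c - a" using c by (simp add: ln_div)
        have "ln c \<le> 0" using c by simp
        then have V: "neg_ln (Z (fst z)) = ennreal (- ln c)" using c by (simp add: neg_ln_def)
        have *: "ennreal (- ln c - a) + ennreal a = ennreal (- (- ln c - a)) + ennreal (- ln c)"
          using a \<open>ln c \<le> 0\<close>
          by (cases "- ln c \<le> a") (auto simp: ennreal_neg ennreal_plus[symmetric] simp del: ennreal_plus)
        show "ennreal (ln (w z)) + f z = ennreal (- ln (w z)) + neg_ln (Z (fst z))
          \<and> ennreal (ln (w z)) \<le> neg_ln (Z (fst z)) \<and> ennreal (- ln (w z)) \<le> f z"
          using * a \<open>ln c \<le> 0\<close> unfolding lnw V a(1) by (auto intro!: ennreal_leI)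
      qed
      have "pw + ?F = nw + V"
        unfolding pw_def nw_def V_P using pw_ae
        by (subst (1 2) nn_integral_add[symmetric]) (auto intro!: nn_integral_cong_AE elim: AE_mp)
      then have *: "D_KL P ?R + ?F + nw = D_KL P ?G + V + nw"
        using eq by (metis add.assoc add.commute)
      show ?thesis
      proof (cases "nw < \<infinity>")
        case True
        with * show ?thesis by (rule ennreal_add_cancel_right)
      next
        case False
        then have nw: "nw = \<infinity>" by (simp add: less_top[symmetric])
        \<comment> \<open>Cancellation is impossible here, but both sides are infinite: the left one
          through \<open>?F\<close>, the right one because \<open>D_KL P ?G + pw\<close> is infinite
          and \<open>pw\<close> is at most \<open>V\<close>.\<close>
        have "nw \<le> ?F" unfolding nw_def
          using pw_ae by (intro nn_integral_mono_AE) (auto elim: AE_mp)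
        moreover have "pw \<le> V" unfolding pw_def V_P
          using pw_ae by (intro nn_integral_mono_AE) (auto elim: AE_mp)
        moreover have "D_KL P ?G + pw = \<infinity>" using eq nw by simp
        ultimately show ?thesis using nw by (auto simp: top_unique)
      qed
    next
      case False
      \<comment> \<open>If both were finite, then f < \<infinity> and Z > 0 would make the density w
        positive P-almost everywhere, so that absolute continuity would pass from \<open>?R\<close>
        to \<open>?G\<close>.\<close>
      have "D_KL P ?R = \<infinity> \<or> ?F = \<infinity>"
      proof (rule ccontr)
        assume "\<not> ?thesis"
        then have "D_KL P ?R \<noteq> \<infinity>" and F: "?F \<noteq> \<infinity>" by auto
        then have ac: "absolutely_continuous ?R P" using D_KL_not_ac by blast
        have "absolutely_continuous ?G P"
          unfolding absolutely_continuous_AE_iff[OF setsR']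
        proof (intro ballI impI)
          fix A assume "A \<in> sets ?G" and AE: "AE z in ?G. z \<notin> A"
          then have [measurable]: "A \<in> sets ?R" using setsR setsR' by simp
          have "AE z in ?R. 0 < w z \<longrightarrow> z \<notin> A"
            using AE unfolding R'w by (subst (asm) AE_density) auto
          then have "AE z in P. 0 < w z \<longrightarrow> z \<notin> A"
            by (rule absolutely_continuous_AE[OF setsR ac])
          moreover note Zpos AE_f[OF F] AE_space
          ultimately show "AE z in P. z \<notin> A"
          proof eventually_elim
            case (elim z)
            then have "Z (fst z) \<le> 1" by (intro Z1) (auto simp: spP space_pair_measure)
            then have "Z (fst z) \<noteq> \<infinity>" by (auto simp: top_unique)
            with elim have "ennreal (w z) \<noteq> 0"
              by (simp add: w_eq exp_neg_eq_0_iff ennreal_divide_eq_0_iff)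
            with elim w0[of z] show ?case by (auto simp: less_le)
          qed
        qed
        with False show False ..
      qed
      with False show ?thesis by (auto simp: D_KL_not_ac)
    qed
  next
    case False
    have "V = \<infinity>"
    proof (rule ccontr)
      assume "V \<noteq> \<infinity>"
      then have "AE x in M. neg_ln (Z x) \<noteq> \<infinity>"
        unfolding V_def by (intro nn_integral_PInf_AE) auto
      then have "AE x in M. Z x \<noteq> 0" by eventually_elim (auto simp: neg_ln_def)
      with False show False ..
    qed
    moreover have "D_KL P ?R = \<infinity> \<or> ?F = \<infinity>"
    proof (rule ccontr)
      assume "\<not> ?thesis"
      then have "D_KL P ?R \<noteq> \<infinity>" and F: "?F \<noteq> \<infinity>" by auto
      then have ac: "absolutely_continuous ?R P" using D_KL_not_ac by blast
      \<comment> \<open>A vanishing normalizer means f = \<infinity> almost everywhere under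
        \<open>K x\<close>. If P is absolutely continuous, it inherits this, against the finite
        integral of f.\<close>
      have "AE y in K x. Z x = 0 \<longrightarrow> f (x, y) = \<infinity>" if "x \<in> space M" for x
      proof (cases "Z x = 0")
        case True
        have [measurable]: "(\<lambda>y. f (x, y)) \<in> borel_measurable (K x)"
          using that by (simp add: measurable_cong_sets[OF kernel_sets[OF K that] refl])
        from True have "AE y in K x. exp_neg (f (x, y)) = 0"
          unfolding Z_def by (subst (asm) nn_integral_0_iff_AE) auto
        then show ?thesis by eventually_elim (simp add: exp_neg_eq_0_iff)
      qed simp
      then have "AE z in ?R. Z (fst z) = 0 \<longrightarrow> f z = \<infinity>"
        by (subst AE_semidirect[OF K]) auto
      then have "AE z in P. Z (fst z) = 0 \<longrightarrow> f z = \<infinity>"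
        by (rule absolutely_continuous_AE[OF setsR ac])
      then have "AE z in P. Z (fst z) \<noteq> 0"
        using AE_f[OF F] by eventually_elim auto
      then have "AE x in M. Z x \<noteq> 0" by (subst AE_M) auto
      with False show False ..
    qed
    ultimately show ?thesis by auto
  qed
  then show ?thesis unfolding V_def G_def Z_def .
qed

text \<open>When the conditional law K itself is known, the conditional divergence is an honest
  integral of pointwise divergences: for almost every x the section of the joint density h is the
  density of \<open>K x\<close> with respect to \<open>K' x\<close>. The countable generator is what
  provides a single exceptional null set.\<close>

lemma D_KL_semidirect_same_base:
  assumes M: "prob_space M" and K: "K \<in> measurable M (prob_algebra T)" and K': "K' \<in> measurable M (prob_algebra T)"
    and G: "countable G" "Int_stable G" "space T \<in> G" "sets T = sigma_sets (space T) G"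
    and D [measurable]: "(\<lambda>x. D_KL (K x) (K' x)) \<in> borel_measurable M"
  shows "D_KL (semidirect T M K) (semidirect T M K') = (\<integral>\<^sup>+x. D_KL (K x) (K' x) \<partial>M)"
    (is "D_KL ?P ?R = _")
proof -
  have P: "prob_space ?P" by (rule prob_space_semidirect[OF K M])
  have R: "prob_space ?R" by (rule prob_space_semidirect[OF K' M])
  have sets: "sets ?P = sets ?R" by (simp add: sets_semidirect[OF _ M] K K')
  note [measurable] = K K' kernel_subprob[OF K] kernel_subprob[OF K'] and [measurable_cong] = sets_semidirect[OF K M] sets_semidirect[OF K' M]
  have GT: "B \<in> sets T" if "B \<in> G" for B unfolding G(4) using that by (rule sigma_sets.Basic)
  have G_sub: "G \<subseteq> Pow (space T)" using GT sets.sets_into_space by blast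
  interpret M: prob_space M by fact
  show ?thesis
  proof (cases "absolutely_continuous ?R ?P")
    case True
    obtain h :: "'a \<times> 'b \<Rightarrow> real" where
      h': "h \<in> borel_measurable ?R" and h0: "\<And>x. 0 \<le> h x"
      and Ph: "?P = density ?R (\<lambda>x. ennreal (h x))" and "AE x in ?P. 0 < h x"
      by (rule RN_deriv_realE[OF R P True sets]) (rule that)
    have h [measurable]: "h \<in> borel_measurable (M \<Otimes>\<^sub>M T)" using h' by simp
    have hx: "(\<lambda>y. h (x, y)) \<in> borel_measurable (K' x)" if "x \<in> space M" for x
      using that by (simp add: measurable_cong_sets[OF kernel_sets[OF K' that] refl])
    have "AE x in M. emeasure (K x) B = emeasure (density (K' x) (\<lambda>y. ennreal (h (x, y)))) B" if "B \<in> G" for B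
    proof -
      from that have B [measurable]: "B \<in> sets T" by (rule GT)
      define I where "I x = (\<integral>\<^sup>+y. ennreal (h (x, y)) * indicator B y \<partial>K' x)" for x
      have I [measurable]: "I \<in> borel_measurable M"
        unfolding I_def
        using measurable_kernel_nn_integral[OF K', of "\<lambda>z. ennreal (h z) * indicator B (snd z)"] by simp
      have KB: "(\<lambda>x. emeasure (K x) B) \<in> borel_measurable M"
        by (rule measurable_emeasure_kernel[OF kernel_subprob[OF K] B])
      \<comment> \<open>Integrating over all base sets A and using uniqueness of densities gives
        equality of the masses of B almost everywhere, with a null set that depends on B.\<close>
      have "density M (\<lambda>x. emeasure (K x) B) = density M I"
      proof (rule measure_eqI)
        fix A assume "A \<in> sets (density M (\<lambda>x. emeasure (K x) B))"
        then have A [measurable]: "A \<in> sets M" by simp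
        have "emeasure (density M (\<lambda>x. emeasure (K x) B)) A = emeasure ?P (A \<times> B)"
          unfolding emeasure_density[OF KB A] emeasure_semidirect_Times[OF K M A B]
          by (intro nn_integral_cong) (rule mult.commute)
        also have "\<dots> = (\<integral>\<^sup>+z. ennreal (h z) * indicator (A \<times> B) z \<partial>?R)"
          by (subst Ph, subst emeasure_density) auto
        also have "\<dots> = (\<integral>\<^sup>+x. \<integral>\<^sup>+y. ennreal (h (x, y)) * indicator (A \<times> B) (x, y) \<partial>K' x \<partial>M)"
          by (subst nn_integral_semidirect[OF K']) auto
        also have "\<dots> = (\<integral>\<^sup>+x. I x * indicator A x \<partial>M)"
          unfolding I_def by (intro nn_integral_cong) (auto simp: indicator_times split: split_indicator)
        also have "\<dots> = emeasure (density M I) A" by (simp add: emeasure_density)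
        finally show "emeasure (density M (\<lambda>x. emeasure (K x) B)) A = emeasure (density M I) A" .
      qed simp
      then have "AE x in M. emeasure (K x) B = I x"
        unfolding M.density_unique_iff[OF KB I] .
      then show "AE x in M. emeasure (K x) B = emeasure (density (K' x) (\<lambda>y. ennreal (h (x, y)))) B"
        using AE_space unfolding I_def
      proof eventually_elim
        case (elim x)
        then show ?case
          by (subst emeasure_density) (use hx[of x] kernel_sets[OF K', of x] B in simp_all)
      qed
    qed
    \<comment> \<open>The null sets for the countably many B are merged; off their union, agreement
      on the intersection-stable generator gives equality of measures.\<close>
    then have "AE x in M. \<forall>B\<in>G. emeasure (K x) B = emeasure (density (K' x) (\<lambda>y. ennreal (h (x, y)))) B"
      by (subst AE_ball_countable[OF G(1)]) blast
    then have Kh: "AE x in M. K x = density (K' x) (\<lambda>y. ennreal (h (x, y)))"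
      using AE_space
    proof eventually_elim
      fix x assume eq: "\<forall>B\<in>G. emeasure (K x) B = emeasure (density (K' x) (\<lambda>y. ennreal (h (x, y)))) B"
        and x: "x \<in> space M"
      show "K x = density (K' x) (\<lambda>y. ennreal (h (x, y)))"
        by (rule measure_eqI_generator_eq[OF G(2) G_sub, where A = "\<lambda>_. space T"])
          (use eq G(3) in \<open>simp_all add: kernel_sets[OF K x] kernel_sets[OF K' x] G(4)[symmetric] kernel_emeasure_space[OF K x]\<close>)
    qed
    let ?n = "\<integral>\<^sup>+z. ennreal (- ln (h z)) \<partial>?P"
    define n p where "n x = (\<integral>\<^sup>+y. ennreal (- ln (h (x, y))) \<partial>K x)"
      and "p x = (\<integral>\<^sup>+y. ennreal (ln (h (x, y))) \<partial>K x)" for x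
    have [measurable]: "n \<in> borel_measurable M" "p \<in> borel_measurable M"
      unfolding n_def p_def
      using measurable_kernel_nn_integral[OF K, of "\<lambda>z. ennreal (- ln (h z))"]
        measurable_kernel_nn_integral[OF K, of "\<lambda>z. ennreal (ln (h z))"] by simp_all
    have "AE x in M. D_KL (K x) (K' x) + n x = p x"
      using Kh AE_space
    proof eventually_elim
      fix x assume Kh: "K x = density (K' x) (\<lambda>y. ennreal (h (x, y)))" and x: "x \<in> space M"
      show "D_KL (K x) (K' x) + n x = p x"
        unfolding n_def p_def
        by (rule D_KL_density[OF kernel_prob_space[OF K' x] kernel_prob_space[OF K x] hx[OF x] h0 Kh])
    qed
    then have "(\<integral>\<^sup>+x. D_KL (K x) (K' x) + n x \<partial>M) = (\<integral>\<^sup>+x. p x \<partial>M)"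
      by (rule nn_integral_cong_AE)
    then have "(\<integral>\<^sup>+x. D_KL (K x) (K' x) \<partial>M) + (\<integral>\<^sup>+x. n x \<partial>M) = (\<integral>\<^sup>+x. p x \<partial>M)"
      by (simp add: nn_integral_add)
    moreover have "(\<integral>\<^sup>+x. n x \<partial>M) = ?n"
      unfolding n_def by (subst nn_integral_semidirect[OF K]) auto
    moreover have "(\<integral>\<^sup>+x. p x \<partial>M) = (\<integral>\<^sup>+z. ennreal (ln (h z)) \<partial>?P)"
      unfolding p_def by (subst nn_integral_semidirect[OF K]) auto
    moreover have "D_KL ?P ?R + ?n = (\<integral>\<^sup>+z. ennreal (ln (h z)) \<partial>?P)"
      by (rule D_KL_density[OF R P h' h0 Ph])
    moreover have "?n < \<infinity>"
      by (rule nn_integral_neg_ln_less_top[OF R h' h0 Ph])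
    ultimately show ?thesis
      using ennreal_add_cancel_right[of "D_KL ?P ?R" ?n] by simp
  next
    case False
    have "(\<integral>\<^sup>+x. D_KL (K x) (K' x) \<partial>M) = \<infinity>"
    proof (rule ccontr)
      assume "(\<integral>\<^sup>+x. D_KL (K x) (K' x) \<partial>M) \<noteq> \<infinity>"
      then have "AE x in M. D_KL (K x) (K' x) \<noteq> \<infinity>"
        by (intro nn_integral_PInf_AE) auto
      then have ac: "AE x in M. absolutely_continuous (K' x) (K x)"
        by eventually_elim (use D_KL_not_ac in blast)
      have "absolutely_continuous ?R ?P"
        unfolding absolutely_continuous_AE_iff[OF sets]
      proof (intro ballI impI)
        fix A assume "A \<in> sets ?R" and AE: "AE z in ?R. z \<notin> A"
        then have [measurable]: "A \<in> sets (M \<Otimes>\<^sub>M T)" by (simp add: sets_semidirect[OF K' M])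
        have "AE x in M. AE y in K' x. (x, y) \<notin> A"
          using AE by (subst (asm) AE_semidirect[OF K']) auto
        then have "AE x in M. AE y in K x. (x, y) \<notin> A"
          using ac AE_space
        proof eventually_elim
          fix x assume AE: "AE y in K' x. (x, y) \<notin> A" and ac: "absolutely_continuous (K' x) (K x)"
            and x: "x \<in> space M"
          have "sets (K x) = sets (K' x)" by (simp add: kernel_sets[OF K x] kernel_sets[OF K' x])
          from absolutely_continuous_AE[OF this ac AE] show "AE y in K x. (x, y) \<notin> A" .
        qed
        then show "AE z in ?P. z \<notin> A" by (subst AE_semidirect[OF K]) auto
      qed
      with False show False ..
    qed
    with False show ?thesis by (simp add: D_KL_not_ac)
  qed
qed

lemma ennreal_le_max_0I: "a \<le> max 0 b \<Longrightarrow> ennreal a \<le> ennreal b"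
  by (cases "0 \<le> b") (auto simp: max_def ennreal_neg intro: ennreal_leI)

lemma ennreal_plus_le: "ennreal (a + b) \<le> ennreal a + ennreal b"
proof -
  have "ennreal (a + b) \<le> ennreal (max 0 a + max 0 b)" by (intro ennreal_leI) auto
  also have "\<dots> = ennreal (max 0 a) + ennreal (max 0 b)" by simp
  also have "\<dots> = ennreal a + ennreal b" by (simp add: max_def ennreal_neg)
  finally show ?thesis .
qed

subsection \<open>Measurability of the divergence between kernels\<close>

text \<open>
  By the Young inequality \<open>g h - (exp g - 1) \<le> h ln h - h + 1\<close> the divergence is the supremum over bounded
  \<open>g\<close> of a functional in which each of the two measures enters linearly. If the \<open>\<sigma>\<close>-algebra is countably
  generated, countably many \<open>g\<close> suffice, which makes the divergence of two kernels measurable without any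
  choice of jointly measurable densities.
\<close>

definition KL_dual :: "'a measure \<Rightarrow> 'a measure \<Rightarrow> ('a \<Rightarrow> real) \<Rightarrow> real" where
  "KL_dual P Q g = (\<integral>x. g x \<partial>P) - (\<integral>x. exp (g x) - 1 \<partial>Q)"

text \<open>The inequality 1 + u \<le> exp u at u = g - ln h gives g \<le> ln h - 1 + exp g / h
  where h > 0. Integrated over P, the last term becomes the Q-integral of exp g over {h \<noteq> 0},
  which is at most that of exp g. Boundedness of g keeps all integrals finite.\<close>

lemma D_KL_ge_dual:
  assumes P: "prob_space P" and Q: "prob_space Q" and sets: "sets P = sets Q"
    and g [measurable]: "g \<in> borel_measurable Q" and bd: "\<And>x. \<bar>g x\<bar> \<le> (c::real)"
  shows "ennreal (KL_dual P Q g) \<le> D_KL P Q"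
proof (cases "D_KL P Q < \<infinity>")
  case True
  interpret P: prob_space P by fact
  interpret Q: prob_space Q by fact
  note [measurable_cong] = sets
  have ac: "absolutely_continuous Q P" using True by (auto simp: D_KL_def split: if_splits)
  obtain h :: "'a \<Rightarrow> real" where
    h [measurable]: "h \<in> borel_measurable Q" and h0: "\<And>x. 0 \<le> h x"
    and Ph: "P = density Q (\<lambda>x. ennreal (h x))" and hpos: "AE x in P. 0 < h x"
    by (rule RN_deriv_realE[OF Q P ac sets]) (rule that)
  have hP: "h \<in> borel_measurable P" by measurable
  define n where "n = (\<integral>\<^sup>+x. ennreal (- ln (h x)) \<partial>P)"
  define p where "p = (\<integral>\<^sup>+x. ennreal (ln (h x)) \<partial>P)"
  have D: "D_KL P Q + n = p"
    unfolding n_def p_def by (rule D_KL_density[OF Q P h h0 Ph])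
  have n: "n < \<infinity>" unfolding n_def by (rule nn_integral_neg_ln_less_top[OF Q h h0 Ph])
  then have p: "p < \<infinity>" using D True by (metis ennreal_add_less_top infinity_ennreal_def)
  have int_ln: "integrable P (\<lambda>x. ln (h x))"
    unfolding real_integrable_def using n p hP by (auto simp: n_def p_def)
  have "(\<integral>x. ln (h x) \<partial>P) = enn2real p - enn2real n"
    using int_ln unfolding p_def n_def by (rule real_lebesgue_integral_def)
  then have D_eq: "D_KL P Q = ennreal (\<integral>x. ln (h x) \<partial>P)"
    using D n p True
    by (cases "D_KL P Q"; cases p; cases n) (auto simp: ennreal_plus[symmetric] simp del: ennreal_plus)
  have eb: "exp (g x) \<le> exp c" for x using bd[of x] by simp
  have int_g: "integrable P g" using bd by (intro P.integrable_const_bound[of _ c]) auto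
  have int_e: "integrable Q (\<lambda>x. exp (g x))"
    using eb by (intro Q.integrable_const_bound[of _ "exp c"]) auto
  have int_he: "integrable Q (\<lambda>x. h x * (exp (g x) / h x))"
    by (rule Bochner_Integration.integrable_bound[OF int_e]) (auto intro!: AE_I2)
  have int_eh: "integrable P (\<lambda>x. exp (g x) / h x)"
    unfolding Ph using int_he h0 by (subst integrable_density) auto
  have "(\<integral>x. g x \<partial>P) \<le> (\<integral>x. ln (h x) - 1 + exp (g x) / h x \<partial>P)"
  proof (intro integral_mono_AE)
    show "AE x in P. g x \<le> ln (h x) - 1 + exp (g x) / h x"
      using hpos
    proof eventually_elim
      case (elim x)
      have "1 + (g x - ln (h x)) \<le> exp (g x - ln (h x))" by (rule exp_ge_add_one_self)
      then show ?case using elim by (simp add: exp_diff)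
    qed
  qed (use int_g int_ln int_eh in auto)
  also have "\<dots> = (\<integral>x. ln (h x) \<partial>P) - 1 + (\<integral>x. exp (g x) / h x \<partial>P)"
    using int_ln int_eh by (simp add: P.prob_space)
  also have "(\<integral>x. exp (g x) / h x \<partial>P) = (\<integral>x. h x * (exp (g x) / h x) \<partial>Q)"
    unfolding Ph using h0 by (subst integral_density) auto
  also have "\<dots> \<le> (\<integral>x. exp (g x) \<partial>Q)"
    using int_he int_e by (intro integral_mono) auto
  finally have "KL_dual P Q g \<le> (\<integral>x. ln (h x) \<partial>P)"
    using int_e by (simp add: KL_dual_def Q.prob_space)
  then show ?thesis unfolding D_eq by (rule ennreal_leI)
qed (simp add: less_top[symmetric])

text \<open>The supremum would be attained at g = ln h, which need not be bounded. Truncating at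
  level k costs at most exp(-k) in the Q-integral, and monotone convergence recovers the positive
  part. In the singular case, multiples of the indicator of a Q-null set charged by P drive the
  functional to infinity.\<close>

lemma D_KL_le_dual:
  assumes P: "prob_space P" and Q: "prob_space Q" and sets: "sets P = sets Q"
    and s: "\<And>(g :: 'a \<Rightarrow> real) n :: nat. g \<in> borel_measurable Q \<Longrightarrow> (\<And>x. \<bar>g x\<bar> \<le> real n) \<Longrightarrow>
      ennreal (KL_dual P Q g) \<le> s"
  shows "D_KL P Q \<le> s"
proof -
  interpret P: prob_space P by fact
  interpret Q: prob_space Q by fact
  note [measurable_cong] = sets
  show ?thesis
  proof (cases "absolutely_continuous Q P")
    case True
    obtain h :: "'a \<Rightarrow> real" where
      h [measurable]: "h \<in> borel_measurable Q" and h0: "\<And>x. 0 \<le> h x"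
      and Ph: "P = density Q (\<lambda>x. ennreal (h x))" and hpos: "AE x in P. 0 < h x"
      by (rule RN_deriv_realE[OF Q P True sets]) (rule that)
    have hP [measurable]: "h \<in> borel_measurable P" by measurable
    define n where "n = (\<integral>\<^sup>+x. ennreal (- ln (h x)) \<partial>P)"
    define p where "p = (\<integral>\<^sup>+x. ennreal (ln (h x)) \<partial>P)"
    have D: "D_KL P Q + n = p"
      unfolding n_def p_def by (rule D_KL_density[OF Q P h h0 Ph])
    have n: "n < \<infinity>" unfolding n_def by (rule nn_integral_neg_ln_less_top[OF Q h h0 Ph])
    \<comment> \<open>As \<open>ln 0\<close> is 0 in HOL, the zeros of h need the explicit value -
      k; it stands for a truncated - \<infinity> and keeps exp g below h + exp(-k) there.\<close>
    define g where "g k x = (if h x = 0 then - real k else max (- real k) (min (real k) (ln (h x))))" for k x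
    have [measurable]: "g k \<in> borel_measurable Q" for k unfolding g_def by measurable
    have gP [measurable]: "g k \<in> borel_measurable P" for k by measurable
    have bd: "\<bar>g k x\<bar> \<le> real k" for k x by (auto simp: g_def)
    have int_h: "integrable Q h" "(\<integral>x. h x \<partial>Q) = 1"
    proof -
      have "(\<integral>\<^sup>+x. ennreal (h x) \<partial>Q) = 1"
        using P.emeasure_space_1 unfolding Ph by (simp add: emeasure_density cong: nn_integral_cong)
      then show "integrable Q h" "(\<integral>x. h x \<partial>Q) = 1"
        using h0 by (auto intro!: integrableI_nn_integral_finite[of _ _ 1] simp: integral_eq_nn_integral)
    qed
    have step: "(\<integral>\<^sup>+x. ennreal (g k x) \<partial>P) \<le> s + ennreal (exp (- real k)) + n" for k
    proof -
      let ?p = "\<integral>\<^sup>+x. ennreal (g k x) \<partial>P" and ?n = "\<integral>\<^sup>+x. ennreal (- g k x) \<partial>P"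
      have int_g: "integrable P (g k)" using bd by (intro P.integrable_const_bound[of _ "real k"]) auto
      have eb: "exp (g k x) \<le> exp (real k)" for x using bd[of k x] by simp
      have int_e: "integrable Q (\<lambda>x. exp (g k x))"
        using eb by (intro Q.integrable_const_bound[of _ "exp (real k)"]) auto
      have "exp (g k x) \<le> h x + exp (- real k)" for x
      proof (cases "h x = 0")
        case False
        with h0[of x] have "0 < h x" by simp
        then have "g k x \<le> max (- real k) (ln (h x))" by (auto simp: g_def)
        then have "exp (g k x) \<le> exp (max (- real k) (ln (h x)))" by simp
        also have "\<dots> \<le> h x + exp (- real k)" using \<open>0 < h x\<close> by (auto simp: max_def)
        finally show ?thesis .
      qed (simp add: g_def)
      then have "(\<integral>x. exp (g k x) \<partial>Q) \<le> (\<integral>x. h x + exp (- real k) \<partial>Q)"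
        using int_e int_h by (intro integral_mono) auto
      then have e_le: "(\<integral>x. exp (g k x) - 1 \<partial>Q) \<le> exp (- real k)"
        using int_e int_h by (simp add: Q.prob_space)
      have neg: "?n \<le> n"
        unfolding n_def using hpos
        by (intro nn_integral_mono_AE, eventually_elim) (auto simp: g_def intro!: ennreal_le_max_0I)
      have pos_fin: "?p < \<infinity>" "?n < \<infinity>"
        using int_g unfolding real_integrable_def by (auto simp: less_top)
      have eq: "(\<integral>x. g k x \<partial>P) = enn2real ?p - enn2real ?n"
        using int_g by (rule real_lebesgue_integral_def)
      have "?p = ennreal (enn2real ?p)"
        using pos_fin by simp
      also have "\<dots> = ennreal ((\<integral>x. g k x \<partial>P) + enn2real ?n)"
        by (simp add: eq)
      also have "\<dots> \<le> ennreal (KL_dual P Q (g k) + exp (- real k) + enn2real ?n)"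
        using e_le by (intro ennreal_leI) (simp add: KL_dual_def)
      also have "\<dots> \<le> ennreal (KL_dual P Q (g k)) + ennreal (exp (- real k)) + ?n"
        using pos_fin(2) by (intro order_trans[OF ennreal_plus_le] add_mono ennreal_plus_le) simp
      also have "\<dots> \<le> s + ennreal (exp (- real k)) + n"
        using neg s[of "g k" k] bd by (intro add_mono) auto
      finally show ?thesis .
    qed
    have "p \<le> s + n"
    proof (rule ennreal_le_epsilon)
      fix e :: real assume e: "0 < e"
      have p_sup: "p = (SUP k. \<integral>\<^sup>+x. ennreal (g k x) \<partial>P)"
      proof -
        have "p = (\<integral>\<^sup>+x. (SUP k. ennreal (g k x)) \<partial>P)"
          unfolding p_def using hpos
        proof (intro nn_integral_cong_AE, eventually_elim)
          fix x assume x: "0 < h x"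
          show "ennreal (ln (h x)) = (SUP k. ennreal (g k x))"
          proof (rule antisym)
            obtain k :: nat where "\<bar>ln (h x)\<bar> \<le> real k" using real_arch_simple by blast
            then have "g k x = ln (h x)" using x by (auto simp: g_def)
            then show "ennreal (ln (h x)) \<le> (SUP k. ennreal (g k x))"
              by (intro SUP_upper2[of k]) auto
            have "ennreal (g k x) \<le> ennreal (ln (h x))" for k
              using x by (auto simp: g_def intro!: ennreal_le_max_0I)
            then show "(SUP k. ennreal (g k x)) \<le> ennreal (ln (h x))" by (intro SUP_least)
          qed
        qed
        also have "\<dots> = (SUP k. \<integral>\<^sup>+x. ennreal (g k x) \<partial>P)"
        proof (rule nn_integral_monotone_convergence_SUP_AE)
          show "AE x in P. ennreal (g i x) \<le> ennreal (g (Suc i) x)" for i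
            using hpos
            by eventually_elim (auto simp: g_def intro!: ennreal_le_max_0I)
        qed auto
        finally show ?thesis .
      qed
      \<comment> \<open>The error exp(-k) in \<open>step\<close> is small only for large k. Since
        \<open>g k\<close> increases with k where h > 0, any k may be replaced by
        \<open>max k k0\<close>.\<close>
      obtain k0 :: nat where k0: "exp (- real k0) < e"
      proof -
        obtain k :: nat where "- ln e < real k" using reals_Archimedean2 by blast
        then have "exp (- real k) < exp (ln e)" by (subst exp_less_cancel_iff) simp
        with e that show thesis by simp
      qed
      have "(\<integral>\<^sup>+x. ennreal (g k x) \<partial>P) \<le> s + n + ennreal e" for k
      proof -
        have "(\<integral>\<^sup>+x. ennreal (g k x) \<partial>P) \<le> (\<integral>\<^sup>+x. ennreal (g (max k k0) x) \<partial>P)"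
          using hpos
          by (intro nn_integral_mono_AE, eventually_elim)
             (auto simp: g_def intro!: ennreal_le_max_0I)
        also have "\<dots> \<le> s + ennreal (exp (- real (max k k0))) + n" by (rule step)
        also have "\<dots> \<le> s + ennreal e + n"
        proof (intro add_mono ennreal_leI order_refl)
          have "exp (- real (max k k0)) \<le> exp (- real k0)" by simp
          then show "exp (- real (max k k0)) \<le> e" using k0 by linarith
        qed
        finally show ?thesis by (simp add: ac_simps)
      qed
      then show "p \<le> s + n + ennreal e"
        unfolding p_sup by (intro SUP_least)
    qed
    then have "D_KL P Q + n \<le> s + n" by (simp add: D)
    then show ?thesis using n by (auto simp: ennreal_add_left_cancel_le add.commute)
  next
    case False
    then obtain A where A [measurable]: "A \<in> sets Q" and A0: "AE x in Q. x \<notin> A" and A1: "\<not> (AE x in P. x \<notin> A)"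
      unfolding absolutely_continuous_AE_iff[OF sets] by blast
    have AP: "A \<in> sets P" using A sets by simp
    have pos: "0 < measure P A"
      using A1 AE_iff_measurable[of A P "\<lambda>x. x \<notin> A"] AP sets.sets_into_space[OF AP]
      by (auto simp: P.emeasure_eq_measure less_le measure_nonneg)
    have "ennreal (real k * measure P A) \<le> s" for k
    proof -
      \<comment> \<open>On the Q-null set A this leaves the exponential term at 0, while the
        P-integral grows linearly in k.\<close>
      define g where "g x = real k * indicator A x" for x
      have [measurable]: "g \<in> borel_measurable Q" unfolding g_def by measurable
      have "(\<integral>x. g x \<partial>P) = real k * measure P A"
        using AP sets.sets_into_space[OF AP] by (simp add: g_def Int_absorb2)
      moreover have "(\<integral>x. exp (g x) - 1 \<partial>Q) = (\<integral>x. 0 \<partial>Q)"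
      proof (intro integral_cong_AE)
        show "AE x in Q. exp (g x) - 1 = 0" using A0 by eventually_elim (simp add: g_def)
      qed simp_all
      moreover have "ennreal (KL_dual P Q g) \<le> s"
        by (rule s[of g k]) (simp_all add: g_def split: split_indicator)
      ultimately show ?thesis by (simp add: KL_dual_def)
    qed
    moreover have "\<exists>k. s < ennreal (real k * measure P A)" if s_fin: "s \<noteq> \<infinity>"
    proof -
      obtain r where r: "s = ennreal r" "0 \<le> r" using s_fin by (cases s) auto
      obtain k :: nat where "r / measure P A < real k" using reals_Archimedean2 by blast
      then have "r < real k * measure P A" using pos by (simp add: field_simps)
      then show ?thesis using r by (auto simp: ennreal_less_iff)
    qed
    ultimately have "s = \<infinity>" by (metis not_le)
    then show ?thesis by simp
  qed
qed

section \<open>Approximation of bounded functions by rational combinations of generating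
  sets\<close>

definition rat_span :: "(rat \<times> 'a set) list \<Rightarrow> 'a \<Rightarrow> real" where
  "rat_span l x = (\<Sum>(q, A)\<leftarrow>l. of_rat q * indicator A x)"

lemma rat_span_append: "rat_span (l @ l') x = rat_span l x + rat_span l' x"
  by (simp add: rat_span_def)

lemma rat_span_scale: "rat_span (map (\<lambda>(r, A). (q * r, A)) l) x = of_rat q * rat_span l x"
  by (induction l) (auto simp: rat_span_def of_rat_mult algebra_simps)

lemma measurable_rat_span:
  assumes "l \<in> lists (UNIV \<times> G)" and "\<And>A. A \<in> G \<Longrightarrow> A \<in> sets M"
  shows "rat_span l \<in> borel_measurable M"
  using assms(1)
proof (induction l)
  case Nil
  then show ?case by (simp add: rat_span_def[abs_def])
next
  case (Cons a l)
  obtain q A where a: "a = (q, A)" by (cases a)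
  with Cons have [measurable]: "A \<in> sets M" "rat_span l \<in> borel_measurable M" using assms(2) by auto
  have "rat_span (a # l) = (\<lambda>x. of_rat q * indicator A x + rat_span l x)"
    by (simp add: a rat_span_def fun_eq_iff)
  then show ?case by simp
qed

context
  fixes P Q :: "'a measure" and G :: "'a set set"
  assumes P: "prob_space P" and Q: "prob_space Q" and sets: "sets P = sets Q"
    and Int_G: "Int_stable G" and \<Omega>_G: "space Q \<in> G" and gen: "sets Q = sigma_sets (space Q) G"
begin

interpretation P: prob_space P by fact
interpretation Q: prob_space Q by fact

lemma generator_sets: "A \<in> G \<Longrightarrow> A \<in> sets Q"
  unfolding gen by (rule sigma_sets.Basic)

text \<open>The L1 norm with respect to P + Q: one approximating function must serve both integrals
  of \<open>KL_dual\<close>.\<close>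

private definition L1 :: "('a \<Rightarrow> real) \<Rightarrow> ennreal" where
  "L1 g = (\<integral>\<^sup>+x. ennreal \<bar>g x\<bar> \<partial>P) + (\<integral>\<^sup>+x. ennreal \<bar>g x\<bar> \<partial>Q)"

private definition approx :: "('a \<Rightarrow> real) \<Rightarrow> bool" where
  "approx g \<longleftrightarrow> g \<in> borel_measurable Q
    \<and> (\<forall>e>0. \<exists>l\<in>lists (UNIV \<times> G). L1 (\<lambda>x. g x - rat_span l x) \<le> ennreal e)"

private lemma borel_P: "g \<in> borel_measurable P \<longleftrightarrow> g \<in> borel_measurable Q" for g :: "'a \<Rightarrow> real"
  by (simp add: measurable_cong_sets[OF sets refl])

private lemma span_Q: "l \<in> lists (UNIV \<times> G) \<Longrightarrow> rat_span l \<in> borel_measurable Q"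
  using generator_sets measurable_rat_span by blast

private lemma L1_add:
  assumes "f \<in> borel_measurable Q" "g \<in> borel_measurable Q" "\<And>x. \<bar>h x\<bar> \<le> \<bar>f x\<bar> + \<bar>g x\<bar>"
  shows "L1 h \<le> L1 f + L1 g"
proof -
  have *: "(\<integral>\<^sup>+x. ennreal \<bar>h x\<bar> \<partial>M) \<le> (\<integral>\<^sup>+x. ennreal \<bar>f x\<bar> \<partial>M) + (\<integral>\<^sup>+x. ennreal \<bar>g x\<bar> \<partial>M)"
    if [measurable]: "f \<in> borel_measurable M" "g \<in> borel_measurable M" for M
  proof -
    have "(\<integral>\<^sup>+x. ennreal \<bar>h x\<bar> \<partial>M) \<le> (\<integral>\<^sup>+x. ennreal \<bar>f x\<bar> + ennreal \<bar>g x\<bar> \<partial>M)"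
      using assms(3) by (intro nn_integral_mono) (simp add: ennreal_plus[symmetric] ennreal_leI del: ennreal_plus)
    then show ?thesis by (simp add: nn_integral_add)
  qed
  have "L1 h \<le> ((\<integral>\<^sup>+x. ennreal \<bar>f x\<bar> \<partial>P) + (\<integral>\<^sup>+x. ennreal \<bar>g x\<bar> \<partial>P)) + ((\<integral>\<^sup>+x. ennreal \<bar>f x\<bar> \<partial>Q) + (\<integral>\<^sup>+x. ennreal \<bar>g x\<bar> \<partial>Q))"
    unfolding L1_def by (intro add_mono *) (auto simp: borel_P assms)
  then show ?thesis by (simp add: L1_def ac_simps)
qed

private lemma L1_cmult: "f \<in> borel_measurable Q \<Longrightarrow> L1 (\<lambda>x. c * f x) = ennreal \<bar>c\<bar> * L1 f"
  unfolding L1_def by (simp add: abs_mult ennreal_mult nn_integral_cmult borel_P distrib_left)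

private lemma L1_bound:
  assumes "\<And>x. \<bar>f x\<bar> \<le> c" shows "L1 f \<le> ennreal (2 * c)"
proof -
  have c: "0 \<le> c" using assms[of undefined] by linarith
  have "L1 f \<le> (\<integral>\<^sup>+x. ennreal c \<partial>P) + (\<integral>\<^sup>+x. ennreal c \<partial>Q)"
    unfolding L1_def using assms by (intro add_mono nn_integral_mono ennreal_leI) auto
  also have "\<dots> = ennreal (2 * c)"
    using c by (simp add: P.emeasure_space_1 Q.emeasure_space_1 ennreal_plus[symmetric] del: ennreal_plus)
  finally show ?thesis .
qed

private lemma approx_limit:
  assumes g: "g \<in> borel_measurable Q" and *: "\<And>e. 0 < e \<Longrightarrow> \<exists>f. approx f \<and> L1 (\<lambda>x. g x - f x) \<le> ennreal e"
  shows "approx g"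
  unfolding approx_def
proof (intro conjI allI impI g)
  fix e :: real assume "0 < e"
  then obtain f where f: "approx f" "L1 (\<lambda>x. g x - f x) \<le> ennreal (e / 2)"
    using *[of "e / 2"] by auto
  then obtain l where l: "l \<in> lists (UNIV \<times> G)" "L1 (\<lambda>x. f x - rat_span l x) \<le> ennreal (e / 2)"
    using \<open>0 < e\<close> by (auto simp: approx_def dest!: spec[of _ "e / 2"])
  have [measurable]: "f \<in> borel_measurable Q" "g \<in> borel_measurable Q" "rat_span l \<in> borel_measurable Q"
    using f g span_Q[OF l(1)] by (auto simp: approx_def)
  have "L1 (\<lambda>x. g x - rat_span l x) \<le> L1 (\<lambda>x. g x - f x) + L1 (\<lambda>x. f x - rat_span l x)"
    by (rule L1_add) auto
  also have "\<dots> \<le> ennreal (e / 2) + ennreal (e / 2)" by (intro add_mono f l)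
  also have "\<dots> = ennreal e" using \<open>0 < e\<close> by (simp add: ennreal_plus[symmetric] del: ennreal_plus)
  finally show "\<exists>l\<in>lists (UNIV \<times> G). L1 (\<lambda>x. g x - rat_span l x) \<le> ennreal e" using l by blast
qed

private lemma approx_add:
  assumes "approx f" "approx g" shows "approx (\<lambda>x. f x + g x)"
  unfolding approx_def
proof (intro conjI allI impI)
  show "(\<lambda>x. f x + g x) \<in> borel_measurable Q" using assms by (auto simp: approx_def)
  fix e :: real assume "0 < e"
  then obtain l l' where l: "l \<in> lists (UNIV \<times> G)" "L1 (\<lambda>x. f x - rat_span l x) \<le> ennreal (e / 2)"
    and l': "l' \<in> lists (UNIV \<times> G)" "L1 (\<lambda>x. g x - rat_span l' x) \<le> ennreal (e / 2)"
    using assms unfolding approx_def by (meson half_gt_zero)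
  have [measurable]: "f \<in> borel_measurable Q" "g \<in> borel_measurable Q" "rat_span l \<in> borel_measurable Q" "rat_span l' \<in> borel_measurable Q"
    using assms span_Q l l' by (auto simp: approx_def)
  have "L1 (\<lambda>x. f x + g x - rat_span (l @ l') x) \<le> L1 (\<lambda>x. f x - rat_span l x) + L1 (\<lambda>x. g x - rat_span l' x)"
    by (rule L1_add) (auto simp: rat_span_append)
  also have "\<dots> \<le> ennreal (e / 2) + ennreal (e / 2)" by (intro add_mono l l')
  also have "\<dots> = ennreal e" using \<open>0 < e\<close> by (simp add: ennreal_plus[symmetric] del: ennreal_plus)
  finally show "\<exists>l\<in>lists (UNIV \<times> G). L1 (\<lambda>x. f x + g x - rat_span l x) \<le> ennreal e"
    using l l' by (intro bexI[of _ "l @ l'"]) auto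
qed

private lemma approx_rat:
  assumes "approx f" shows "approx (\<lambda>x. of_rat q * f x)"
  unfolding approx_def
proof (intro conjI allI impI)
  show "(\<lambda>x. of_rat q * f x) \<in> borel_measurable Q" using assms by (auto simp: approx_def)
  fix e :: real assume "0 < e"
  define r :: real where "r = \<bar>of_rat q\<bar>"
  have "0 \<le> r" by (simp add: r_def)
  \<comment> \<open>Dividing by r + 1 instead of r also covers q = 0.\<close>
  then have "0 < e / (r + 1)" using \<open>0 < e\<close> by simp
  then obtain l where l: "l \<in> lists (UNIV \<times> G)" "L1 (\<lambda>x. f x - rat_span l x) \<le> ennreal (e / (r + 1))"
    using assms unfolding approx_def by meson
  have [measurable]: "f \<in> borel_measurable Q" "rat_span l \<in> borel_measurable Q"
    using assms span_Q l by (auto simp: approx_def)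
  have "L1 (\<lambda>x. of_rat q * f x - rat_span (map (\<lambda>(r, A). (q * r, A)) l) x) = L1 (\<lambda>x. of_rat q * (f x - rat_span l x))"
    by (simp add: rat_span_scale right_diff_distrib)
  also have "\<dots> = ennreal r * L1 (\<lambda>x. f x - rat_span l x)"
    unfolding r_def by (rule L1_cmult) simp
  also have "\<dots> \<le> ennreal r * ennreal (e / (r + 1))" by (intro mult_left_mono l) simp
  also have "\<dots> = ennreal (r * (e / (r + 1)))" by (rule ennreal_mult'[symmetric]) (simp add: r_def)
  also have "\<dots> \<le> ennreal e"
    using \<open>0 < e\<close> \<open>0 \<le> r\<close> by (intro ennreal_leI) (simp add: field_simps)
  finally show "\<exists>l\<in>lists (UNIV \<times> G). L1 (\<lambda>x. of_rat q * f x - rat_span l x) \<le> ennreal e"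
    using l by (intro bexI[of _ "map (\<lambda>(r, A). (q * r, A)) l"]) auto
qed

private lemma approx_generator: "A \<in> G \<Longrightarrow> approx (indicator A)"
  unfolding approx_def
  using generator_sets[of A]
  by (auto intro!: bexI[of _ "[(1, A)]"] simp: rat_span_def L1_def)

private lemma approx_zero: "approx (\<lambda>_. 0)"
  using approx_rat[OF approx_generator[OF \<Omega>_G], of 0] by simp

private lemma approx_sum: "finite I \<Longrightarrow> (\<And>i. i \<in> I \<Longrightarrow> approx (f i)) \<Longrightarrow> approx (\<lambda>x. \<Sum>i\<in>I. f i x)"
  by (induction I rule: finite_induct) (simp_all add: approx_zero approx_add)

text \<open>Needed because identities such as the one for the indicator of a complement hold only
  inside the space, and the norm does not see points outside it.\<close>

private lemma approx_cong_space:
  assumes f: "approx f" and eq: "\<And>x. x \<in> space Q \<Longrightarrow> f x = g x"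
  shows "approx g"
proof -
  have [measurable]: "g \<in> borel_measurable Q"
    using f eq unfolding approx_def by (auto cong: measurable_cong)
  have sp: "space P = space Q" using sets by (rule sets_eq_imp_space_eq)
  have "L1 (\<lambda>x. g x - f x) = 0"
    unfolding L1_def using eq by (auto simp: sp intro!: nn_integral_zero' AE_I2)
  then show ?thesis using f by (intro approx_limit) auto
qed

text \<open>Dynkin argument over the intersection-stable generator. Complements use that the space
  itself belongs to G; for disjoint unions the tails shrink to the empty set, so their masses under
  the finite measures P and Q tend to 0.\<close>

private lemma approx_indicator: "A \<in> sets Q \<Longrightarrow> approx (indicator A)"
proof -
  have G_sub: "G \<subseteq> Pow (space Q)" using generator_sets sets.sets_into_space by blast
  assume "A \<in> sets Q"
  then have "A \<in> sigma_sets (space Q) G" by (simp add: gen)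
  with Int_G G_sub show ?thesis
  proof (induction rule: sigma_sets_induct_disjoint)
    case (basic A)
    then show ?case by (rule approx_generator)
  next
    case empty
    then show ?case using approx_zero by simp
  next
    case (compl A)
    have "approx (\<lambda>x. indicator (space Q) x + of_rat (-1) * indicator A x)"
      by (intro approx_add approx_rat approx_generator compl \<Omega>_G)
    then show ?case by (rule approx_cong_space) (auto split: split_indicator)
  next
    case (union A)
    have A: "A i \<in> sets Q" for i using union(2) unfolding gen by auto
    have U [measurable]: "(\<Union>i. A i) \<in> sets Q" using A by auto
    show ?case
    proof (rule approx_limit)
      show "indicator (\<Union>i. A i) \<in> borel_measurable Q" using A by measurable
      fix e :: real assume "0 < e"
      define R where "R n = (\<lambda>x. indicator (\<Union>i. A i) x - (\<Sum>i<n. indicator (A i) x) :: real)" for n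
      have R_eq: "ennreal \<bar>R n x\<bar> = indicator ((\<Union>i. A i) - (\<Union>i<n. A i)) x" for n x
      proof -
        have "(\<Sum>i<n. indicator (A i) x :: real) = indicator (\<Union>i<n. A i) x"
          using union(1) by (intro indicator_UN_disjoint[symmetric]) (auto simp: disjoint_family_on_def)
        then show ?thesis by (auto simp: R_def split: split_indicator)
      qed
      have lim: "(\<lambda>n. emeasure M ((\<Union>i. A i) - (\<Union>i<n. A i))) \<longlonglongrightarrow> 0"
        if M: "finite_measure M" "sets M = sets Q" for M
      proof -
        interpret finite_measure M by fact
        have "(\<lambda>n. emeasure M ((\<Union>i. A i) - (\<Union>i<n. A i))) \<longlonglongrightarrow> emeasure M (\<Inter>n. (\<Union>i. A i) - (\<Union>i<n. A i))"
          using A M(2) by (intro Lim_emeasure_decseq) (auto simp: decseq_def)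
        also have "(\<Inter>n. (\<Union>i. A i) - (\<Union>i<n. A i)) = {}" by auto
        finally show ?thesis by simp
      qed
      have L1R: "L1 (R n) = emeasure P ((\<Union>i. A i) - (\<Union>i<n. A i)) + emeasure Q ((\<Union>i. A i) - (\<Union>i<n. A i))" for n
        unfolding L1_def R_eq using A by (simp add: sets)
      have "(\<lambda>n. L1 (R n)) \<longlonglongrightarrow> 0 + 0"
        unfolding L1R by (intro tendsto_add lim P.finite_measure_axioms Q.finite_measure_axioms sets refl)
      then have "eventually (\<lambda>n. L1 (R n) < ennreal e) sequentially"
        using \<open>0 < e\<close> by (intro order_tendstoD(2)[of _ 0]) auto
      then obtain n where "L1 (R n) < ennreal e" by (auto simp: eventually_sequentially)
      moreover have "approx (\<lambda>x. \<Sum>i<n. indicator (A i) x)"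
        by (intro approx_sum union(3)) auto
      ultimately show "\<exists>f. approx f \<and> L1 (\<lambda>x. indicator (\<Union>i. A i) x - f x) \<le> ennreal e"
        unfolding R_def by (intro exI[of _ "\<lambda>x. \<Sum>i<n. indicator (A i) x"]) auto
    qed
  qed
qed

text \<open>Rounding g down to multiples of 1/k is a uniform approximation, and boundedness leaves
  only finitely many levels, each with a measurable level set and a rational value.\<close>

private lemma approx_bounded:
  assumes g [measurable]: "g \<in> borel_measurable Q" and bd: "\<And>x. \<bar>g x\<bar> \<le> real n"
  shows "approx g"
proof (rule approx_limit[OF g])
  fix e :: real assume e: "0 < e"
  \<comment> \<open>A uniform error 1/k counts twice in \<open>L1\<close>, once for each probability
    measure; hence the bound 2/e.\<close>
  obtain k :: nat where k: "2 / e < real k" using reals_Archimedean2 by blast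
  have k0: "0 < real k" using k e by (meson divide_pos_pos less_trans zero_less_numeral)
  \<comment> \<open>All possible values of the floor of k g, with one unit of slack at both ends for
    the rounding.\<close>
  define J where "J = {- int (k * n) - 1 .. int (k * n) + 1}"
  define f :: "'a \<Rightarrow> real" where "f x = (\<Sum>j\<in>J. of_rat (of_int j / of_nat k) * indicator {x\<in>space Q. \<lfloor>real k * g x\<rfloor> = j} x)" for x
  have "approx f"
    unfolding f_def by (intro approx_sum approx_rat approx_indicator) (auto simp: J_def)
  define f' where "f' x = real_of_int \<lfloor>real k * g x\<rfloor> / real k" for x
  have "f x = f' x" if x: "x \<in> space Q" for x
  proof -
    have "\<bar>real k * g x\<bar> \<le> real k * real n"
      using bd[of x] by (simp add: abs_mult mult_left_mono)
    then have "\<lfloor>real k * g x\<rfloor> \<in> J"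
      unfolding J_def by (auto simp: le_floor_iff floor_le_iff abs_le_iff)
    then have "f x = (\<Sum>j\<in>J. if j = \<lfloor>real k * g x\<rfloor> then of_rat (of_int j / of_nat k) else 0)"
      unfolding f_def using x by (intro sum.cong) (auto split: split_indicator)
    also have "\<dots> = f' x"
      using \<open>\<lfloor>real k * g x\<rfloor> \<in> J\<close> by (simp add: J_def f'_def of_rat_divide)
    finally show ?thesis .
  qed
  then have "approx f'" using \<open>approx f\<close> by (rule approx_cong_space[rotated])
  moreover have "L1 (\<lambda>x. g x - f' x) \<le> ennreal (2 * (1 / real k))"
  proof (rule L1_bound)
    fix x
    have "\<bar>real k * g x - real_of_int \<lfloor>real k * g x\<rfloor>\<bar> \<le> 1" by linarith
    also have "real k * g x - real_of_int \<lfloor>real k * g x\<rfloor> = real k * (g x - f' x)"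
      using k0 by (simp add: f'_def right_diff_distrib)
    finally have "real k * \<bar>g x - f' x\<bar> \<le> 1" by (simp only: abs_mult abs_of_nat)
    then show "\<bar>g x - f' x\<bar> \<le> 1 / real k" using k0 by (simp add: pos_le_divide_eq mult.commute)
  qed
  moreover have "ennreal (2 * (1 / real k)) \<le> ennreal e"
    using k k0 e by (intro ennreal_leI) (simp add: field_simps)
  ultimately show "\<exists>f. approx f \<and> L1 (\<lambda>x. g x - f x) \<le> ennreal e" by (meson order_trans)
qed

text \<open>Truncation to [-n, n] does not increase the distance to g, whose values lie in that
  interval, and makes exp Lipschitz there with constant c = exp n. If a and b are the errors under P
  and Q, then \<open>KL_dual\<close> changes by at most a + c b \<le> c (a + b), which explains the
  accuracy e/c.\<close>

lemma dual_bound_from_rat_span: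
  assumes s: "\<And>n l. l \<in> lists (UNIV \<times> G) \<Longrightarrow>
      ennreal (KL_dual P Q (\<lambda>x. max (- real n) (min (real n) (rat_span l x)))) \<le> s"
    and g [measurable]: "g \<in> borel_measurable Q" and bd: "\<And>x. \<bar>g x\<bar> \<le> real n"
  shows "ennreal (KL_dual P Q g) \<le> s"
proof (rule ennreal_le_epsilon)
  fix e :: real assume e: "0 < e"
  define c where "c = exp (real n)"
  have c: "1 \<le> c" by (simp add: c_def)
  have "0 < e / c" using e c by simp
  then obtain l where l: "l \<in> lists (UNIV \<times> G)" "L1 (\<lambda>x. g x - rat_span l x) \<le> ennreal (e / c)"
    using approx_bounded[OF g bd] unfolding approx_def by meson
  have [measurable]: "rat_span l \<in> borel_measurable Q" using span_Q l by auto
  define f where "f x = max (- real n) (min (real n) (rat_span l x))" for x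
  have [measurable]: "f \<in> borel_measurable Q" unfolding f_def by measurable
  have [measurable]: "f \<in> borel_measurable P" "g \<in> borel_measurable P" by (simp_all add: borel_P)
  have bdf: "\<bar>f x\<bar> \<le> real n" for x by (auto simp: f_def)
  have diff: "\<bar>g x - f x\<bar> \<le> \<bar>g x - rat_span l x\<bar>" for x using bd[of x] by (auto simp: f_def)
  have "integrable P f" "integrable P g" "integrable Q f" "integrable Q g"
    using bd bdf
    by (auto intro!: P.integrable_const_bound[of _ "real n"] Q.integrable_const_bound[of _ "real n"])
  moreover have "exp (f x) \<le> exp (real n)" "exp (g x) \<le> exp (real n)" for x
    using bd[of x] bdf[of x] by auto
  then have "integrable Q (\<lambda>x. exp (f x))" "integrable Q (\<lambda>x. exp (g x))"
    by (auto intro!: Q.integrable_const_bound[of _ "exp (real n)"])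
  ultimately have int: "integrable P f" "integrable P g" "integrable Q f" "integrable Q g"
    "integrable Q (\<lambda>x. exp (f x))" "integrable Q (\<lambda>x. exp (g x))" by blast+
  define a b where "a = (\<integral>x. \<bar>g x - f x\<bar> \<partial>P)" and "b = (\<integral>x. \<bar>g x - f x\<bar> \<partial>Q)"
  have ab0: "0 \<le> a" "0 \<le> b" by (simp_all add: a_def b_def)
  have "ennreal a + ennreal b = L1 (\<lambda>x. g x - f x)"
    unfolding a_def b_def L1_def using int by (simp add: nn_integral_eq_integral)
  also have "\<dots> \<le> L1 (\<lambda>x. g x - rat_span l x)"
    unfolding L1_def using diff by (intro add_mono nn_integral_mono ennreal_leI) auto
  also note l(2)
  finally have ab: "a + b \<le> e / c"
    using ab0 e c by (simp add: ennreal_plus[symmetric] ennreal_le_iff del: ennreal_plus)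
  have exp_diff: "exp (f x) - exp (g x) \<le> c * \<bar>g x - f x\<bar>" for x
  proof (cases "g x \<le> f x")
    case True
    have "1 - exp (g x - f x) \<le> f x - g x" using exp_ge_add_one_self[of "g x - f x"] by linarith
    then have "exp (f x) * (1 - exp (g x - f x)) \<le> exp (f x) * (f x - g x)" by (intro mult_left_mono) auto
    also have "\<dots> \<le> c * (f x - g x)" using True bdf[of x] by (intro mult_right_mono) (auto simp: c_def)
    finally show ?thesis using True by (simp add: right_diff_distrib exp_diff)
  next
    case False
    then have "exp (f x) - exp (g x) \<le> 0" by simp
    also have "0 \<le> c * \<bar>g x - f x\<bar>" using c by simp
    finally show ?thesis .
  qed
  have "(\<integral>x. g x \<partial>P) - (\<integral>x. f x \<partial>P) = (\<integral>x. g x - f x \<partial>P)" using int by simp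
  also have "\<dots> \<le> a" unfolding a_def using int by (intro integral_mono) auto
  finally have 1: "(\<integral>x. g x \<partial>P) - (\<integral>x. f x \<partial>P) \<le> a" .
  have "(\<integral>x. exp (f x) \<partial>Q) - (\<integral>x. exp (g x) \<partial>Q) = (\<integral>x. exp (f x) - exp (g x) \<partial>Q)" using int by simp
  also have "\<dots> \<le> (\<integral>x. c * \<bar>g x - f x\<bar> \<partial>Q)" using int exp_diff by (intro integral_mono) auto
  also have "\<dots> = c * b" by (simp add: b_def)
  finally have 2: "(\<integral>x. exp (f x) \<partial>Q) - (\<integral>x. exp (g x) \<partial>Q) \<le> c * b" .
  have "a + c * b \<le> c * (a + b)" using c ab0 by (simp add: distrib_left mult_le_cancel_right1)
  also have "\<dots> \<le> e" using ab c by (simp add: field_simps)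
  finally have 3: "a + c * b \<le> e" .
  have "KL_dual P Q g \<le> KL_dual P Q f + e"
    using 1 2 3 int by (simp add: KL_dual_def)
  then have "ennreal (KL_dual P Q g)
      \<le> ennreal (KL_dual P Q f + e)" by (rule ennreal_leI)
  also have "\<dots> \<le> ennreal (KL_dual P Q f) + ennreal e" by (rule ennreal_plus_le)
  also have "\<dots> \<le> s + ennreal e"
    using s[OF l(1), of n] unfolding f_def[symmetric] by (rule add_right_mono)
  finally show "ennreal (KL_dual P Q g) \<le> s + ennreal e" .
qed

end

text \<open>An index in C pairs a truncation level with a rational combination of sets of G. C is
  countable and the same for all x, and for a fixed index both kernels integrate a fixed bounded
  measurable function.\<close>

lemma measurable_D_KL_kernel:
  fixes M :: "'a measure" and T :: "'b measure"
  assumes K: "K \<in> measurable M (prob_algebra T)" and K': "K' \<in> measurable M (prob_algebra T)"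
    and G: "countable G" "Int_stable G" "space T \<in> G" "sets T = sigma_sets (space T) G"
  shows "(\<lambda>x. D_KL (K x) (K' x)) \<in> borel_measurable M"
proof -
  define g :: "nat \<times> (rat \<times> 'b set) list \<Rightarrow> 'b \<Rightarrow> real" where "g = (\<lambda>(n, l) x. max (- real n) (min (real n) (rat_span l x :: real)))"
  define C where "C = (UNIV :: nat set) \<times> lists ((UNIV :: rat set) \<times> G)"
  define J where "J i x = ennreal (KL_dual (K x) (K' x) (g i))" for i x
  have "countable C" unfolding C_def using G(1) by (intro countable_SIGMA countable_lists) auto
  have GT: "A \<in> G \<Longrightarrow> A \<in> sets T" for A unfolding G(4) by (rule sigma_sets.Basic)
  have gT: "g i \<in> borel_measurable T" if "i \<in> C" for i
  proof -
    obtain n l where i: "i = (n, l)" by (cases i)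
    have [measurable]: "rat_span l \<in> borel_measurable T"
      using that GT by (intro measurable_rat_span[of _ G]) (auto simp: i C_def)
    show ?thesis unfolding i g_def by simp
  qed
  have bd: "\<bar>g i x\<bar> \<le> real (fst i)" for i x by (cases i) (auto simp: g_def)
  have "D_KL (K x) (K' x) = (SUP i\<in>C. J i x)" if x: "x \<in> space M" for x
  proof (rule antisym)
    note k = kernel_prob_space[OF K x] kernel_prob_space[OF K' x]
    have s: "sets (K x) = sets (K' x)" by (simp add: kernel_sets[OF K x] kernel_sets[OF K' x])
    note sp = kernel_space[OF K' x] kernel_sets[OF K' x]
    show "(SUP i\<in>C. J i x) \<le> D_KL (K x) (K' x)"
    proof (rule SUP_least)
      fix i assume "i \<in> C"
      show "J i x \<le> D_KL (K x) (K' x)"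
        unfolding J_def
        by (rule D_KL_ge_dual[OF k s _ bd]) (simp add: measurable_cong_sets[OF sp(2) refl] gT \<open>i \<in> C\<close>)
    qed
    show "D_KL (K x) (K' x) \<le> (SUP i\<in>C. J i x)"
    proof (rule D_KL_le_dual[OF k s], rule dual_bound_from_rat_span[OF k s G(2)])
      show "space (K' x) \<in> G" "sets (K' x) = sigma_sets (space (K' x)) G"
        using G(3,4) by (simp_all add: sp)
      fix n l assume "l \<in> lists ((UNIV :: rat set) \<times> G)"
      then have "(n, l) \<in> C" by (auto simp: C_def)
      then show "ennreal (KL_dual (K x) (K' x) (\<lambda>y. max (- real n) (min (real n) (rat_span l y)))) \<le> (SUP i\<in>C. J i x)"
        using SUP_upper[of "(n, l)" C "\<lambda>i. J i x"] by (simp add: J_def g_def)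
    qed
  qed
  moreover have "J i \<in> borel_measurable M" if "i \<in> C" for i
  proof -
    have g: "g i \<in> borel_measurable T" using that by (rule gT)
    then have e: "(\<lambda>y. exp (g i y) - 1) \<in> borel_measurable T" by simp
    have [measurable]: "(\<lambda>x. \<integral>y. g i y \<partial>K x) \<in> borel_measurable M"
      by (rule measurable_compose[OF kernel_subprob[OF K] integral_measurable_subprob_algebra[OF g]])
    have [measurable]: "(\<lambda>x. \<integral>y. exp (g i y) - 1 \<partial>K' x) \<in> borel_measurable M"
      by (rule measurable_compose[OF kernel_subprob[OF K'] integral_measurable_subprob_algebra[OF e]])
    show ?thesis
      unfolding J_def KL_dual_def by (intro measurable_compose[OF _ measurable_ennreal] borel_measurable_diff) fact+
  qed
  then have "(\<lambda>x. SUP i\<in>C. J i x) \<in> borel_measurable M"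
    using \<open>countable C\<close> by (intro borel_measurable_SUP) auto
  ultimately show ?thesis
    using measurable_cong[of M "\<lambda>x. D_KL (K x) (K' x)" "\<lambda>x. SUP i\<in>C. J i x" borel] by blast
qed

subsection \<open>Borel \<open>\<sigma>\<close>-algebras and conditional laws\<close>

lemma polish_imp_second_countable:
  assumes "polish S" shows "second_countable S"
proof -
  from assms have "separable_space S" and "completely_metrizable_space S" by (simp_all add: polish_def)
  then obtain M d where "Metric_space M d" and S: "S = Metric_space.mtopology M d"
    by (auto simp: completely_metrizable_space_def)
  interpret Metric_space M d by fact
  obtain C where C: "countable C" "C \<subseteq> M" "mtopology closure_of C = M"
    using \<open>separable_space S\<close> unfolding S separable_space_def by auto
  define B where "B = (\<lambda>(c, n::nat). mball c (inverse (Suc n))) ` (C \<times> UNIV)"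
  have "countable B" unfolding B_def using C(1) by auto
  moreover have "\<forall>V\<in>B. openin mtopology V" by (auto simp: B_def)
  moreover have "\<exists>V\<in>B. x \<in> V \<and> V \<subseteq> U" if U: "openin mtopology U" "x \<in> U" for U x
  proof -
    obtain r where r: "r > 0" "mball x r \<subseteq> U" and x: "x \<in> M"
      using U unfolding openin_mtopology by blast
    obtain n where n: "inverse (real (Suc n)) < r / 2"
      using reals_Archimedean[of "r / 2"] r(1) by auto
    have "x \<in> mtopology closure_of C" using C(3) x by simp
    then obtain c where c: "c \<in> C" "c \<in> mball x (inverse (Suc n))"
      using openin_mball[of x "inverse (Suc n)"] x unfolding in_closure_of
      by (metis centre_in_mball_iff inverse_positive_iff_positive of_nat_0_less_iff zero_less_Suc)
    have "mball c (inverse (Suc n)) \<subseteq> mball x r"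
    proof
      fix y assume "y \<in> mball c (inverse (Suc n))"
      then have y: "y \<in> M" "c \<in> M" "d c y < inverse (Suc n)" by (auto simp: in_mball)
      have "d x y \<le> d x c + d c y" using x y by (intro triangle) auto
      also have "\<dots> < r" using y(3) c(2) n by (auto simp: in_mball)
      finally show "y \<in> mball x r" using x y by (auto simp: in_mball)
    qed
    moreover have "x \<in> mball c (inverse (Suc n))" using c(2) x by (auto simp: in_mball commute)
    moreover have "mball c (inverse (Suc n)) \<in> B" using c(1) by (auto simp: B_def)
    ultimately show ?thesis using r(2) by blast
  qed
  ultimately have "second_countable mtopology"
    unfolding second_countable_def by (intro exI[of _ B] conjI allI impI) simp_all
  then show ?thesis by (simp add: S)
qed

lemma space_borel_of: "space (borel_of S) = topspace S"
  and sets_borel_of: "sets (borel_of S) = sigma_sets (topspace S) {U. openin S U}"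
  unfolding borel_of_def using openin_subset
  by (auto intro!: space_measure_of sets_measure_of)

text \<open>Finite intersections of a countable base are again countably many and
  intersection-stable, and every open set is a countable union of base sets. Intersecting with
  \<open>topspace S\<close> makes the empty intersection the whole space.\<close>

lemma second_countable_borel_of_generator:
  assumes "second_countable S"
  obtains G where "countable G" "Int_stable G" "space (borel_of S) \<in> G"
    "sets (borel_of S) = sigma_sets (space (borel_of S)) G"
proof -
  from assms obtain B where "countable B \<and> (\<forall>V\<in>B. openin S V) \<and>
      (\<forall>U x. openin S U \<and> x \<in> U \<longrightarrow> (\<exists>V\<in>B. x \<in> V \<and> V \<subseteq> U))"
    unfolding second_countable_def by (elim exE)
  then have B: "countable B" "\<And>V. V \<in> B \<Longrightarrow> openin S V"
    "\<And>U x. openin S U \<Longrightarrow> x \<in> U \<Longrightarrow> \<exists>V\<in>B. x \<in> V \<and> V \<subseteq> U"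
    by simp_all
  define G where "G = (\<lambda>F. topspace S \<inter> \<Inter>F) ` {F. F \<subseteq> B \<and> finite F}"
  have BG: "V \<in> G" if "V \<in> B" for V
    unfolding G_def using that openin_subset[OF B(2)[OF that]] by (intro image_eqI[of _ _ "{V}"]) auto
  have openG: "openin S V" if V: "V \<in> G" for V
  proof -
    obtain F where F: "F \<subseteq> B" "finite F" "V = topspace S \<inter> \<Inter>F" using V by (auto simp: G_def)
    have "openin S (topspace S \<inter> \<Inter>F)"
      using F(2,1) by (induction F rule: finite_induct) (auto simp: B(2) Int_left_commute intro: openin_Int)
    then show ?thesis by (simp add: F)
  qed
  show ?thesis
  proof
    show "countable G"
      unfolding G_def using countable_Collect_finite_subset[OF B(1)] by (simp add: conj_commute)
    show "Int_stable G"
    proof (rule Int_stableI)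
      fix a b assume "a \<in> G" "b \<in> G"
      then obtain F F' where "F \<subseteq> B" "finite F" "a = topspace S \<inter> \<Inter>F" "F' \<subseteq> B" "finite F'" "b = topspace S \<inter> \<Inter>F'"
        by (auto simp: G_def)
      then show "a \<inter> b \<in> G" unfolding G_def by (intro image_eqI[of _ _ "F \<union> F'"]) auto
    qed
    show "space (borel_of S) \<in> G"
      unfolding G_def space_borel_of by (intro image_eqI[of _ _ "{}"]) auto
    show "sets (borel_of S) = sigma_sets (space (borel_of S)) G"
      unfolding sets_borel_of space_borel_of
    proof (rule sigma_sets_eqI)
      fix U assume "U \<in> {U. openin S U}"
      then have "openin S U" by simp
      then have "U = \<Union>{V\<in>B. V \<subseteq> U}" using B(3) by blast
      moreover have "\<Union>{V\<in>B. V \<subseteq> U} \<in> sigma_sets (topspace S) G"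
        using B(1) BG by (intro sigma_sets_UNION) (auto intro: countable_subset)
      ultimately show "U \<in> sigma_sets (topspace S) G" by simp
    next
      fix V assume "V \<in> G"
      then show "V \<in> sigma_sets (topspace S) {U. openin S U}"
        using openG by (intro sigma_sets.Basic) simp
    qed
  qed
qed

section \<open>Conditional laws and conditional independence\<close>

lemma measure_eq_on_rectangles:
  assumes "sets N = sets (S \<Otimes>\<^sub>M T)" "sets N' = sets (S \<Otimes>\<^sub>M T)"
    and fin: "emeasure N (space S \<times> space T) \<noteq> \<infinity>"
    and eq: "\<And>A B. A \<in> sets S \<Longrightarrow> B \<in> sets T \<Longrightarrow> emeasure N (A \<times> B) = emeasure N' (A \<times> B)"
  shows "N = N'"
  by (rule measure_eqI_generator_eq[OF Int_stable_pair_measure_generator[of S T] pair_measure_closed,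
        where A = "\<lambda>_. space S \<times> space T"])
    (use assms in \<open>auto simp: sets_pair_measure\<close>)

text \<open>Mediates between \<open>regular_cond_law\<close>, stated in extended nonnegative reals,
  and the real integrals that characterize \<open>real_cond_exp\<close>; all integrands lie between
  0 and 1.\<close>

lemma regular_cond_law_integral_iff:
  assumes M: "prob_space M" and C [measurable]: "C \<in> measurable M U" and A [measurable]: "A \<in> measurable M S"
    and k: "k \<in> measurable U (prob_algebra S)" and D [measurable]: "D \<in> sets U" and F [measurable]: "F \<in> sets S"
  shows "emeasure M {\<omega> \<in> space M. C \<omega> \<in> D \<and> A \<omega> \<in> F} = (\<integral>\<^sup>+\<omega>. indicator D (C \<omega>) * emeasure (k (C \<omega>)) F \<partial>M)
   
    \<longleftrightarrow> (\<integral>\<omega>. indicator D (C \<omega>) * indicator F (A \<omega>) \<partial>M) = (\<integral>\<omega>. indicator D (C \<omega>) * measure (k (C \<omega>)) F \<partial>M)"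
    (is "emeasure M ?W = ?N \<longleftrightarrow> ?I = ?J")
proof -
  interpret M: prob_space M by fact
  have km: "(\<lambda>\<omega>. measure (k (C \<omega>)) F) \<in> borel_measurable M"
    by (rule measurable_compose[OF C measurable_compose[OF k measurable_measure_prob_algebra[OF F]]])
  have pk: "prob_space (k (C \<omega>))" if "\<omega> \<in> space M" for \<omega>
    by (rule kernel_prob_space[OF k measurable_space[OF C that]])
  have int: "integrable M (\<lambda>\<omega>. indicator D (C \<omega>) * measure (k (C \<omega>)) F :: real)"
  proof (rule M.integrable_const_bound[of _ 1], rule AE_I2)
    show "norm (indicator D (C \<omega>) * measure (k (C \<omega>)) F :: real) \<le> 1" if "\<omega> \<in> space M" for \<omega>
      using prob_space.prob_le_1[OF pk[OF that], of F] by (cases "C \<omega> \<in> D") simp_all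
    show "(\<lambda>\<omega>. indicator D (C \<omega>) * measure (k (C \<omega>)) F :: real) \<in> borel_measurable M"
      by (rule borel_measurable_times[OF _ km]) simp
  qed
  have "emeasure M ?W = ennreal (measure M ?W)"
    by (rule M.emeasure_eq_measure)
  also have "measure M ?W = (\<integral>\<omega>. indicator ?W \<omega> \<partial>M)"
    by simp
  also have "\<dots> = ?I"
    by (intro Bochner_Integration.integral_cong) (auto split: split_indicator)
  finally have 1: "emeasure M ?W = ennreal ?I" .
  have "?N = (\<integral>\<^sup>+\<omega>. ennreal (indicator D (C \<omega>) * measure (k (C \<omega>)) F) \<partial>M)"
    using finite_measure.emeasure_eq_measure[OF prob_space.finite_measure[OF pk]]
    by (intro nn_integral_cong) (auto split: split_indicator)
  also have "\<dots> = ennreal ?J"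
    by (rule nn_integral_eq_integral[OF int]) simp
  finally have 2: "?N = ennreal ?J" .
  have "0 \<le> (\<integral>\<omega>. indicator D (C \<omega>) * indicator F (A \<omega>) \<partial>M :: real)" "0 \<le> ?J"
    by (intro Bochner_Integration.integral_nonneg; simp)+
  then show ?thesis unfolding 1 2 by (simp add: ennreal_inj)
qed

text \<open>The definition compares two measures on rectangles, which generate the product. As an
  equality of measures, a conditional law can be substituted into the chain rules.\<close>

lemma regular_cond_law_iff_semidirect:
  assumes M: "prob_space M" and A [measurable]: "A \<in> measurable M S" and B [measurable]: "B \<in> measurable M T"
    and K: "K \<in> measurable S (prob_algebra T)"
  shows "regular_cond_law M S T A B K
    \<longleftrightarrow> distr M (S \<Otimes>\<^sub>M T) (\<lambda>\<omega>. (A \<omega>, B \<omega>)) = semidirect T (distr M S A) K"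
    (is "_ \<longleftrightarrow> ?l = ?r")
proof -
  interpret M: prob_space M by fact
  have MA: "prob_space (distr M S A)" by (rule M.prob_space_distr) simp
  have K': "K \<in> measurable (distr M S A) (prob_algebra T)" using K by simp
  note [measurable] = K kernel_subprob[OF K]
  have 1: "emeasure (?l) (E \<times> F) = emeasure M {\<omega> \<in> space M. A \<omega> \<in> E \<and> B \<omega> \<in> F}"
    if "E \<in> sets S" "F \<in> sets T" for E F
    using that by (subst emeasure_distr) (auto intro!: arg_cong2[where f = emeasure])
  have 2: "emeasure (?r) (E \<times> F) = (\<integral>\<^sup>+\<omega>. indicator E (A \<omega>) * emeasure (K (A \<omega>)) F \<partial>M)"
    if "E \<in> sets S" "F \<in> sets T" for E F
  proof -
    have [measurable]: "(\<lambda>x. emeasure (K x) F) \<in> borel_measurable S"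
      by (rule measurable_emeasure_kernel[OF kernel_subprob[OF K] that(2)])
    show ?thesis
      using that by (subst emeasure_semidirect_Times[OF K' MA]) (auto simp: nn_integral_distr)
  qed
  show ?thesis
  proof
    assume R: "regular_cond_law M S T A B K"
    show "?l = ?r"
    proof (rule measure_eq_on_rectangles)
      show "sets (?r) = sets (S \<Otimes>\<^sub>M T)"
        unfolding sets_semidirect[OF K' MA] by (rule sets_pair_measure_cong) simp_all
      have "prob_space (?l)" by (rule M.prob_space_distr) simp
      then show "emeasure (?l) (space S \<times> space T) \<noteq> \<infinity>"
        by (simp add: prob_space.emeasure_space_1 finite_measure.emeasure_finite prob_space_def)
    qed (use R 1 2 in \<open>simp_all add: regular_cond_law_def\<close>)
  next
    assume "?l = ?r"
    then show "regular_cond_law M S T A B K"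
      using 1 2 K A B by (simp add: regular_cond_law_def)
  qed
qed

text \<open>Independence of A and B given C means that knowing B in addition to C does not change
  the conditional law k of A. Both sides are reduced to \<open>?eq\<close>, tested on D for C, E for
  B and F for A; here \<kappa> is a version of the conditional expectation of the indicator of
  F.\<close>

lemma cond_indep_iff_regular_cond_law:
  assumes M: "prob_space M" and B [measurable]: "B \<in> measurable M T"
    and R: "regular_cond_law M U S C A k"
  shows "cond_indep M S T U A B C
    \<longleftrightarrow> regular_cond_law M (U \<Otimes>\<^sub>M T) S (\<lambda>\<omega>. (C \<omega>, B \<omega>)) A (\<lambda>z. k (fst z))"
    (is "_ \<longleftrightarrow> ?R")
proof -
  let ?CB = "\<lambda>\<omega>. (C \<omega>, B \<omega>)"
  interpret M: prob_space M by fact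
  have C [measurable]: "C \<in> measurable M U" and A [measurable]: "A \<in> measurable M S"
    and k: "k \<in> measurable U (prob_algebra S)"
    using R by (simp_all add: regular_cond_law_def)
  define H where "H = vimage_algebra (space M) C U"
  have CH: "C \<in> measurable H U"
    unfolding H_def using measurable_space[OF C] by (intro measurable_vimage_algebra1) auto
  have setsH: "sets H = {C -` D \<inter> space M | D. D \<in> sets U}"
    unfolding H_def using measurable_space[OF C] by (intro sets_vimage_algebra2) auto
  have sub: "subalgebra M H"
    unfolding subalgebra_def setsH using measurable_sets[OF C] by (auto simp: H_def)
  let ?E = "real_cond_exp M H"
  interpret H: finite_measure_subalgebra M H by standard (rule sub)
  define a b where "a F \<omega> = (indicator F (A \<omega>) :: real)" and "b E \<omega> = (indicator E (B \<omega>) :: real)" for F E \<omega>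
  define \<kappa> where "\<kappa> F \<omega> = measure (k (C \<omega>)) F" for F \<omega>
  define d where "d D \<omega> = (indicator D (C \<omega>) :: real)" for D \<omega>
  have aM [measurable]: "a F \<in> borel_measurable M" if "F \<in> sets S" for F
    unfolding a_def using that by measurable
  have bM [measurable]: "b E \<in> borel_measurable M" if "E \<in> sets T" for E
    unfolding b_def using that by measurable
  have \<kappa>H: "\<kappa> F \<in> borel_measurable H" if "F \<in> sets S" for F
    unfolding \<kappa>_def
    by (rule measurable_compose[OF CH measurable_compose[OF k measurable_measure_prob_algebra[OF that]]])
  have dH: "d D \<in> borel_measurable H" if "D \<in> sets U" for D
    unfolding d_def using CH that by measurable
  note HM = measurable_from_subalg[OF sub]
  note \<kappa>M [measurable] = HM[OF \<kappa>H] and dM [measurable] = HM[OF dH]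
  have bd: "0 \<le> a F \<omega>" "a F \<omega> \<le> 1" "0 \<le> b E \<omega>" "b E \<omega> \<le> 1" "0 \<le> d D \<omega>" "d D \<omega> \<le> 1" for F E D \<omega>
    by (simp_all add: a_def b_def d_def indicator_def)
  have bd\<kappa>: "0 \<le> \<kappa> F \<omega>" "\<omega> \<in> space M \<Longrightarrow> \<kappa> F \<omega> \<le> 1" for F \<omega>
    unfolding \<kappa>_def
    using prob_space.prob_le_1[OF kernel_prob_space[OF k measurable_space[OF C]]] by simp_all
  have set_int: "(\<integral>\<omega>\<in>(C -` D \<inter> space M). f \<omega> \<partial>M) = (\<integral>\<omega>. d D \<omega> * f \<omega> \<partial>M)" for D and f :: "_ \<Rightarrow> real"
    unfolding set_lebesgue_integral_def
    by (intro Bochner_Integration.integral_cong) (auto simp: d_def split: split_indicator)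
  have int1: "integrable M f" if "f \<in> borel_measurable M" "\<And>\<omega>. \<omega> \<in> space M \<Longrightarrow> 0 \<le> f \<omega> \<and> f \<omega> \<le> 1" for f :: "_ \<Rightarrow> real"
    using that by (intro M.integrable_const_bound[of _ 1] AE_I2) auto
  have da: "(\<integral>\<omega>. d D \<omega> * a F \<omega> \<partial>M) = (\<integral>\<omega>. d D \<omega> * \<kappa> F \<omega> \<partial>M)" if "D \<in> sets U" "F \<in> sets S" for D F
    using R that regular_cond_law_integral_iff[OF M C A k that]
    by (simp add: regular_cond_law_def d_def a_def \<kappa>_def)
  have ca: "AE \<omega> in M. ?E (a F) \<omega> = \<kappa> F \<omega>" if F: "F \<in> sets S" for F
  proof (rule H.real_cond_exp_charact)
    fix G assume "G \<in> sets H"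
    then obtain D where "G = C -` D \<inter> space M" "D \<in> sets U" by (auto simp: setsH)
    then show "(\<integral>\<omega>\<in>G. a F \<omega> \<partial>M) = (\<integral>\<omega>\<in>G. \<kappa> F \<omega> \<partial>M)" using da F by (simp add: set_int)
  qed (use F bd bd\<kappa> \<kappa>H in \<open>auto intro!: int1\<close>)
  \<comment> \<open>Both d and \<kappa> are measurable with respect to C, so they may be moved
    through the conditional expectation of b.\<close>
  have key: "(\<integral>\<omega>. d D \<omega> * (\<kappa> F \<omega> * ?E (b E) \<omega>) \<partial>M) = (\<integral>\<omega>. d D \<omega> * \<kappa> F \<omega> * b E \<omega> \<partial>M)"
    "integrable M (\<lambda>\<omega>. \<kappa> F \<omega> * ?E (b E) \<omega>)"
    if D: "D \<in> sets U" and F: "F \<in> sets S" and E: "E \<in> sets T" for D F E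
  proof -
    note [measurable] = \<kappa>M[OF F] bM[OF E] dM[OF D] \<kappa>H[OF F] dH[OF D]
    have "integrable M (\<lambda>\<omega>. d D \<omega> * \<kappa> F \<omega> * b E \<omega>)"
      using bd bd\<kappa> by (intro int1) (auto intro!: mult_le_one)
    from H.real_cond_exp_intg(2)[OF this]
    show "(\<integral>\<omega>. d D \<omega> * (\<kappa> F \<omega> * ?E (b E) \<omega>) \<partial>M) = (\<integral>\<omega>. d D \<omega> * \<kappa> F \<omega> * b E \<omega> \<partial>M)"
      by (simp add: mult.assoc)
    have "integrable M (\<lambda>\<omega>. \<kappa> F \<omega> * b E \<omega>)"
      using bd bd\<kappa> by (intro int1) (auto intro!: mult_le_one)
    from H.real_cond_exp_intg(1)[OF this]
    show "integrable M (\<lambda>\<omega>. \<kappa> F \<omega> * ?E (b E) \<omega>)" by simp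
  qed
  have int_ab: "integrable M (\<lambda>\<omega>. a F \<omega> * b E \<omega>)" "integrable M (\<lambda>\<omega>. d D \<omega> * (a F \<omega> * b E \<omega>))"
    if D: "D \<in> sets U" and F: "F \<in> sets S" and E: "E \<in> sets T" for D F E
  proof -
    note [measurable] = aM[OF F] bM[OF E] dM[OF D]
    show "integrable M (\<lambda>\<omega>. a F \<omega> * b E \<omega>)" "integrable M (\<lambda>\<omega>. d D \<omega> * (a F \<omega> * b E \<omega>))"
      using bd by (intro int1; auto intro!: mult_le_one)+
  qed
  have kf: "(\<lambda>z. k (fst z)) \<in> measurable (U \<Otimes>\<^sub>M T) (prob_algebra S)"
    by (rule measurable_compose[OF measurable_fst k])
  have CB [measurable]: "?CB \<in> measurable M (U \<Otimes>\<^sub>M T)" by measurable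
  let ?eq = "\<lambda>D E F. (\<integral>\<omega>. d D \<omega> * (a F \<omega> * b E \<omega>) \<partial>M) = (\<integral>\<omega>. d D \<omega> * \<kappa> F \<omega> * b E \<omega> \<partial>M)"
  let ?l = "\<lambda>W F. emeasure M {\<omega> \<in> space M. (C \<omega>, B \<omega>) \<in> W \<and> A \<omega> \<in> F}"
    and ?r = "\<lambda>W F. \<integral>\<^sup>+\<omega>. indicator W (C \<omega>, B \<omega>) * emeasure (k (C \<omega>)) F \<partial>M"
  have reg_iff: "?R
    \<longleftrightarrow> (\<forall>D\<in>sets U. \<forall>E\<in>sets T. \<forall>F\<in>sets S. ?eq D E F)"
  proof -
    have rect: "(?l (D \<times> E) F
        = ?r (D \<times> E) F)
      \<longleftrightarrow> ?eq D E F"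
      if D: "D \<in> sets U" and F: "F \<in> sets S" and E: "E \<in> sets T" for D F E
      using regular_cond_law_integral_iff[OF M CB A kf pair_measureI[OF D E] F]
      by (simp add: d_def a_def b_def \<kappa>_def indicator_times mult_ac)
    show ?thesis
    proof
      assume "?R"
      then show "\<forall>D\<in>sets U. \<forall>E\<in>sets T. \<forall>F\<in>sets S. ?eq D E F"
        unfolding regular_cond_law_def by (intro ballI rect[THEN iffD1]) (simp_all del: mem_Sigma_iff)
    next
      assume eq: "\<forall>D\<in>sets U. \<forall>E\<in>sets T. \<forall>F\<in>sets S. ?eq D E F"
      have "?l Z F
          = ?r Z F"
        if Z: "Z \<in> sets (U \<Otimes>\<^sub>M T)" and F: "F \<in> sets S" for Z F
      proof -
        have km: "(\<lambda>\<omega>. emeasure (k (C \<omega>)) F) \<in> borel_measurable M"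
          by (rule measurable_compose[OF C measurable_emeasure_kernel[OF kernel_subprob[OF k] F]])
        \<comment> \<open>For fixed F both sides of the required identity are measures in their
          first argument. They agree on rectangles and have finite mass, hence agree on the whole
          product.\<close>
        define N where "N = distr (density M (\<lambda>\<omega>. indicator F (A \<omega>))) (U \<Otimes>\<^sub>M T) ?CB"
        define N' where "N' = distr (density M (\<lambda>\<omega>. emeasure (k (C \<omega>)) F)) (U \<Otimes>\<^sub>M T) ?CB"
        have N: "emeasure N W = ?l W F"
          if [measurable]: "W \<in> sets (U \<Otimes>\<^sub>M T)" for W
        proof -
          note [measurable] = F
          have "emeasure N W = (\<integral>\<^sup>+\<omega>. indicator F (A \<omega>) * indicator (?CB -` W \<inter> space M) \<omega> \<partial>M)"
            unfolding N_def by (subst emeasure_distr) (simp_all add: emeasure_density)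
          also have "\<dots> = (\<integral>\<^sup>+\<omega>. indicator {\<omega> \<in> space M. (C \<omega>, B \<omega>) \<in> W \<and> A \<omega> \<in> F} \<omega> \<partial>M)"
            by (intro nn_integral_cong) (auto split: split_indicator)
          finally show ?thesis by simp
        qed
        have N': "emeasure N' W = ?r W F"
          if [measurable]: "W \<in> sets (U \<Otimes>\<^sub>M T)" for W
        proof -
          have "emeasure N' W = (\<integral>\<^sup>+\<omega>. emeasure (k (C \<omega>)) F * indicator (?CB -` W \<inter> space M) \<omega> \<partial>M)"
            unfolding N'_def
            by (subst emeasure_distr) (simp_all add: emeasure_density[OF km] measurable_sets[OF CB])
          also have "\<dots> = ?r W F"
            by (intro nn_integral_cong) (auto split: split_indicator)
          finally show ?thesis .
        qed
        have "N = N'"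
        proof (rule measure_eq_on_rectangles)
          show "emeasure N (space U \<times> space T) \<noteq> \<infinity>"
            by (subst N) auto
          fix D E assume "D \<in> sets U" "E \<in> sets T"
          then show "emeasure N (D \<times> E) = emeasure N' (D \<times> E)"
            using eq F rect[of D F E] by (simp add: N N' del: mem_Sigma_iff)
        qed (simp_all add: N_def N'_def)
        with N[OF Z] N'[OF Z] show ?thesis by simp
      qed
      then show "?R"
        using kf CB A unfolding regular_cond_law_def by simp
    qed
  qed
  have ci_iff: "cond_indep M S T U A B C \<longleftrightarrow> (\<forall>F\<in>sets S. \<forall>E\<in>sets T. AE \<omega> in M.
      ?E (\<lambda>\<omega>. a F \<omega> * b E \<omega>) \<omega> = ?E (a F) \<omega> * ?E (b E) \<omega>)"
    unfolding cond_indep_def Let_def H_def a_def b_def ..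
  show ?thesis
    unfolding reg_iff ci_iff
  proof (intro iffI ballI)
    fix D E F assume ci: "\<forall>F\<in>sets S. \<forall>E\<in>sets T. AE \<omega> in M.
        ?E (\<lambda>\<omega>. a F \<omega> * b E \<omega>) \<omega> = ?E (a F) \<omega> * ?E (b E) \<omega>"
      and D: "D \<in> sets U" and E: "E \<in> sets T" and F: "F \<in> sets S"
    note [measurable] = aM[OF F] bM[OF E] dM[OF D] \<kappa>M[OF F]
    have "(\<integral>\<omega>. d D \<omega> * (a F \<omega> * b E \<omega>) \<partial>M) = (\<integral>\<omega>. d D \<omega> * ?E (\<lambda>\<omega>. a F \<omega> * b E \<omega>) \<omega> \<partial>M)"
      by (rule H.real_cond_exp_intg(2)[symmetric, OF int_ab(2)[OF D F E] dH[OF D]]) simp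
    also have "\<dots> = (\<integral>\<omega>. d D \<omega> * (\<kappa> F \<omega> * ?E (b E) \<omega>) \<partial>M)"
    proof (rule integral_cong_AE)
      show "AE \<omega> in M. d D \<omega> * ?E (\<lambda>\<omega>. a F \<omega> * b E \<omega>) \<omega> = d D \<omega> * (\<kappa> F \<omega> * ?E (b E) \<omega>)"
        using ci[rule_format, OF F E] ca[OF F] by eventually_elim simp
    qed simp_all
    also have "\<dots> = (\<integral>\<omega>. d D \<omega> * \<kappa> F \<omega> * b E \<omega> \<partial>M)" by (rule key(1)[OF D F E])
    finally show "?eq D E F" .
  next
    fix F E assume eq: "\<forall>D\<in>sets U. \<forall>E\<in>sets T. \<forall>F\<in>sets S. ?eq D E F"
      and E: "E \<in> sets T" and F: "F \<in> sets S"
    have "AE \<omega> in M. ?E (\<lambda>\<omega>. a F \<omega> * b E \<omega>) \<omega> = \<kappa> F \<omega> * ?E (b E) \<omega>"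
    proof (rule H.real_cond_exp_charact)
      fix G assume "G \<in> sets H"
      then obtain D where "G = C -` D \<inter> space M" "D \<in> sets U" by (auto simp: setsH)
      then show "(\<integral>\<omega>\<in>G. a F \<omega> * b E \<omega> \<partial>M) = (\<integral>\<omega>\<in>G. \<kappa> F \<omega> * ?E (b E) \<omega> \<partial>M)"
        using eq F E key(1)[of D F E] by (simp add: set_int)
    next
      show "(\<lambda>\<omega>. \<kappa> F \<omega> * ?E (b E) \<omega>) \<in> borel_measurable H"
        using \<kappa>H[OF F] by simp
    qed (use int_ab(1)[OF sets.empty_sets F E] key(2)[OF sets.empty_sets F E] in auto)
    then show "AE \<omega> in M. ?E (\<lambda>\<omega>. a F \<omega> * b E \<omega>) \<omega> = ?E (a F) \<omega> * ?E (b E) \<omega>"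
      using ca[OF F] by eventually_elim simp
  qed
qed

subsection \<open>Paths and the backward recursion\<close>

lemma space_paths_0: "space (paths X 0) = {\<lambda>_. undefined}"
  by (simp add: paths_def space_PiM_empty)

lemma measurable_upto_time:
  assumes "s \<le> t" shows "upto_time s \<in> measurable (paths X t) (paths X s)"
  unfolding paths_def using assms by (intro measurable_restrict_subset) auto

lemma measurable_path_component:
  assumes "s \<in> {1..t}" shows "(\<lambda>x. x s) \<in> measurable (paths X t) (borel_of (X s))"
  unfolding paths_def using assms by (rule measurable_component_singleton)

lemma measurable_path_update:
  "(\<lambda>(x, x'). x(Suc t := x')) \<in> measurable (paths X t \<Otimes>\<^sub>M borel_of (X (Suc t))) (paths X (Suc t))"
proof -
  have "{1..Suc t} = insert (Suc t) {1..t}" by auto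
  then show ?thesis unfolding paths_def using measurable_add_dim by simp
qed

lemma upto_time_self:
  assumes "x \<in> space (paths X t)" shows "upto_time t x = x"
  using assms by (auto simp: paths_def space_PiM PiE_def extensional_restrict)

lemma update_upto_time: "(upto_time t x)(Suc t := x (Suc t)) = upto_time (Suc t) x"
  by (auto simp: fun_eq_iff restrict_def)

lemma upto_time_upto_time: "s \<le> t \<Longrightarrow> upto_time s (upto_time t x) = upto_time s x"
  by (auto simp: fun_eq_iff restrict_def)

type_synonym ('a, 'b) path_pair = "(nat \<Rightarrow> 'a) \<times> (nat \<Rightarrow> 'b)"

text \<open>Each time step is made in two half-steps, X first and then Y. The extension maps append
  one coordinate, and \<open>split_X\<close>, \<open>split_Y\<close> below undo this on the relevant
  spaces, which is what \<open>D_KL_distr\<close> asks for.\<close>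

definition ext_X :: "nat \<Rightarrow> ('a, 'b) path_pair \<times> 'a \<Rightarrow> ('a, 'b) path_pair" where
  "ext_X t = (\<lambda>((x, y), x'). (x(Suc t := x'), y))"

definition ext_Y :: "nat \<Rightarrow> ('a, 'b) path_pair \<times> 'b \<Rightarrow> ('a, 'b) path_pair" where
  "ext_Y t = (\<lambda>((x, y), y'). (x, y(Suc t := y')))"

definition split_X :: "nat \<Rightarrow> ('a, 'b) path_pair \<Rightarrow> ('a, 'b) path_pair \<times> 'a" where
  "split_X t = (\<lambda>(x, y). ((upto_time t x, y), x (Suc t)))"

definition split_Y :: "nat \<Rightarrow> ('a, 'b) path_pair \<Rightarrow> ('a, 'b) path_pair \<times> 'b" where
  "split_Y t = (\<lambda>(x, y). ((x, upto_time t y), y (Suc t)))"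

lemma measurable_ext_X:
  "ext_X t \<in> measurable ((paths X t \<Otimes>\<^sub>M paths Y s) \<Otimes>\<^sub>M borel_of (X (Suc t))) (paths X (Suc t) \<Otimes>\<^sub>M paths Y s)"
proof -
  have "(\<lambda>z. (\<lambda>(x, x'). x(Suc t := x')) (fst (fst z), snd z))
      \<in> measurable ((paths X t \<Otimes>\<^sub>M paths Y s) \<Otimes>\<^sub>M borel_of (X (Suc t))) (paths X (Suc t))"
    by (rule measurable_compose[OF _ measurable_path_update]) measurable
  then show ?thesis
    unfolding ext_X_def split_beta' by (intro measurable_Pair) simp_all
qed

lemma measurable_ext_Y:
  "ext_Y t \<in> measurable ((paths X s \<Otimes>\<^sub>M paths Y t) \<Otimes>\<^sub>M borel_of (Y (Suc t))) (paths X s \<Otimes>\<^sub>M paths Y (Suc t))"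
proof -
  have "(\<lambda>z. (\<lambda>(x, x'). x(Suc t := x')) (snd (fst z), snd z))
      \<in> measurable ((paths X s \<Otimes>\<^sub>M paths Y t) \<Otimes>\<^sub>M borel_of (Y (Suc t))) (paths Y (Suc t))"
    by (rule measurable_compose[OF _ measurable_path_update]) measurable
  then show ?thesis
    unfolding ext_Y_def split_beta' by (intro measurable_Pair) simp_all
qed

lemma measurable_split_X:
  "split_X t \<in> measurable (paths X (Suc t) \<Otimes>\<^sub>M paths Y s) ((paths X t \<Otimes>\<^sub>M paths Y s) \<Otimes>\<^sub>M borel_of (X (Suc t)))"
  unfolding split_X_def split_beta'
  by (intro measurable_Pair measurable_compose[OF measurable_fst measurable_upto_time]
      measurable_compose[OF measurable_fst measurable_path_component]) simp_all

lemma measurable_split_Y: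
  "split_Y t \<in> measurable (paths X s \<Otimes>\<^sub>M paths Y (Suc t)) ((paths X s \<Otimes>\<^sub>M paths Y t) \<Otimes>\<^sub>M borel_of (Y (Suc t)))"
  unfolding split_Y_def split_beta'
  by (intro measurable_Pair measurable_compose[OF measurable_snd measurable_upto_time]
      measurable_compose[OF measurable_snd measurable_path_component]) simp_all

lemma split_ext_X: "z \<in> space ((paths X t \<Otimes>\<^sub>M paths Y s) \<Otimes>\<^sub>M T) \<Longrightarrow> split_X t (ext_X t z) = z"
  by (auto simp: split_X_def ext_X_def space_pair_measure upto_time_self simp del: One_nat_def)

lemma split_ext_Y: "z \<in> space ((paths X s \<Otimes>\<^sub>M paths Y t) \<Otimes>\<^sub>M T) \<Longrightarrow> split_Y t (ext_Y t z) = z"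
  by (auto simp: split_Y_def ext_Y_def space_pair_measure upto_time_self simp del: One_nat_def)

text \<open>In \<open>semidirect\<close> the target algebra mentions the base M, which itself may
  vary with a parameter. With a fixed algebra instead, the measurability rules for
  \<open>bind\<close> become applicable.\<close>

lemma semidirect_eq_bind:
  assumes "sets M = sets S" "\<And>x. x \<in> space S \<Longrightarrow> sets (K x) = sets T"
  shows "semidirect T M K = M \<bind> (\<lambda>x. distr (K x) (S \<Otimes>\<^sub>M T) (\<lambda>y. (x, y)))"
  unfolding semidirect_def
  using assms by (intro bind_cong refl distr_cong sets_pair_measure_cong) auto

text \<open>Neither \<mu> nor \<gamma> occurs: the recursion and its measurability concern the
  kernels alone. The link to \<gamma> is made in \<open>causal_problem\<close>.\<close>

locale kernel_data =
  fixes N :: nat and X :: "nat \<Rightarrow> 'a topology" and Y :: "nat \<Rightarrow> 'b topology"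
    and m :: "nat \<Rightarrow> (nat \<Rightarrow> 'a) \<Rightarrow> 'a measure" and gX :: "('a, 'b, 'a) kernels" and gY :: "('a, 'b, 'b) kernels"
  assumes m_kernel: "t < N \<Longrightarrow> m (Suc t) \<in> measurable (paths X t) (prob_algebra (borel_of (X (Suc t))))"
    and gX_kernel: "t < N \<Longrightarrow> gX (Suc t) \<in> measurable (paths X t \<Otimes>\<^sub>M paths Y t) (prob_algebra (borel_of (X (Suc t))))"
    and gY_kernel: "t < N \<Longrightarrow> gY (Suc t) \<in> measurable (paths X (Suc t) \<Otimes>\<^sub>M paths Y t) (prob_algebra (borel_of (Y (Suc t))))"
    and second_countable_X: "t < N \<Longrightarrow> second_countable (X (Suc t))"
begin

abbreviation "bX t \<equiv> borel_of (X t)"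
abbreviation "bY t \<equiv> borel_of (Y t)"
abbreviation "S t \<equiv> paths X t \<Otimes>\<^sub>M paths Y t"
abbreviation "S' t \<equiv> paths X (Suc t) \<Otimes>\<^sub>M paths Y t"
abbreviation "f \<equiv> cost N Y m gX gY"
abbreviation "kX \<equiv> opt_X m :: ('a, 'b, 'a) kernels"
abbreviation "kY \<equiv> opt_Y gY f"

lemma kX: "t < N \<Longrightarrow> kX (Suc t) \<in> measurable (S t) (prob_algebra (bX (Suc t)))"
  unfolding opt_X_def split_beta' by (rule measurable_compose[OF measurable_fst m_kernel])

lemma kY_eq: "kY (Suc t) = (\<lambda>z. gibbs (gY (Suc t) z) (\<lambda>y'. f (Suc t) (ext_Y t (z, y'))))"
  by (simp add: opt_Y_def ext_Y_def split_beta')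

text \<open>The optimal remaining cost at the half-step, when the next X-coordinate is known and the
  next Y-coordinate is still to be drawn.\<close>

definition V :: "nat \<Rightarrow> ('a, 'b) path_pair \<Rightarrow> ennreal" where
  "V t z = neg_ln (\<integral>\<^sup>+y'. exp_neg (f (Suc t) (ext_Y t (z, y'))) \<partial>gY (Suc t) z)"

lemma f_ext_Y:
  assumes "f (Suc t) \<in> borel_measurable (S (Suc t))"
  shows "(\<lambda>z. f (Suc t) (ext_Y t z)) \<in> borel_measurable (S' t \<Otimes>\<^sub>M bY (Suc t))"
  by (rule measurable_compose[OF measurable_ext_Y assms])

text \<open>This and the following auxiliary facts assume measurability of the next cost function,
  because they are used inside the backward induction that proves it.\<close>

lemma kY_aux:
  assumes "t < N" "f (Suc t) \<in> borel_measurable (S (Suc t))"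
  shows "kY (Suc t) \<in> measurable (S' t) (prob_algebra (bY (Suc t)))"
  unfolding kY_eq by (rule measurable_gibbs[OF gY_kernel[OF assms(1)] f_ext_Y[OF assms(2)]])

lemma V_aux:
  assumes "t < N" "f (Suc t) \<in> borel_measurable (S (Suc t))"
  shows "V t \<in> borel_measurable (S' t)"
proof -
  have "(\<lambda>z. exp_neg (f (Suc t) (ext_Y t z))) \<in> borel_measurable (S' t \<Otimes>\<^sub>M bY (Suc t))"
    by (rule measurable_compose[OF f_ext_Y[OF assms(2)] measurable_exp_neg])
  from measurable_kernel_nn_integral[OF gY_kernel[OF assms(1)] this]
  show ?thesis unfolding V_def[abs_def] by (rule measurable_compose[OF _ measurable_neg_ln])
qed

text \<open>A Bellman equation. The chain rule separates the X-part of the one-step law P, and the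
  Gibbs identity applied to P itself has \<open>D_KL P P\<close> = 0 on its right, leaving the
  integral of V.\<close>

lemma cost_eq_aux:
  assumes t: "t < N" and f: "f (Suc t) \<in> borel_measurable (S (Suc t))" and z: "z \<in> space (S t)"
  shows "f t z = D_KL (kX (Suc t) z) (gX (Suc t) z) + (\<integral>\<^sup>+x'. V t (ext_X t (z, x')) \<partial>kX (Suc t) z)"
proof -
  obtain x y where xy: "z = (x, y)" by (cases z)
  define M where "M = kX (Suc t) z"
  define M' where "M' = gX (Suc t) z"
  have M: "prob_space M" "sets M = sets (bX (Suc t))"
    unfolding M_def using kernel_prob_space[OF kX[OF t] z] kernel_sets[OF kX[OF t] z] by auto
  have M': "prob_space M'" "sets M' = sets (bX (Suc t))"
    unfolding M'_def using kernel_prob_space[OF gX_kernel[OF t] z] kernel_sets[OF gX_kernel[OF t] z] by auto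
  have Zx: "(\<lambda>x'. ext_X t (z, x')) \<in> measurable (bX (Suc t)) (S' t)"
    by (rule measurable_compose[OF measurable_Pair1'[OF z] measurable_ext_X])
  define K where "K x' = gY (Suc t) (ext_X t (z, x'))" for x'
  define g where "g w = f (Suc t) (ext_Y t (ext_X t (z, fst w), snd w))" for w
  define P where "P = semidirect (bY (Suc t)) M (\<lambda>x'. gibbs (K x') (\<lambda>y'. g (x', y')))"
  have K0: "K \<in> measurable (bX (Suc t)) (prob_algebra (bY (Suc t)))"
    unfolding K_def by (rule measurable_compose[OF Zx gY_kernel[OF t]])
  have K: "K \<in> measurable M (prob_algebra (bY (Suc t)))"
    using K0 by (simp add: measurable_cong_sets[OF M(2) refl])
  have K': "K \<in> measurable M' (prob_algebra (bY (Suc t)))"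
    using K0 by (simp add: measurable_cong_sets[OF M'(2) refl])
  have "(\<lambda>w. (ext_X t (z, fst w), snd w)) \<in> measurable (bX (Suc t) \<Otimes>\<^sub>M bY (Suc t)) (S' t \<Otimes>\<^sub>M bY (Suc t))"
    by (intro measurable_Pair measurable_compose[OF measurable_fst Zx] measurable_snd)
  from measurable_compose[OF this f_ext_Y[OF f]]
  have g: "g \<in> borel_measurable (M \<Otimes>\<^sub>M bY (Suc t))"
    unfolding g_def by (simp add: measurable_cong_sets[OF sets_pair_measure_cong[OF M(2) refl] refl])
  note G = measurable_gibbs[OF K g]
  have P: "prob_space P" "sets P = sets (M \<Otimes>\<^sub>M bY (Suc t))"
    unfolding P_def by (rule prob_space_semidirect[OF G M(1)], rule sets_semidirect[OF G M(1)])
  have PM: "distr P M fst = M"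
    unfolding P_def by (rule distr_semidirect_fst[OF G M(1)])
  have sPM': "sets P = sets (M' \<Otimes>\<^sub>M bY (Suc t))"
    unfolding P(2) by (rule sets_pair_measure_cong) (simp_all add: M M')
  have PM': "M = distr P M' fst"
    by (subst PM[symmetric], rule distr_cong) (simp_all add: M M')
  have V: "neg_ln (\<integral>\<^sup>+y'. exp_neg (g (x', y')) \<partial>K x') = V t (ext_X t (z, x'))" for x'
    by (simp add: V_def g_def K_def)
  have "f t z = D_KL P (semidirect (bY (Suc t)) M' K) + (\<integral>\<^sup>+w. g w \<partial>P)"
    using t unfolding xy
    by (subst cost.simps)
      (simp add: Let_def joint_kernel_def P_def M_def M'_def K_def[abs_def] g_def[abs_def] xy ext_X_def ext_Y_def opt_Y_def opt_X_def split_beta')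
  also have "\<dots> = D_KL M M' + (D_KL P (semidirect (bY (Suc t)) M K) + (\<integral>\<^sup>+w. g w \<partial>P))"
    by (simp add: D_KL_semidirect_marginal[OF M'(1) K' P(1) sPM' PM'] add.assoc)
  also have "D_KL P (semidirect (bY (Suc t)) M K) + (\<integral>\<^sup>+w. g w \<partial>P)
      = D_KL P P + (\<integral>\<^sup>+x'. neg_ln (\<integral>\<^sup>+y'. exp_neg (g (x', y')) \<partial>K x') \<partial>M)"
    using D_KL_gibbs[OF M(1) K g P PM] unfolding P_def[symmetric] .
  also have "\<dots> = (\<integral>\<^sup>+x'. V t (ext_X t (z, x')) \<partial>M)"
    by (simp add: D_KL_self[OF P(1)] V)
  finally show ?thesis by (simp add: M_def M'_def)
qed

lemma measurable_cost: "t \<le> N \<Longrightarrow> f t \<in> borel_measurable (S t)"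
proof (induction rule: inc_induct)
  case base
  show ?case by (subst cost.simps) simp
next
  case (step t)
  then have t: "t < N" and f: "f (Suc t) \<in> borel_measurable (S (Suc t))" by simp_all
  obtain G where G: "countable G" "Int_stable G" "space (bX (Suc t)) \<in> G"
      "sets (bX (Suc t)) = sigma_sets (space (bX (Suc t))) G"
    by (rule second_countable_borel_of_generator[OF second_countable_X[OF t]])
  have "(\<lambda>z. D_KL (kX (Suc t) z) (gX (Suc t) z)) \<in> borel_measurable (S t)"
    by (rule measurable_D_KL_kernel[OF kX[OF t] gX_kernel[OF t] G])
  moreover have "(\<lambda>z. \<integral>\<^sup>+x'. V t (ext_X t (z, x')) \<partial>kX (Suc t) z) \<in> borel_measurable (S t)"
    by (rule measurable_kernel_nn_integral[OF kX[OF t]])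
      (rule measurable_compose[OF measurable_ext_X V_aux[OF t f]])
  ultimately have "(\<lambda>z. D_KL (kX (Suc t) z) (gX (Suc t) z) + (\<integral>\<^sup>+x'. V t (ext_X t (z, x')) \<partial>kX (Suc t) z))
      \<in> borel_measurable (S t)" by (rule borel_measurable_add)
  then show ?case
    by (rule measurable_cong[THEN iffD2, rotated]) (rule cost_eq_aux[OF t f])
qed

lemma kY: "t < N \<Longrightarrow> kY (Suc t) \<in> measurable (S' t) (prob_algebra (bY (Suc t)))"
  by (intro kY_aux measurable_cost) auto

lemma measurable_V: "t < N \<Longrightarrow> V t \<in> borel_measurable (S' t)"
  by (intro V_aux measurable_cost) auto

lemma cost_eq:
  "t < N \<Longrightarrow> z \<in> space (S t) \<Longrightarrow>
    f t z = D_KL (kX (Suc t) z) (gX (Suc t) z) + (\<integral>\<^sup>+x'. V t (ext_X t (z, x')) \<partial>kX (Suc t) z)"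
  by (intro cost_eq_aux measurable_cost) auto

end

text \<open>Otherwise the simplifier turns the \<open>{1..t}\<close> in \<^const>\<open>paths\<close> and \<open>upto_time\<close> into \<open>{Suc 0..t}\<close>.\<close>

declare One_nat_def [simp del]

section \<open>Truncations of a law and its one-step joint laws\<close>

context kernel_data
begin

abbreviation "cut_at s t \<equiv> \<lambda>(x, y). (upto_time s x, upto_time t y)"

definition trunc :: "nat \<Rightarrow> nat \<Rightarrow> ('a, 'b) path_pair measure \<Rightarrow> ('a, 'b) path_pair measure" where
  "trunc s t \<rho> = distr \<rho> (paths X s \<Otimes>\<^sub>M paths Y t) (cut_at s t)"

text \<open>The nesting as past and new coordinate is the shape produced by
  \<open>semidirect\<close>; \<open>ext_X\<close> carries it back to a law of paths.\<close>

definition joint_X :: "nat \<Rightarrow> ('a, 'b) path_pair measure \<Rightarrow> (('a, 'b) path_pair \<times> 'a) measure" where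
  "joint_X t \<rho> = distr \<rho> (S t \<Otimes>\<^sub>M bX (Suc t)) (\<lambda>(x, y). ((upto_time t x, upto_time t y), x (Suc t)))"

definition joint_Y :: "nat \<Rightarrow> ('a, 'b) path_pair measure \<Rightarrow> (('a, 'b) path_pair \<times> 'b) measure" where
  "joint_Y t \<rho> = distr \<rho> (S' t \<Otimes>\<^sub>M bY (Suc t)) (\<lambda>(x, y). ((upto_time (Suc t) x, upto_time t y), y (Suc t)))"

abbreviation "opt_joint_X t \<rho> \<equiv> semidirect (bX (Suc t)) (trunc t t \<rho>) (kX (Suc t))"
abbreviation "opt_joint_Y t \<rho> \<equiv> semidirect (bY (Suc t)) (trunc (Suc t) t \<rho>) (kY (Suc t))"

definition deficit :: "nat \<Rightarrow> ('a, 'b) path_pair measure \<Rightarrow> ennreal" where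
  "deficit t \<rho> = D_KL (joint_Y t \<rho>) (opt_joint_Y t \<rho>)"

lemma measurable_trunc:
  assumes "s \<le> s'" "t \<le> t'"
  shows "cut_at s t \<in> measurable (paths X s' \<Otimes>\<^sub>M paths Y t') (paths X s \<Otimes>\<^sub>M paths Y t)"
  unfolding split_beta'
  by (intro measurable_Pair measurable_compose[OF measurable_fst measurable_upto_time]
      measurable_compose[OF measurable_snd measurable_upto_time] assms)

lemma measurable_joint_X:
  assumes "t < N"
  shows "(\<lambda>(x, y). ((upto_time t x, upto_time t y), x (Suc t))) \<in> measurable (S N) (S t \<Otimes>\<^sub>M bX (Suc t))"
  unfolding split_beta' using assms
  by (intro measurable_Pair measurable_compose[OF measurable_fst measurable_upto_time]
      measurable_compose[OF measurable_snd measurable_upto_time]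
      measurable_compose[OF measurable_fst measurable_path_component]) auto

lemma measurable_joint_Y:
  assumes "t < N"
  shows "(\<lambda>(x, y). ((upto_time (Suc t) x, upto_time t y), y (Suc t))) \<in> measurable (S N) (S' t \<Otimes>\<^sub>M bY (Suc t))"
  unfolding split_beta' using assms
  by (intro measurable_Pair measurable_compose[OF measurable_fst measurable_upto_time]
      measurable_compose[OF measurable_snd measurable_upto_time]
      measurable_compose[OF measurable_snd measurable_path_component]) auto

lemma sets_trunc: "sets (trunc s t \<rho>) = sets (paths X s \<Otimes>\<^sub>M paths Y t)"
  and sets_joint_X: "sets (joint_X t \<rho>) = sets (S t \<Otimes>\<^sub>M bX (Suc t))"
  and sets_joint_Y: "sets (joint_Y t \<rho>) = sets (S' t \<Otimes>\<^sub>M bY (Suc t))"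
  by (simp_all add: trunc_def joint_X_def joint_Y_def)

context
  fixes \<rho> assumes \<rho>: "\<rho> \<in> space (prob_algebra (S N))"
begin

lemma prob_\<rho>: "prob_space \<rho>" and sets_\<rho>: "sets \<rho> = sets (S N)"
  using \<rho> by (auto simp: space_prob_algebra)

lemma measurable_\<rho>: "measurable \<rho> M = measurable (S N) M"
  by (rule measurable_cong_sets[OF sets_\<rho> refl])

lemma prob_trunc: "s \<le> N \<Longrightarrow> t \<le> N \<Longrightarrow> prob_space (trunc s t \<rho>)"
  unfolding trunc_def by (rule prob_space.prob_space_distr[OF prob_\<rho>]) (simp add: measurable_\<rho> measurable_trunc)

lemma prob_joint_X: "t < N \<Longrightarrow> prob_space (joint_X t \<rho>)"
  unfolding joint_X_def by (rule prob_space.prob_space_distr[OF prob_\<rho>]) (simp add: measurable_\<rho> measurable_joint_X)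

lemma prob_joint_Y: "t < N \<Longrightarrow> prob_space (joint_Y t \<rho>)"
  unfolding joint_Y_def by (rule prob_space.prob_space_distr[OF prob_\<rho>]) (simp add: measurable_\<rho> measurable_joint_Y)

lemma distr_joint_X_fst: "t < N \<Longrightarrow> distr (joint_X t \<rho>) (S t) fst = trunc t t \<rho>"
  unfolding joint_X_def trunc_def
  by (subst distr_distr) (simp_all add: measurable_\<rho> measurable_joint_X[unfolded split_beta'] comp_def split_beta')

lemma distr_joint_Y_fst: "t < N \<Longrightarrow> distr (joint_Y t \<rho>) (S' t) fst = trunc (Suc t) t \<rho>"
  unfolding joint_Y_def trunc_def
  by (subst distr_distr) (simp_all add: measurable_\<rho> measurable_joint_Y[unfolded split_beta'] comp_def split_beta')

lemma distr_joint_X_ext: "t < N \<Longrightarrow> distr (joint_X t \<rho>) (S' t) (ext_X t) = trunc (Suc t) t \<rho>"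
  unfolding joint_X_def trunc_def
  by (subst distr_distr)
    (simp_all add: measurable_\<rho> measurable_joint_X[unfolded split_beta'] measurable_ext_X[unfolded ext_X_def split_beta'] comp_def split_beta' ext_X_def update_upto_time)

lemma distr_joint_Y_ext: "t < N \<Longrightarrow> distr (joint_Y t \<rho>) (S (Suc t)) (ext_Y t) = trunc (Suc t) (Suc t) \<rho>"
  unfolding joint_Y_def trunc_def
  by (subst distr_distr)
    (simp_all add: measurable_\<rho> measurable_joint_Y[unfolded split_beta'] measurable_ext_Y[unfolded ext_Y_def split_beta'] comp_def split_beta' ext_Y_def update_upto_time)

lemma distr_trunc_split_X: "t < N \<Longrightarrow> distr (trunc (Suc t) t \<rho>) (S t \<Otimes>\<^sub>M bX (Suc t)) (split_X t) = joint_X t \<rho>"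
  unfolding joint_X_def trunc_def
  by (subst distr_distr)
    (simp_all add: measurable_\<rho> measurable_trunc[unfolded split_beta'] measurable_split_X[unfolded split_X_def split_beta'] comp_def split_beta' split_X_def upto_time_upto_time)

lemma distr_trunc_split_Y: "t < N \<Longrightarrow> distr (trunc (Suc t) (Suc t) \<rho>) (S' t \<Otimes>\<^sub>M bY (Suc t)) (split_Y t) = joint_Y t \<rho>"
  unfolding joint_Y_def trunc_def
  by (subst distr_distr)
    (simp_all add: measurable_\<rho> measurable_trunc[unfolded split_beta'] measurable_split_Y[unfolded split_Y_def split_beta'] comp_def split_beta' split_Y_def upto_time_upto_time)

lemma distr_trunc_trunc:
  "s \<le> s' \<Longrightarrow> t \<le> t' \<Longrightarrow> s' \<le> N \<Longrightarrow> t' \<le> N \<Longrightarrow>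
    distr (trunc s' t' \<rho>) (paths X s \<Otimes>\<^sub>M paths Y t) (cut_at s t) = trunc s t \<rho>"
  unfolding trunc_def
  by (subst distr_distr)
    (simp_all add: measurable_\<rho> measurable_trunc[unfolded split_beta'] comp_def split_beta' upto_time_upto_time)

lemma trunc_N: "trunc N N \<rho> = \<rho>"
proof -
  have "trunc N N \<rho> = distr \<rho> \<rho> (\<lambda>z. z)"
    unfolding trunc_def
    by (rule distr_cong)
      (auto simp: sets_\<rho> sets_eq_imp_space_eq[OF sets_\<rho>] space_pair_measure upto_time_self)
  then show ?thesis by simp
qed

text \<open>There is only one pair of paths at time 0, so all laws share this truncation; therefore
  the initial functional is the same for every competitor.\<close>

lemma trunc_0: "trunc 0 0 \<rho> = return (S 0) (\<lambda>_. undefined, \<lambda>_. undefined)"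
proof -
  have "trunc 0 0 \<rho> = distr \<rho> (S 0) (\<lambda>_. (\<lambda>_. undefined, \<lambda>_. undefined))"
    unfolding trunc_def by (simp add: split_beta' restrict_def)
  also have "\<dots> = return (S 0) (\<lambda>_. undefined, \<lambda>_. undefined)"
  proof (rule measure_eqI)
    fix A assume "A \<in> sets (distr \<rho> (S 0) (\<lambda>_. (\<lambda>_. undefined, \<lambda>_. undefined)))"
    then have A: "A \<in> sets (S 0)" by simp
    have "emeasure (distr \<rho> (S 0) (\<lambda>_. (\<lambda>_. undefined, \<lambda>_. undefined))) A
      = emeasure \<rho> ((\<lambda>_. (\<lambda>_. undefined, \<lambda>_. undefined)) -` A \<inter> space \<rho>)"
      by (rule emeasure_distr[OF _ A]) (simp add: space_pair_measure space_paths_0)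
    then show "emeasure (distr \<rho> (S 0) (\<lambda>_. (\<lambda>_. undefined, \<lambda>_. undefined))) A
      = emeasure (return (S 0) (\<lambda>_. undefined, \<lambda>_. undefined)) A"
      using A prob_space.emeasure_space_1[OF prob_\<rho>]
      by (cases "(\<lambda>_. undefined, \<lambda>_. undefined) \<in> A") simp_all
  qed simp
  finally show ?thesis .
qed

end

lemma joint_X_eq_iff:
  assumes \<rho>: "\<rho> \<in> space (prob_algebra (S N))" and t: "t < N"
    and k: "k \<in> measurable (S t) (prob_algebra (bX (Suc t)))"
  shows "regular_cond_law \<rho> (S t) (bX (Suc t)) (cut_at t t) (\<lambda>(x, y). x (Suc t)) k
    \<longleftrightarrow> joint_X t \<rho> = semidirect (bX (Suc t)) (trunc t t \<rho>) k"
proof -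
  have "(\<lambda>(x, y). x (Suc t)) \<in> measurable (S N) (bX (Suc t))"
    unfolding split_beta' using t by (intro measurable_compose[OF measurable_fst measurable_path_component]) auto
  then show ?thesis
    using regular_cond_law_iff_semidirect[OF prob_\<rho>[OF \<rho>] _ _ k] measurable_trunc[of t N t N, unfolded split_beta'] t
    by (simp add: measurable_\<rho>[OF \<rho>] joint_X_def trunc_def split_beta')
qed

lemma joint_Y_eq_iff:
  assumes \<rho>: "\<rho> \<in> space (prob_algebra (S N))" and t: "t < N"
    and k: "k \<in> measurable (S' t) (prob_algebra (bY (Suc t)))"
  shows "regular_cond_law \<rho> (S' t) (bY (Suc t)) (cut_at (Suc t) t) (\<lambda>(x, y). y (Suc t)) k
    \<longleftrightarrow> joint_Y t \<rho> = semidirect (bY (Suc t)) (trunc (Suc t) t \<rho>) k"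
proof -
  have "(\<lambda>(x, y). y (Suc t)) \<in> measurable (S N) (bY (Suc t))"
    unfolding split_beta' using t by (intro measurable_compose[OF measurable_snd measurable_path_component]) auto
  then show ?thesis
    using regular_cond_law_iff_semidirect[OF prob_\<rho>[OF \<rho>] _ _ k] measurable_trunc[of "Suc t" N t N, unfolded split_beta'] t
    by (simp add: measurable_\<rho>[OF \<rho>] joint_Y_def trunc_def split_beta')
qed

end

section \<open>Telescoping of the divergence\<close>

locale causal_problem = kernel_data N X Y m gX gY
  for N :: nat and X :: "nat \<Rightarrow> 'a topology" and Y :: "nat \<Rightarrow> 'b topology"
    and m :: "nat \<Rightarrow> (nat \<Rightarrow> 'a) \<Rightarrow> 'a measure" and gX :: "('a, 'b, 'a) kernels" and gY :: "('a, 'b, 'b) kernels" +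
  fixes \<gamma> :: "('a, 'b) path_pair measure"
  assumes \<gamma>: "\<gamma> \<in> space (prob_algebra (S N))"
    and joint_X_\<gamma>: "t < N \<Longrightarrow> joint_X t \<gamma> = semidirect (bX (Suc t)) (trunc t t \<gamma>) (gX (Suc t))"
    and joint_Y_\<gamma>: "t < N \<Longrightarrow> joint_Y t \<gamma> = semidirect (bY (Suc t)) (trunc (Suc t) t \<gamma>) (gY (Suc t))"
begin

definition \<Phi> :: "nat \<Rightarrow> ('a, 'b) path_pair measure \<Rightarrow> ennreal" where
  "\<Phi> t \<rho> = D_KL (trunc t t \<rho>) (trunc t t \<gamma>) + (\<integral>\<^sup>+z. f t z \<partial>trunc t t \<rho>)"

lemma \<Phi>_Suc:
  assumes \<rho>: "\<rho> \<in> space (prob_algebra (S N))" and t: "t < N"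
    and joint_X_\<rho>: "joint_X t \<rho> = opt_joint_X t \<rho>"
  shows "\<Phi> (Suc t) \<rho> = \<Phi> t \<rho> + deficit t \<rho>"
proof -
  let ?DX = "\<integral>\<^sup>+z. D_KL (kX (Suc t) z) (gX (Suc t) z) \<partial>trunc t t \<rho>"
  let ?V = "\<integral>\<^sup>+z. V t z \<partial>trunc (Suc t) t \<rho>"
  let ?VX = "\<integral>\<^sup>+z. \<integral>\<^sup>+x'. V t (ext_X t (z, x')) \<partial>kX (Suc t) z \<partial>trunc t t \<rho>"
  let ?QY = "semidirect (bY (Suc t)) (trunc (Suc t) t \<rho>) (gY (Suc t))"
  let ?FY = "\<integral>\<^sup>+w. f (Suc t) (ext_Y t w) \<partial>joint_Y t \<rho>"
  have le: "t \<le> N" "Suc t \<le> N" using t by simp_all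
  have congS: "measurable M L = measurable (S t) L" if "sets M = sets (S t)" for M and L :: "'x measure"
    using that by (rule measurable_cong_sets) simp
  have congS': "measurable M L = measurable (S' t) L" if "sets M = sets (S' t)" for M and L :: "'x measure"
    using that by (rule measurable_cong_sets) simp
  have fm: "f (Suc t) \<in> borel_measurable (S (Suc t))" by (rule measurable_cost) fact
  note pT = prob_trunc[OF \<rho> le(1) le(1)] and pT' = prob_trunc[OF \<rho> le(2) le(1)]
    and pJX = prob_joint_X[OF \<rho> t] and pJY = prob_joint_Y[OF \<rho> t]
  note gT = prob_trunc[OF \<gamma> le(1) le(1)] and gT' = prob_trunc[OF \<gamma> le(2) le(1)]
    and gJX = prob_joint_X[OF \<gamma> t] and gJY = prob_joint_Y[OF \<gamma> t]
  have gYk: "gY (Suc t) \<in> measurable (trunc (Suc t) t \<gamma>) (prob_algebra (bY (Suc t)))"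
    "gY (Suc t) \<in> measurable (trunc (Suc t) t \<rho>) (prob_algebra (bY (Suc t)))"
    using gY_kernel[OF t] by (simp_all add: measurable_cong_sets[OF sets_trunc refl])
  have gXk: "gX (Suc t) \<in> measurable (trunc t t \<gamma>) (prob_algebra (bX (Suc t)))"
    "gX (Suc t) \<in> measurable (trunc t t \<rho>) (prob_algebra (bX (Suc t)))"
    and kXk: "kX (Suc t) \<in> measurable (trunc t t \<rho>) (prob_algebra (bX (Suc t)))"
    using gX_kernel[OF t] kX[OF t] by (simp_all add: measurable_cong_sets[OF sets_trunc refl])
  have sJY: "sets (joint_Y t \<rho>) = sets (trunc (Suc t) t \<alpha> \<Otimes>\<^sub>M bY (Suc t))" for \<alpha>
    unfolding sets_joint_Y by (rule sets_pair_measure_cong[symmetric]) (simp_all add: sets_trunc)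
  have sJX: "sets (joint_X t \<rho>) = sets (trunc t t \<alpha> \<Otimes>\<^sub>M bX (Suc t))" for \<alpha>
    unfolding sets_joint_X by (rule sets_pair_measure_cong[symmetric]) (simp_all add: sets_trunc)
  have mJY: "trunc (Suc t) t \<rho> = distr (joint_Y t \<rho>) (trunc (Suc t) t \<alpha>) fst" for \<alpha>
    unfolding distr_joint_Y_fst[OF \<rho> t, symmetric] by (rule distr_cong) (simp_all add: sets_trunc)
  have mJX: "trunc t t \<rho> = distr (joint_X t \<rho>) (trunc t t \<alpha>) fst" for \<alpha>
    unfolding distr_joint_X_fst[OF \<rho> t, symmetric] by (rule distr_cong) (simp_all add: sets_trunc)
  obtain G where G: "countable G" "Int_stable G" "space (bX (Suc t)) \<in> G"
      "sets (bX (Suc t)) = sigma_sets (space (bX (Suc t))) G"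
    by (rule second_countable_borel_of_generator[OF second_countable_X[OF t]])
  have gm: "(\<lambda>w. f (Suc t) (ext_Y t w)) \<in> borel_measurable (trunc (Suc t) t \<rho> \<Otimes>\<^sub>M bY (Suc t))"
    using f_ext_Y[OF fm] by (simp add: measurable_cong_sets[OF sets_pair_measure_cong[OF sets_trunc refl] refl])
  have Vm: "(\<lambda>w. V t (ext_X t w)) \<in> borel_measurable (trunc t t \<rho> \<Otimes>\<^sub>M bX (Suc t))"
    using measurable_compose[OF measurable_ext_X measurable_V[OF t]]
    by (simp add: measurable_cong_sets[OF sets_pair_measure_cong[OF sets_trunc refl] refl])

  \<comment> \<open>The chain rule needs the new coordinate as a separate factor;
    \<open>split_Y\<close> inverts the passage back to paths.\<close>
  have Y1: "D_KL (trunc (Suc t) (Suc t) \<rho>) (trunc (Suc t) (Suc t) \<gamma>) = D_KL (joint_Y t \<rho>) (joint_Y t \<gamma>)"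
    unfolding distr_joint_Y_ext[OF \<rho> t, symmetric] distr_joint_Y_ext[OF \<gamma> t, symmetric]
    by (rule D_KL_distr[OF pJY gJY, where g = "split_Y t"])
      (simp_all add: sets_joint_Y measurable_ext_Y measurable_split_Y split_ext_Y
        measurable_cong_sets[OF sets_joint_Y refl] measurable_cong_sets[OF refl sets_joint_Y] sets_eq_imp_space_eq[OF sets_joint_Y])
  have Y2: "D_KL (joint_Y t \<rho>) (joint_Y t \<gamma>) = D_KL (trunc (Suc t) t \<rho>) (trunc (Suc t) t \<gamma>)
      + D_KL (joint_Y t \<rho>) ?QY"
    unfolding joint_Y_\<gamma>[OF t] by (rule D_KL_semidirect_marginal[OF gT' gYk(1) pJY sJY mJY])
  \<comment> \<open>The Y-step of \<rho> is unrestricted, so its conditional divergence is exchanged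
    for the deficit plus a term that sees \<rho> only up to the half-step.\<close>
  have Y3: "D_KL (joint_Y t \<rho>) ?QY
      + ?FY = deficit t \<rho> + ?V"
    unfolding deficit_def kY_eq V_def
    by (rule D_KL_gibbs[OF pT' gYk(2) gm pJY sJY mJY[symmetric]])
  have Y4: "(\<integral>\<^sup>+z. f (Suc t) z \<partial>trunc (Suc t) (Suc t) \<rho>) = ?FY"
    unfolding distr_joint_Y_ext[OF \<rho> t, symmetric]
    by (rule nn_integral_distr) (simp_all add: measurable_cong_sets[OF sets_joint_Y refl] measurable_ext_Y fm)

  have X1: "D_KL (trunc (Suc t) t \<rho>) (trunc (Suc t) t \<gamma>) = D_KL (joint_X t \<rho>) (joint_X t \<gamma>)"
    unfolding distr_joint_X_ext[OF \<rho> t, symmetric] distr_joint_X_ext[OF \<gamma> t, symmetric]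
    by (rule D_KL_distr[OF pJX gJX, where g = "split_X t"])
      (simp_all add: sets_joint_X measurable_ext_X measurable_split_X split_ext_X
        measurable_cong_sets[OF sets_joint_X refl] measurable_cong_sets[OF refl sets_joint_X] sets_eq_imp_space_eq[OF sets_joint_X])
  have X2: "D_KL (joint_X t \<rho>) (joint_X t \<gamma>) = D_KL (trunc t t \<rho>) (trunc t t \<gamma>)
      + D_KL (joint_X t \<rho>) (semidirect (bX (Suc t)) (trunc t t \<rho>) (gX (Suc t)))"
    unfolding joint_X_\<gamma>[OF t] by (rule D_KL_semidirect_marginal[OF gT gXk(1) pJX sJX mJX])
  have Dm: "(\<lambda>z. D_KL (kX (Suc t) z) (gX (Suc t) z)) \<in> borel_measurable (trunc t t \<rho>)"
    by (rule measurable_D_KL_kernel[OF kXk gXk(2) G])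
  \<comment> \<open>Here causality is used: it identifies the conditional law of the next
    X-coordinate with \<open>kX (Suc t)\<close>, so the conditional divergence becomes an integral
    with an integrand that does not depend on \<rho>.\<close>
  have X3: "D_KL (joint_X t \<rho>) (semidirect (bX (Suc t)) (trunc t t \<rho>) (gX (Suc t)))
      = ?DX"
    unfolding joint_X_\<rho> by (rule D_KL_semidirect_same_base[OF pT kXk gXk(2) G Dm])
  have "?V = (\<integral>\<^sup>+w. V t (ext_X t w) \<partial>joint_X t \<rho>)"
    unfolding distr_joint_X_ext[OF \<rho> t, symmetric]
    by (rule nn_integral_distr) (simp_all add: measurable_cong_sets[OF sets_joint_X refl] measurable_ext_X measurable_V t)
  also have "\<dots> = ?VX"
    unfolding joint_X_\<rho> by (rule nn_integral_semidirect[OF kXk Vm])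
  finally have X4: "?V
      = ?VX" .
  have "(\<integral>\<^sup>+z. f t z \<partial>trunc t t \<rho>)
      = (\<integral>\<^sup>+z. D_KL (kX (Suc t) z) (gX (Suc t) z) + (\<integral>\<^sup>+x'. V t (ext_X t (z, x')) \<partial>kX (Suc t) z) \<partial>trunc t t \<rho>)"
    by (rule nn_integral_cong) (simp add: cost_eq t sets_eq_imp_space_eq[OF sets_trunc])
  also have "\<dots> = ?DX + ?V"
    unfolding X4 by (rule nn_integral_add[OF Dm measurable_kernel_nn_integral[OF kXk Vm]])
  \<comment> \<open>By \<open>cost_eq\<close>, what the X-step and the Gibbs identity leave over is
    exactly the integral of f at time t.\<close>
  finally have f_eq: "(\<integral>\<^sup>+z. f t z \<partial>trunc t t \<rho>)
      = ?DX + ?V" .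
  have "\<Phi> (Suc t) \<rho> = D_KL (trunc (Suc t) t \<rho>) (trunc (Suc t) t \<gamma>)
      + (D_KL (joint_Y t \<rho>) ?QY
        + ?FY)"
    by (simp only: \<Phi>_def Y1 Y2 Y4 add.assoc)
  also have "\<dots> = D_KL (trunc (Suc t) t \<rho>) (trunc (Suc t) t \<gamma>)
      + (deficit t \<rho> + ?V)"
    by (simp only: Y3)
  also have "\<dots> = \<Phi> t \<rho> + deficit t \<rho>"
    by (simp only: X1 X2 X3 \<Phi>_def f_eq ac_simps)
  finally show ?thesis .
qed

text \<open>The recursion carried one step further, to time 0, so that the first pair of coordinates
  is treated like all others. The integral over the one-point law is the form in which
  \<open>\<Phi> 0\<close> delivers it.\<close>

definition optimal_value :: ennreal where
  "optimal_value = (\<integral>\<^sup>+z. f 0 z \<partial>return (S 0) (\<lambda>_. undefined, \<lambda>_. undefined))"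

lemma D_KL_eq_optimal_value_plus_deficits:
  assumes \<rho>: "\<rho> \<in> space (prob_algebra (S N))"
    and joint_X_\<rho>: "\<And>t. t < N \<Longrightarrow> joint_X t \<rho> = opt_joint_X t \<rho>"
  shows "D_KL \<rho> \<gamma> = optimal_value + (\<Sum>t<N. deficit t \<rho>)"
proof -
  have "t \<le> N \<Longrightarrow> \<Phi> t \<rho> = \<Phi> 0 \<rho> + (\<Sum>s<t. deficit s \<rho>)" for t
    by (induction t) (simp_all add: \<Phi>_Suc[OF \<rho> _ joint_X_\<rho>] add.assoc)
  from this[of N] have "\<Phi> N \<rho> = \<Phi> 0 \<rho> + (\<Sum>s<N. deficit s \<rho>)" by simp
  moreover have "\<Phi> N \<rho> = D_KL \<rho> \<gamma>"
    by (simp add: \<Phi>_def trunc_N[OF \<rho>] trunc_N[OF \<gamma>] cost.simps)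
  moreover have "\<Phi> 0 \<rho> = optimal_value"
    using prob_trunc[OF \<gamma>, of 0 0]
    by (simp add: \<Phi>_def trunc_0[OF \<rho>] trunc_0[OF \<gamma>] optimal_value_def D_KL_self)
  ultimately show ?thesis by simp
qed

end

subsection \<open>The optimal law\<close>

lemma distr_left_inverse:
  assumes f: "f \<in> measurable M N" and g: "g \<in> measurable N M" and gf: "\<And>x. x \<in> space M \<Longrightarrow> g (f x) = x"
  shows "distr (distr M N f) M g = M"
proof -
  have "distr (distr M N f) M g = distr M M (\<lambda>x. x)"
    unfolding distr_distr[OF g f] by (rule distr_cong) (simp_all add: gf)
  then show ?thesis by simp
qed

text \<open>For a kernel that sees its argument only through g, appending a coordinate commutes with
  pushing the past forward. With g = \<open>fst\<close> this shows that the X-marginal of the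
  optimal law evolves by itself.\<close>

lemma semidirect_distr:
  assumes M: "prob_space M" and g [measurable]: "g \<in> measurable M S" and k: "k \<in> measurable S (prob_algebra T)"
  shows "semidirect T (distr M S g) k = distr (semidirect T M (\<lambda>x. k (g x))) (S \<Otimes>\<^sub>M T) (\<lambda>(x, y). (g x, y))"
    (is "?l = ?r")
proof (rule measure_eqI)
  have D: "prob_space (distr M S g)" by (rule prob_space.prob_space_distr[OF M g])
  have k': "k \<in> measurable (distr M S g) (prob_algebra T)" using k by simp
  have kg: "(\<lambda>x. k (g x)) \<in> measurable M (prob_algebra T)" by (rule measurable_compose[OF g k])
  have ST: "sets (distr M S g \<Otimes>\<^sub>M T) = sets (S \<Otimes>\<^sub>M T)" by (rule sets_pair_measure_cong) simp_all
  show "sets (?l) = sets (?r)"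
    unfolding sets_semidirect[OF k' D] ST by simp
  fix A assume "A \<in> sets (?l)"
  then have A': "A \<in> sets (distr M S g \<Otimes>\<^sub>M T)" and A [measurable]: "A \<in> sets (S \<Otimes>\<^sub>M T)"
    unfolding sets_semidirect[OF k' D] ST by simp_all
  have ind: "indicator A \<in> borel_measurable (S \<Otimes>\<^sub>M T)" by simp
  have gT: "(\<lambda>(x, y). (g x, y)) \<in> measurable (M \<Otimes>\<^sub>M T) (S \<Otimes>\<^sub>M T)" by measurable
  have gT': "(\<lambda>(x, y). (g x, y)) \<in> measurable (semidirect T M (\<lambda>x. k (g x))) (S \<Otimes>\<^sub>M T)"
    using gT by (simp add: measurable_cong_sets[OF sets_semidirect[OF kg M] refl])
  have "emeasure (?l) A = (\<integral>\<^sup>+x. \<integral>\<^sup>+y. indicator A (x, y) \<partial>k x \<partial>distr M S g)"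
    by (rule emeasure_semidirect[OF k' D A'])
  also have "\<dots> = (\<integral>\<^sup>+x. \<integral>\<^sup>+y. indicator A (g x, y) \<partial>k (g x) \<partial>M)"
    by (rule nn_integral_distr[OF g]) (simp add: measurable_kernel_nn_integral[OF k ind])
  also have "\<dots> = (\<integral>\<^sup>+w. indicator A (case w of (x, y) \<Rightarrow> (g x, y)) \<partial>semidirect T M (\<lambda>x. k (g x)))"
    by (subst nn_integral_semidirect[OF kg measurable_compose[OF gT ind]]) simp
  also have "\<dots> = (\<integral>\<^sup>+w. indicator A w \<partial>?r)"
    by (rule nn_integral_distr[OF gT', symmetric]) simp
  finally show "emeasure (?l) A
      = emeasure (?r) A" by simp
qed

lemma regular_cond_law_distr:
  assumes h: "h \<in> measurable M M'" and R: "regular_cond_law (distr M M' h) S T A B K"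
  shows "regular_cond_law M S T (\<lambda>\<omega>. A (h \<omega>)) (\<lambda>\<omega>. B (h \<omega>)) K"
  unfolding regular_cond_law_def
proof (intro conjI ballI)
  have A: "A \<in> measurable M' S" and B: "B \<in> measurable M' T" and K: "K \<in> measurable S (prob_algebra T)"
    and eq: "\<And>E F. E \<in> sets S \<Longrightarrow> F \<in> sets T \<Longrightarrow> emeasure (distr M M' h) {\<omega> \<in> space M'. A \<omega> \<in> E \<and> B \<omega> \<in> F}
        = (\<integral>\<^sup>+\<omega>. indicator E (A \<omega>) * emeasure (K (A \<omega>)) F \<partial>distr M M' h)"
    using R by (simp_all add: regular_cond_law_def)
  show "(\<lambda>\<omega>. A (h \<omega>)) \<in> measurable M S" "(\<lambda>\<omega>. B (h \<omega>)) \<in> measurable M T"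
    by (rule measurable_compose[OF h A], rule measurable_compose[OF h B])
  show "K \<in> measurable S (prob_algebra T)" by (rule K)
  fix E F assume E: "E \<in> sets S" and F: "F \<in> sets T"
  have W: "{\<omega> \<in> space M'. A \<omega> \<in> E \<and> B \<omega> \<in> F} \<in> sets M'"
    using A B E F by measurable
  have "(\<lambda>\<omega>. emeasure (K (A \<omega>)) F) \<in> borel_measurable M'"
    by (rule measurable_compose[OF A measurable_emeasure_kernel[OF kernel_subprob[OF K] F]])
  moreover have "(\<lambda>\<omega>. indicator E (A \<omega>) :: ennreal) \<in> borel_measurable M'"
    by (rule measurable_compose[OF A borel_measurable_indicator[OF E]])
  ultimately have I: "(\<lambda>\<omega>. indicator E (A \<omega>) * emeasure (K (A \<omega>)) F) \<in> borel_measurable M'"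
    by (intro borel_measurable_times_ennreal)
  have "{\<omega> \<in> space M. A (h \<omega>) \<in> E \<and> B (h \<omega>) \<in> F} = h -` {\<omega> \<in> space M'. A \<omega> \<in> E \<and> B \<omega> \<in> F} \<inter> space M"
    using measurable_space[OF h] by auto
  then show "emeasure M {\<omega> \<in> space M. A (h \<omega>) \<in> E \<and> B (h \<omega>) \<in> F}
      = (\<integral>\<^sup>+\<omega>. indicator E (A (h \<omega>)) * emeasure (K (A (h \<omega>))) F \<partial>M)"
    using eq[OF E F] using I by (simp add: emeasure_distr[OF h W] nn_integral_distr[OF h])
qed

context kernel_data
begin

abbreviation "L \<equiv> law_of_kernels X Y kX kY"
abbreviation "bXY t \<equiv> bX (Suc t) \<Otimes>\<^sub>M bY (Suc t)"
abbreviation "LX t \<equiv> semidirect (bX (Suc t)) (L t) (kX (Suc t))"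

text \<open>\<open>law_of_kernels\<close> draws both coordinates at once; this is the law at the
  half-step in between, where only X has advanced.\<close>

definition L' :: "nat \<Rightarrow> ('a, 'b) path_pair measure" where
  "L' t = distr (LX t) (S' t) (ext_X t)"

abbreviation "LY t \<equiv> semidirect (bY (Suc t)) (L' t) (kY (Suc t))"
abbreviation "law_kernel t z \<equiv> distr (joint_kernel Y kX kY (Suc t) z) (S (Suc t)) (\<lambda>(x', y'). ext_Y t (ext_X t (z, x'), y'))"

lemma measurable_joint_kernel:
  assumes t: "t < N"
  shows "joint_kernel Y kX kY (Suc t) \<in> measurable (S t) (prob_algebra (bXY t))"
proof -
  have kYX: "(\<lambda>w. kY (Suc t) (ext_X t w)) \<in> measurable (S t \<Otimes>\<^sub>M bX (Suc t)) (prob_algebra (bY (Suc t)))"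
    by (rule measurable_compose[OF measurable_ext_X kY[OF t]])
  have "(\<lambda>z. kX (Suc t) z \<bind> (\<lambda>x'. distr (kY (Suc t) (ext_X t (z, x'))) (bXY t) (\<lambda>y'. (x', y'))))
      \<in> measurable (S t) (prob_algebra (bXY t))"
  proof (rule measurable_bind_prob_space2[OF kX[OF t]])
    have "(\<lambda>w. distr (kY (Suc t) (ext_X t w)) (bXY t) (\<lambda>y'. (snd w, y')))
        \<in> measurable (S t \<Otimes>\<^sub>M bX (Suc t)) (prob_algebra (bXY t))"
      by (rule measurable_distr_prob_space2[OF kYX]) measurable
    then show "(\<lambda>(z, x'). distr (kY (Suc t) (ext_X t (z, x'))) (bXY t) (\<lambda>y'. (x', y')))
        \<in> measurable (S t \<Otimes>\<^sub>M bX (Suc t)) (prob_algebra (bXY t))"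
      by (simp add: split_beta')
  qed
  moreover have "joint_kernel Y kX kY (Suc t) z
      = kX (Suc t) z \<bind> (\<lambda>x'. distr (kY (Suc t) (ext_X t (z, x'))) (bXY t) (\<lambda>y'. (x', y')))"
    if z: "z \<in> space (S t)" for z
  proof -
    have "joint_kernel Y kX kY (Suc t) z = semidirect (bY (Suc t)) (kX (Suc t) z) (\<lambda>x'. kY (Suc t) (ext_X t (z, x')))"
      by (simp add: joint_kernel_def ext_X_def split_beta')
    also have "\<dots> = kX (Suc t) z \<bind> (\<lambda>x'. distr (kY (Suc t) (ext_X t (z, x'))) (bXY t) (\<lambda>y'. (x', y')))"
      using z kernel_sets[OF kYX]
      by (intro semidirect_eq_bind kernel_sets[OF kX[OF t]]) (simp_all add: space_pair_measure)
    finally show ?thesis .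
  qed
  ultimately show ?thesis by (subst measurable_cong) auto
qed

lemma nn_integral_joint_kernel:
  assumes t: "t < N" and z: "z \<in> space (S t)"
    and g: "g \<in> borel_measurable (bXY t)"
  shows "(\<integral>\<^sup>+w. g w \<partial>joint_kernel Y kX kY (Suc t) z)
    = (\<integral>\<^sup>+x'. \<integral>\<^sup>+y'. g (x', y') \<partial>kY (Suc t) (ext_X t (z, x')) \<partial>kX (Suc t) z)"
proof -
  have sX: "sets (kX (Suc t) z) = sets (bX (Suc t))" by (rule kernel_sets[OF kX[OF t] z])
  have "(\<lambda>x'. kY (Suc t) (ext_X t (z, x'))) \<in> measurable (bX (Suc t)) (prob_algebra (bY (Suc t)))"
    by (rule measurable_compose[OF measurable_compose[OF measurable_Pair1'[OF z] measurable_ext_X] kY[OF t]])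
  then have k: "(\<lambda>x'. kY (Suc t) (ext_X t (z, x'))) \<in> measurable (kX (Suc t) z) (prob_algebra (bY (Suc t)))"
    by (simp add: measurable_cong_sets[OF sX refl])
  have g': "g \<in> borel_measurable (kX (Suc t) z \<Otimes>\<^sub>M bY (Suc t))"
    using g by (simp add: measurable_cong_sets[OF sets_pair_measure_cong[OF sX refl] refl])
  from nn_integral_semidirect[OF k g'] show ?thesis
    by (simp add: joint_kernel_def ext_X_def split_beta')
qed

lemma law_Suc_bind:
  "L (Suc t) = L t \<bind> (law_kernel t)"
  by (simp add: ext_X_def ext_Y_def split_beta')

lemma measurable_ext_Y_ext_X:
  "(\<lambda>(z, x', y'). ext_Y t (ext_X t (z, x'), y')) \<in> measurable (S t \<Otimes>\<^sub>M (bXY t)) (S (Suc t))"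
proof -
  have "(\<lambda>w. (fst w, fst (snd w))) \<in> measurable (S t \<Otimes>\<^sub>M (bXY t)) (S t \<Otimes>\<^sub>M bX (Suc t))"
    by measurable
  from measurable_compose[OF this measurable_ext_X]
  have "(\<lambda>w. (ext_X t (fst w, fst (snd w)), snd (snd w))) \<in> measurable (S t \<Otimes>\<^sub>M (bXY t)) (S' t \<Otimes>\<^sub>M bY (Suc t))"
    by (intro measurable_Pair) simp_all
  from measurable_compose[OF this measurable_ext_Y] show ?thesis by (simp add: split_beta')
qed

lemma measurable_law_kernel:
  assumes t: "t < N"
  shows "(law_kernel t)
    \<in> measurable (S t) (prob_algebra (S (Suc t)))"
  by (rule measurable_distr_prob_space2[OF measurable_joint_kernel[OF t] measurable_ext_Y_ext_X])

lemma law_in_prob_algebra: "t \<le> N \<Longrightarrow> L t \<in> space (prob_algebra (S t))"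
proof (induction t)
  case 0
  have "return (S 0) (\<lambda>_. undefined, \<lambda>_. undefined) \<in> space (prob_algebra (S 0))"
    by (rule measurable_space[OF measurable_return_prob_space]) (simp add: space_pair_measure space_paths_0)
  then show ?case by simp
next
  case (Suc t)
  then have t: "t < N" and L: "L t \<in> space (prob_algebra (S t))" by simp_all
  show ?case
    unfolding law_Suc_bind
    using prob_space_bind'[OF L measurable_law_kernel[OF t]] sets_bind'[OF L measurable_law_kernel[OF t]]
    by (simp add: space_prob_algebra)
qed

lemma prob_law: "t \<le> N \<Longrightarrow> prob_space (L t)" and sets_law: "t \<le> N \<Longrightarrow> sets (L t) = sets (S t)"
  using law_in_prob_algebra by (auto simp: space_prob_algebra)

context
  fixes t assumes t: "t < N"
begin

lemma kX_law: "kX (Suc t) \<in> measurable (L t) (prob_algebra (bX (Suc t)))"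
  using kX[OF t] sets_law[of t] t by (simp add: measurable_cong_sets[OF sets_law refl])

lemma sets_semidirect_law: "sets (LX t) = sets (S t \<Otimes>\<^sub>M bX (Suc t))"
  unfolding sets_semidirect[OF kX_law prob_law[OF less_imp_le[OF t]]]
  by (rule sets_pair_measure_cong) (simp_all add: sets_law t less_imp_le)

lemma measurable_ext_X_law: "ext_X t \<in> measurable (LX t) (S' t)"
  by (simp add: measurable_cong_sets[OF sets_semidirect_law refl] measurable_ext_X)

lemma prob_L': "prob_space (L' t)"
  unfolding L'_def
  by (rule prob_space.prob_space_distr[OF prob_space_semidirect[OF kX_law prob_law] measurable_ext_X_law])
    (use t in simp)

lemma sets_L': "sets (L' t) = sets (S' t)"
  by (simp add: L'_def)

lemma kY_L': "kY (Suc t) \<in> measurable (L' t) (prob_algebra (bY (Suc t)))"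
  using kY[OF t] by (simp add: measurable_cong_sets[OF sets_L' refl])

lemma sets_semidirect_L': "sets (LY t) = sets (S' t \<Otimes>\<^sub>M bY (Suc t))"
  unfolding sets_semidirect[OF kY_L' prob_L'] by (rule sets_pair_measure_cong) (simp_all add: sets_L')

lemma measurable_ext_Y_L': "ext_Y t \<in> measurable (LY t) (S (Suc t))"
  by (simp add: measurable_cong_sets[OF sets_semidirect_L' refl] measurable_ext_Y)

text \<open>One draw from the joint kernel equals two successive extensions, because on any event
  both reduce to integrating \<open>I\<close> over the X-kernel and then over
  \<open>L t\<close>.\<close>

lemma law_Suc: "L (Suc t) = distr (LY t) (S (Suc t)) (ext_Y t)"
proof (rule measure_eqI)
  have le: "t \<le> N" "Suc t \<le> N" using t by simp_all
  show "sets (L (Suc t)) = sets (distr (LY t) (S (Suc t)) (ext_Y t))"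
    using sets_law[OF le(2)] by simp
  fix A assume "A \<in> sets (L (Suc t))"
  then have A: "A \<in> sets (S (Suc t))" using sets_law[OF le(2)] by blast
  then have ind: "indicator A \<in> borel_measurable (S (Suc t))" by simp
  have g: "(\<lambda>w. indicator A (ext_Y t w) :: ennreal) \<in> borel_measurable (S' t \<Otimes>\<^sub>M bY (Suc t))"
    by (rule measurable_compose[OF measurable_ext_Y ind])
  define I :: "_ \<Rightarrow> ennreal" where "I z = (\<integral>\<^sup>+y'. indicator A (ext_Y t (z, y')) \<partial>kY (Suc t) z)" for z
  have I: "I \<in> borel_measurable (S' t)"
    unfolding I_def[abs_def] by (rule measurable_kernel_nn_integral[OF kY[OF t] g])
  have IX: "(\<lambda>w. I (ext_X t w)) \<in> borel_measurable (L t \<Otimes>\<^sub>M bX (Suc t))"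
    using measurable_compose[OF measurable_ext_X I]
    by (simp add: measurable_cong_sets[OF sets_pair_measure_cong[OF sets_law[OF le(1)] refl] refl])
  have LS: "L t \<in> space (prob_algebra (S t))" by (rule law_in_prob_algebra[OF le(1)])
  have "emeasure (L (Suc t)) A
      = (\<integral>\<^sup>+z. emeasure (law_kernel t z) A \<partial>L t)"
    unfolding law_Suc_bind by (rule emeasure_bind_prob_algebra[OF LS measurable_law_kernel[OF t] A])
  also have "\<dots> = (\<integral>\<^sup>+z. \<integral>\<^sup>+x'. I (ext_X t (z, x')) \<partial>kX (Suc t) z \<partial>L t)"
  proof (rule nn_integral_cong)
    fix z assume "z \<in> space (L t)"
    then have z: "z \<in> space (S t)" using sets_eq_imp_space_eq[OF sets_law[OF le(1)]] by simp
    have e: "(\<lambda>(x', y'). ext_Y t (ext_X t (z, x'), y')) \<in> measurable (bXY t) (S (Suc t))"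
      using measurable_compose[OF measurable_Pair1'[OF z] measurable_ext_Y_ext_X] by (simp add: split_beta')
    have e': "(\<lambda>(x', y'). ext_Y t (ext_X t (z, x'), y')) \<in> measurable (joint_kernel Y kX kY (Suc t) z) (S (Suc t))"
      using e by (simp add: measurable_cong_sets[OF kernel_sets[OF measurable_joint_kernel[OF t] z] refl])
    have "emeasure (law_kernel t z) A
        = (\<integral>\<^sup>+w. indicator A w \<partial>law_kernel t z)"
      using A by simp
    also have "\<dots> = (\<integral>\<^sup>+w. indicator A (case w of (x', y') \<Rightarrow> ext_Y t (ext_X t (z, x'), y')) \<partial>joint_kernel Y kX kY (Suc t) z)"
      by (rule nn_integral_distr[OF e']) (use A in simp)
    also have "\<dots> = (\<integral>\<^sup>+x'. I (ext_X t (z, x')) \<partial>kX (Suc t) z)"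
      by (subst nn_integral_joint_kernel[OF t z measurable_compose[OF e ind]]) (simp add: I_def)
    finally show "emeasure (law_kernel t z) A
        = (\<integral>\<^sup>+x'. I (ext_X t (z, x')) \<partial>kX (Suc t) z)" .
  qed
  also have "\<dots> = (\<integral>\<^sup>+w. I (ext_X t w) \<partial>LX t)"
    by (rule nn_integral_semidirect[OF kX_law IX, symmetric])
  also have "\<dots> = (\<integral>\<^sup>+z. I z \<partial>L' t)"
    unfolding L'_def by (rule nn_integral_distr[OF measurable_ext_X_law, symmetric]) (simp add: I)
  also have "\<dots> = (\<integral>\<^sup>+w. indicator A (ext_Y t w) \<partial>LY t)"
    unfolding I_def
    by (rule nn_integral_semidirect[OF kY_L', symmetric])
      (use g in \<open>simp add: measurable_cong_sets[OF sets_pair_measure_cong[OF sets_L' refl] refl]\<close>)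
  also have "\<dots> = (\<integral>\<^sup>+w. indicator A w \<partial>distr (LY t) (S (Suc t)) (ext_Y t))"
    by (rule nn_integral_distr[OF measurable_ext_Y_L', symmetric]) (use A in simp)
  finally show "emeasure (L (Suc t)) A = emeasure (distr (LY t) (S (Suc t)) (ext_Y t)) A"
    using A by simp
qed

lemma distr_law_split_Y: "distr (L (Suc t)) (S' t \<Otimes>\<^sub>M bY (Suc t)) (split_Y t) = LY t"
proof -
  have "distr (L (Suc t)) (S' t \<Otimes>\<^sub>M bY (Suc t)) (split_Y t)
      = distr (L (Suc t)) (LY t) (split_Y t)"
    by (rule distr_cong) (simp_all add: sets_semidirect_L')
  also have "\<dots> = LY t"
    unfolding law_Suc
    by (rule distr_left_inverse[OF measurable_ext_Y_L'])
      (simp_all add: measurable_cong_sets[OF refl sets_semidirect_L'] measurable_split_Y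
        sets_eq_imp_space_eq[OF sets_semidirect_L'] split_ext_Y)
  finally show ?thesis .
qed

lemma distr_L'_split_X: "distr (L' t) (S t \<Otimes>\<^sub>M bX (Suc t)) (split_X t) = LX t"
proof -
  have "distr (L' t) (S t \<Otimes>\<^sub>M bX (Suc t)) (split_X t)
      = distr (L' t) (LX t) (split_X t)"
    by (rule distr_cong) (simp_all add: sets_semidirect_law)
  also have "\<dots> = LX t"
    unfolding L'_def
    by (rule distr_left_inverse[OF measurable_ext_X_law])
      (simp_all add: measurable_cong_sets[OF refl sets_semidirect_law] measurable_split_X
        sets_eq_imp_space_eq[OF sets_semidirect_law] split_ext_X)
  finally show ?thesis .
qed

lemma distr_semidirect_L'_fst: "distr (LY t) (S' t) fst = L' t"
proof -
  have "distr (LY t) (S' t) fst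
      = distr (LY t) (L' t) fst"
    by (rule distr_cong) (simp_all add: sets_L')
  then show ?thesis by (simp add: distr_semidirect_fst[OF kY_L' prob_L'])
qed

lemma distr_semidirect_law_fst: "distr (LX t) (S t) fst = L t"
proof -
  have "distr (LX t) (S t) fst
      = distr (LX t) (L t) fst"
    by (rule distr_cong) (use t in \<open>simp_all add: sets_law\<close>)
  then show ?thesis using t by (simp add: distr_semidirect_fst[OF kX_law prob_law])
qed

text \<open>The cut is factored as undoing the Y-half-step and then the X-half-step; each marginal
  in between is already known.\<close>

lemma distr_law_trunc: "distr (L (Suc t)) (S t) (cut_at t t) = L t"
proof -
  have 1: "cut_at t t z = fst (split_X t (fst (split_Y t z)))" for z
    by (simp add: split_X_def split_Y_def split_beta')
  have "distr P (S t) (cut_at t t)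
      = distr (distr (distr (distr P (S' t \<Otimes>\<^sub>M bY (Suc t)) (split_Y t)) (S' t) fst) (S t \<Otimes>\<^sub>M bX (Suc t)) (split_X t)) (S t) fst"
    if P: "sets P = sets (S (Suc t))" for P
  proof -
    have "distr P (S t) (cut_at t t) = distr P (S t) (\<lambda>z. fst (split_X t (fst (split_Y t z))))"
      unfolding 1 ..
    then show ?thesis
      by (simp add: distr_distr comp_def measurable_cong_sets[OF P refl] measurable_split_X measurable_split_Y
          measurable_compose[OF measurable_split_Y measurable_fst]
          measurable_compose[OF measurable_compose[OF measurable_split_Y measurable_fst] measurable_split_X])
  qed
  from this[OF sets_law] t have "distr (L (Suc t)) (S t) (cut_at t t)
      = distr (distr (distr (distr (L (Suc t)) (S' t \<Otimes>\<^sub>M bY (Suc t)) (split_Y t)) (S' t) fst)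
          (S t \<Otimes>\<^sub>M bX (Suc t)) (split_X t)) (S t) fst" by simp
  also have "\<dots> = L t"
    by (simp only: distr_law_split_Y distr_semidirect_L'_fst distr_L'_split_X distr_semidirect_law_fst)
  finally show ?thesis .
qed

end

lemma trunc_law: "t \<le> N \<Longrightarrow> trunc t t (L N) = L t"
proof (induction rule: inc_induct)
  case base
  show ?case by (rule trunc_N) (simp add: law_in_prob_algebra)
next
  case (step t)
  have "trunc t t (L N) = distr (trunc (Suc t) (Suc t) (L N)) (S t) (cut_at t t)"
    using step by (intro distr_trunc_trunc[symmetric] law_in_prob_algebra) simp_all
  then show ?case by (simp only: step.IH distr_law_trunc[OF step.hyps(2)])
qed

lemma joint_Y_law: "t < N \<Longrightarrow> joint_Y t (L N) = opt_joint_Y t (L N)"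
  and joint_X_law: "t < N \<Longrightarrow> joint_X t (L N) = opt_joint_X t (L N)"
proof -
  assume t: "t < N"
  have L: "L N \<in> space (prob_algebra (S N))" by (simp add: law_in_prob_algebra)
  have JY: "joint_Y t (L N) = LY t"
    using t by (simp only: distr_trunc_split_Y[OF L t, symmetric] trunc_law Suc_leI distr_law_split_Y)
  then have T: "trunc (Suc t) t (L N) = L' t"
    by (simp only: distr_joint_Y_fst[OF L t, symmetric] distr_semidirect_L'_fst[OF t])
  show "joint_Y t (L N) = opt_joint_Y t (L N)"
    by (simp only: JY T)
  show "joint_X t (L N) = opt_joint_X t (L N)"
    using t by (simp only: distr_trunc_split_X[OF L t, symmetric] T distr_L'_split_X trunc_law less_imp_le)
qed

lemma law_unique:
  assumes \<rho>: "\<rho> \<in> space (prob_algebra (S N))"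
    and JX: "\<And>t. t < N \<Longrightarrow> joint_X t \<rho> = opt_joint_X t \<rho>"
    and JY: "\<And>t. t < N \<Longrightarrow> joint_Y t \<rho> = opt_joint_Y t \<rho>"
  shows "\<rho> = L N"
proof -
  have "t \<le> N \<Longrightarrow> trunc t t \<rho> = L t" for t
  proof (induction t)
    case 0
    show ?case by (simp add: trunc_0[OF \<rho>])
  next
    case (Suc t)
    then have t: "t < N" and IH: "trunc t t \<rho> = L t" by simp_all
    have "trunc (Suc t) t \<rho> = L' t"
      by (simp only: distr_joint_X_ext[OF \<rho> t, symmetric] JX[OF t] IH L'_def)
    then show ?case
      by (simp only: distr_joint_Y_ext[OF \<rho> t, symmetric] JY[OF t] law_Suc[OF t])
  qed
  from this[of N] show ?thesis by (simp add: trunc_N[OF \<rho>])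
qed

end

section \<open>First marginal and causality\<close>

lemma upto_time_0: "upto_time 0 x = (\<lambda>_. undefined)"
  by (simp add: restrict_def)

context kernel_data
begin

lemma kX_eq: "kX t = (\<lambda>z. m t (fst z))"
  by (simp add: opt_X_def split_beta')

context
  fixes \<mu> assumes \<mu>: "\<mu> \<in> space (prob_algebra (paths X N))"
    and m_\<mu>: "\<And>t. t < N \<Longrightarrow> regular_cond_law \<mu> (paths X t) (bX (Suc t)) (upto_time t) (\<lambda>x. x (Suc t)) (m (Suc t))"
begin

lemma prob_\<mu>: "prob_space \<mu>" and sets_\<mu>: "sets \<mu> = sets (paths X N)"
  using \<mu> by (auto simp: space_prob_algebra)

text \<open>The kernel of the next X-coordinate ignores y, so the X-marginals obey the recursion
  with kernels m that \<mu> obeys, from the same start.\<close>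

lemma distr_law_fst:
  assumes "t \<le> N" shows "distr (L t) (paths X t) fst = distr \<mu> (paths X t) (upto_time t)"
  using assms
proof (induction t)
  case 0
  have "distr (L 0) (paths X 0) fst = return (paths X 0) (\<lambda>_. undefined)"
    by (simp add: distr_return space_pair_measure space_paths_0)
  also have "\<dots> = distr \<mu> (paths X 0) (upto_time 0)"
    unfolding upto_time_0 by (simp add: prob_space.distr_const[OF prob_\<mu>] space_paths_0)
  finally show ?case .
next
  case (Suc t)
  from Suc.prems have t: "t < N" and le: "t \<le> N" by simp_all
  note IH = Suc.IH[OF le]
  define U :: "(nat \<Rightarrow> 'a) \<times> 'a \<Rightarrow> nat \<Rightarrow> 'a" where "U = (\<lambda>(x, x'). x(Suc t := x'))"
  have U: "U \<in> measurable (paths X t \<Otimes>\<^sub>M bX (Suc t)) (paths X (Suc t))"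
    unfolding U_def by (rule measurable_path_update)
  have um: "upto_time t \<in> measurable \<mu> (paths X t)" "(\<lambda>x. x (Suc t)) \<in> measurable \<mu> (bX (Suc t))"
    using m_\<mu>[OF t] by (simp_all add: regular_cond_law_def)
  have fstm: "fst \<in> measurable (L t) (paths X t)"
    by (simp add: measurable_cong_sets[OF sets_law[OF le] refl])
  have sdm: "(\<lambda>(z, x'). (fst z, x')) \<in> measurable (LX t) (paths X t \<Otimes>\<^sub>M bX (Suc t))"
    unfolding measurable_cong_sets[OF sets_semidirect_law[OF t] refl] by measurable
  have "distr (L (Suc t)) (paths X (Suc t)) fst
      = distr (distr (LY t) (S' t) fst) (paths X (Suc t)) fst"
    unfolding law_Suc[OF t]
    using measurable_ext_Y_L'[OF t]
    by (simp add: distr_distr comp_def measurable_cong_sets[OF sets_semidirect_L'[OF t] refl])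
      (simp add: ext_Y_def split_beta')
  also have "\<dots> = distr (L' t) (paths X (Suc t)) fst"
    by (simp only: distr_semidirect_L'_fst[OF t])
  also have "\<dots> = distr (LX t) (paths X (Suc t)) (\<lambda>w. U (fst (fst w), snd w))"
    unfolding L'_def
    using measurable_ext_X_law[OF t]
    by (simp add: distr_distr comp_def) (simp add: ext_X_def U_def split_beta')
  also have "\<dots> = distr (distr (LX t) (paths X t \<Otimes>\<^sub>M bX (Suc t)) (\<lambda>(z, x'). (fst z, x')))
      (paths X (Suc t)) U"
    unfolding distr_distr[OF U sdm] by (simp add: comp_def split_beta')
  also have "\<dots> = distr (semidirect (bX (Suc t)) (distr (L t) (paths X t) fst) (m (Suc t))) (paths X (Suc t)) U"
    unfolding semidirect_distr[OF prob_law[OF le] fstm m_kernel[OF t]] kX_eq ..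
  also have "\<dots> = distr (distr \<mu> (paths X t \<Otimes>\<^sub>M bX (Suc t)) (\<lambda>x. (upto_time t x, x (Suc t)))) (paths X (Suc t)) U"
    using m_\<mu>[OF t] unfolding IH regular_cond_law_iff_semidirect[OF prob_\<mu> um m_kernel[OF t]] by simp
  also have "\<dots> = distr \<mu> (paths X (Suc t)) (upto_time (Suc t))"
    unfolding distr_distr[OF U measurable_Pair[OF um]] by (simp add: comp_def U_def update_upto_time)
  finally show ?case .
qed

lemma distr_law_fst_eq: "distr (L N) (paths X N) fst = \<mu>"
proof -
  have "distr (L N) (paths X N) fst = distr \<mu> (paths X N) (upto_time N)" by (rule distr_law_fst) simp
  also have "\<dots> = distr \<mu> \<mu> (\<lambda>x. x)"
    by (rule distr_cong) (simp_all add: sets_\<mu> sets_eq_imp_space_eq[OF sets_\<mu>] upto_time_self)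
  finally show ?thesis by simp
qed

text \<open>With the X-marginal fixed, the law of the next X-coordinate given the X-past is m;
  conditional independence extends this to conditioning on both pasts.\<close>

lemma causal_iff_joint_X:
  assumes \<rho>: "\<rho> \<in> space (prob_algebra (S N))" and marginal: "distr \<rho> (paths X N) fst = \<mu>"
  shows "causal N X Y \<rho> \<longleftrightarrow> (\<forall>t<N. joint_X t \<rho> = opt_joint_X t \<rho>)"
proof -
  have fstm: "fst \<in> measurable \<rho> (paths X N)" by (simp add: measurable_\<rho>[OF \<rho>])
  have R: "regular_cond_law \<rho> (paths X t) (bX (Suc t)) (\<lambda>\<omega>. upto_time t (fst \<omega>)) (\<lambda>\<omega>. fst \<omega> (Suc t)) (m (Suc t))"
    if "t < N" for t
    by (rule regular_cond_law_distr[OF fstm, unfolded marginal, OF m_\<mu>[OF that]])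
  have step: "cond_indep \<rho> (bX (Suc t)) (paths Y t) (paths X t)
        (\<lambda>(x, y). x (Suc t)) (\<lambda>(x, y). upto_time t y) (\<lambda>(x, y). upto_time t x)
      \<longleftrightarrow> joint_X t \<rho> = opt_joint_X t \<rho>" if t: "t < N" for t
  proof -
    have B: "(\<lambda>\<omega>. upto_time t (snd \<omega>)) \<in> measurable \<rho> (paths Y t)"
      unfolding measurable_\<rho>[OF \<rho>] using t
      by (intro measurable_compose[OF measurable_snd measurable_upto_time]) simp
    show ?thesis
      using cond_indep_iff_regular_cond_law[OF prob_\<rho>[OF \<rho>] B R[OF t]] joint_X_eq_iff[OF \<rho> t kX[OF t]]
      by (simp add: split_beta' kX_eq)
  qed
  \<comment> \<open>\<open>causal\<close> only speaks of times t \<ge> 1. At t = 0 the past is a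
    single point, and the marginal \<mu> alone fixes the law of the first X-coordinate.\<close>
  have "joint_X 0 \<rho> = opt_joint_X 0 \<rho>" if N: "0 < N"
  proof (rule joint_X_eq_iff[OF \<rho> N kX[OF N], THEN iffD1], unfold regular_cond_law_def, intro conjI ballI)
    show "cut_at 0 0 \<in> measurable \<rho> (S 0)"
      unfolding measurable_\<rho>[OF \<rho>] by (rule measurable_trunc) simp_all
    show "(\<lambda>(x, y). x (Suc 0)) \<in> measurable \<rho> (bX (Suc 0))"
      using R[OF N] by (simp add: regular_cond_law_def split_beta')
    show "kX (Suc 0) \<in> measurable (S 0) (prob_algebra (bX (Suc 0)))" by (rule kX[OF N])
    fix E F assume "E \<in> sets (S 0)" and F: "F \<in> sets (bX (Suc 0))"
    have "emeasure \<rho> {\<omega> \<in> space \<rho>. upto_time 0 (fst \<omega>) \<in> space (paths X 0) \<and> fst \<omega> (Suc 0) \<in> F}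
        = (\<integral>\<^sup>+\<omega>. indicator (space (paths X 0)) (upto_time 0 (fst \<omega>)) * emeasure (m (Suc 0) (upto_time 0 (fst \<omega>))) F \<partial>\<rho>)"
      using R[OF N] F by (simp add: regular_cond_law_def)
    then have "emeasure \<rho> {\<omega> \<in> space \<rho>. fst \<omega> (Suc 0) \<in> F} = (\<integral>\<^sup>+\<omega>. emeasure (m (Suc 0) (\<lambda>_. undefined)) F \<partial>\<rho>)"
      unfolding upto_time_0 by (simp add: space_paths_0)
    then show "emeasure \<rho> {\<omega> \<in> space \<rho>. (case \<omega> of (x, y) \<Rightarrow> (upto_time 0 x, upto_time 0 y)) \<in> E
          \<and> (case \<omega> of (x, y) \<Rightarrow> x (Suc 0)) \<in> F}
        = (\<integral>\<^sup>+\<omega>. indicator E (case \<omega> of (x, y) \<Rightarrow> (upto_time 0 x, upto_time 0 y))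
            * emeasure (kX (Suc 0) (case \<omega> of (x, y) \<Rightarrow> (upto_time 0 x, upto_time 0 y))) F \<partial>\<rho>)"
      unfolding split_beta' upto_time_0 kX_eq
      by (cases "(\<lambda>_. undefined, \<lambda>_. undefined) \<in> E") simp_all
  qed
  then have "(\<forall>t<N. joint_X t \<rho> = opt_joint_X t \<rho>)
      \<longleftrightarrow> (\<forall>t\<in>{1..<N}. joint_X t \<rho> = opt_joint_X t \<rho>)"
    by (metis One_nat_def Suc_leI atLeastLessThan_iff gr0I)
  then show ?thesis unfolding causal_def using step by auto
qed

lemma law_in_causal_couplings: "L N \<in> causal_couplings N X Y \<mu>"
  using law_in_prob_algebra[of N] causal_iff_joint_X[OF _ distr_law_fst_eq] joint_X_law
  by (simp add: causal_couplings_def distr_law_fst_eq)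

lemma causal_couplingsD:
  assumes "\<rho> \<in> causal_couplings N X Y \<mu>"
  shows "\<rho> \<in> space (prob_algebra (S N))"
    and "t < N \<Longrightarrow> joint_X t \<rho> = opt_joint_X t \<rho>"
  using assms causal_iff_joint_X[of \<rho>] by (auto simp: causal_couplings_def)

end
end

theorem lemma6p2:
  fixes N :: nat
    and X :: "nat \<Rightarrow> 'a topology"
    and Y :: "nat \<Rightarrow> 'b topology"
    and \<mu> :: "(nat \<Rightarrow> 'a) measure"
    and \<gamma> :: "((nat \<Rightarrow> 'a) \<times> (nat \<Rightarrow> 'b)) measure"
    and \<pi> :: "((nat \<Rightarrow> 'a) \<times> (nat \<Rightarrow> 'b)) measure"
    and m :: "nat \<Rightarrow> (nat \<Rightarrow> 'a) \<Rightarrow> 'a measure"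
    and gX :: "nat \<Rightarrow> (nat \<Rightarrow> 'a) \<times> (nat \<Rightarrow> 'b) \<Rightarrow> 'a measure"
    and gY :: "nat \<Rightarrow> (nat \<Rightarrow> 'a) \<times> (nat \<Rightarrow> 'b) \<Rightarrow> 'b measure"
  assumes N: "1 \<le> N"
    and polish_X: "\<And>t. t \<in> {1..N} \<Longrightarrow> polish (X t)"
    and polish_Y: "\<And>t. t \<in> {1..N} \<Longrightarrow> polish (Y t)"
    and \<mu>: "\<mu> \<in> space (prob_algebra (paths X N))"
    and \<gamma>: "\<gamma> \<in> space (prob_algebra (paths X N \<Otimes>\<^sub>M paths Y N))"
    and m: "\<And>t. t < N \<Longrightarrow>
      regular_cond_law \<mu> (paths X t) (borel_of (X (Suc t)))
        (\<lambda>x. upto_time t x) (\<lambda>x. x (Suc t)) (m (Suc t))"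
    and gX: "\<And>t. t < N \<Longrightarrow>
      regular_cond_law \<gamma> (paths X t \<Otimes>\<^sub>M paths Y t) (borel_of (X (Suc t)))
        (\<lambda>(x, y). (upto_time t x, upto_time t y)) (\<lambda>(x, y). x (Suc t)) (gX (Suc t))"
    and gY: "\<And>t. t < N \<Longrightarrow>
      regular_cond_law \<gamma> (paths X (Suc t) \<Otimes>\<^sub>M paths Y t) (borel_of (Y (Suc t)))
        (\<lambda>(x, y). (upto_time (Suc t) x, upto_time t y)) (\<lambda>(x, y). y (Suc t)) (gY (Suc t))"
    and finite_inf: "(INF \<rho>\<in>causal_couplings N X Y \<mu>. D_KL \<rho> \<gamma>) < \<infinity>"
    and \<pi>: "\<pi> = opt_law N X Y m gX gY"
  shows "is_arg_min (\<lambda>\<rho>. D_KL \<rho> \<gamma>) (\<lambda>\<rho>. \<rho> \<in> causal_couplings N X Y \<mu>) \<pi>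
    \<and> (\<forall>\<rho>. is_arg_min (\<lambda>\<rho>. D_KL \<rho> \<gamma>) (\<lambda>\<rho>. \<rho> \<in> causal_couplings N X Y \<mu>) \<rho> \<longrightarrow> \<rho> = \<pi>)"
proof -
  interpret kernel_data N X Y m gX gY
  proof
    fix t assume t: "t < N"
    show "m (Suc t) \<in> measurable (paths X t) (prob_algebra (borel_of (X (Suc t))))"
      using m[OF t] by (simp add: regular_cond_law_def)
    show "gX (Suc t) \<in> measurable (paths X t \<Otimes>\<^sub>M paths Y t) (prob_algebra (borel_of (X (Suc t))))"
      using gX[OF t] by (simp add: regular_cond_law_def)
    show "gY (Suc t) \<in> measurable (paths X (Suc t) \<Otimes>\<^sub>M paths Y t) (prob_algebra (borel_of (Y (Suc t))))"
      using gY[OF t] by (simp add: regular_cond_law_def)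
    show "second_countable (X (Suc t))"
      using t by (intro polish_imp_second_countable polish_X) simp
  qed
  interpret causal_problem N X Y m gX gY \<gamma>
  proof
    show "\<gamma> \<in> space (prob_algebra (paths X N \<Otimes>\<^sub>M paths Y N))" by (rule \<gamma>)
    fix t assume t: "t < N"
    show "joint_X t \<gamma> = semidirect (borel_of (X (Suc t))) (trunc t t \<gamma>) (gX (Suc t))"
      by (rule joint_X_eq_iff[OF \<gamma> t gX_kernel[OF t], THEN iffD1, OF gX[OF t]])
    show "joint_Y t \<gamma> = semidirect (borel_of (Y (Suc t))) (trunc (Suc t) t \<gamma>) (gY (Suc t))"
      by (rule joint_Y_eq_iff[OF \<gamma> t gY_kernel[OF t], THEN iffD1, OF gY[OF t]])
  qed
  have \<pi>_eq: "\<pi> = L N" by (simp add: \<pi> opt_law_def)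
  have couplingsD: "\<rho> \<in> space (prob_algebra (S N))"
    "\<And>t. t < N \<Longrightarrow> joint_X t \<rho> = opt_joint_X t \<rho>"
    if "\<rho> \<in> causal_couplings N X Y \<mu>" for \<rho>
    by (rule causal_couplingsD(1)[OF \<mu> m that], assumption)
      (rule causal_couplingsD(2)[OF \<mu> m that], assumption)
  have \<pi>_in: "\<pi> \<in> causal_couplings N X Y \<mu>"
    unfolding \<pi>_eq by (rule law_in_causal_couplings[OF \<mu> m])
  have D: "D_KL \<rho> \<gamma> = optimal_value + (\<Sum>t<N. deficit t \<rho>)" if "\<rho> \<in> causal_couplings N X Y \<mu>" for \<rho>
    by (rule D_KL_eq_optimal_value_plus_deficits[OF couplingsD[OF that]])
  have "deficit t \<pi> = 0" if t: "t < N" for t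
    using prob_joint_Y[OF couplingsD(1)[OF \<pi>_in] t]
    by (simp add: deficit_def \<pi>_eq joint_Y_law[OF t, symmetric] D_KL_self)
  then have D_\<pi>: "D_KL \<pi> \<gamma> = optimal_value" by (simp add: D[OF \<pi>_in])
  obtain \<rho>\<^sub>0 where "\<rho>\<^sub>0 \<in> causal_couplings N X Y \<mu>" "D_KL \<rho>\<^sub>0 \<gamma> < \<infinity>"
    using finite_inf by (auto simp: INF_less_iff)
  \<comment> \<open>A coupling of finite divergence bounds the common summand; without this it could
    not be cancelled, and an infinite minimum would not single out \<pi>.\<close>
  then have fin: "optimal_value < \<infinity>" by (simp add: D)
  show ?thesis
  proof (intro conjI allI impI)
    show "is_arg_min (\<lambda>\<rho>. D_KL \<rho> \<gamma>) (\<lambda>\<rho>. \<rho> \<in> causal_couplings N X Y \<mu>) \<pi>"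
      unfolding is_arg_min_def D_\<pi> using \<pi>_in D by (auto simp: not_less)
    fix \<rho> assume "is_arg_min (\<lambda>\<rho>. D_KL \<rho> \<gamma>) (\<lambda>\<rho>. \<rho> \<in> causal_couplings N X Y \<mu>) \<rho>"
    then have \<rho>: "\<rho> \<in> causal_couplings N X Y \<mu>" and "D_KL \<rho> \<gamma> \<le> D_KL \<pi> \<gamma>"
      using \<pi>_in by (auto simp: is_arg_min_def not_less)
    then have "optimal_value + (\<Sum>t<N. deficit t \<rho>) \<le> optimal_value + 0" by (simp add: D D_\<pi>)
    then have "(\<Sum>t<N. deficit t \<rho>) \<le> 0"
      using fin unfolding ennreal_add_left_cancel_le by auto
    then have deficit_0: "deficit t \<rho> = 0" if "t < N" for t using that by simp
    note \<rho>_in = couplingsD(1)[OF \<rho>] and JX = couplingsD(2)[OF \<rho>]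
    \<comment> \<open>A zero deficit forces the conditional law of the next Y-coordinate to be the
      Gibbs kernel; with the X-steps fixed by causality, all conditional laws of \<rho> are then
      those of \<pi>.\<close>
    have "joint_Y t \<rho> = opt_joint_Y t \<rho>" if t: "t < N" for t
    proof (rule D_KL_eq_0_imp_eq)
      have k: "kY (Suc t) \<in> measurable (trunc (Suc t) t \<rho>) (prob_algebra (borel_of (Y (Suc t))))"
        using kY[OF t] by (simp add: measurable_cong_sets[OF sets_trunc refl])
      have pT: "prob_space (trunc (Suc t) t \<rho>)" using t by (intro prob_trunc[OF \<rho>_in]) simp_all
      show "prob_space (opt_joint_Y t \<rho>)"
        by (rule prob_space_semidirect[OF k pT])
      show "prob_space (joint_Y t \<rho>)" by (rule prob_joint_Y[OF \<rho>_in t])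
      show "sets (joint_Y t \<rho>) = sets (opt_joint_Y t \<rho>)"
        unfolding sets_semidirect[OF k pT] sets_joint_Y
        by (rule sets_pair_measure_cong[symmetric]) (simp_all add: sets_trunc)
      show "D_KL (joint_Y t \<rho>) (opt_joint_Y t \<rho>) = 0"
        using deficit_0[OF t] by (simp add: deficit_def)
    qed
    then show "\<rho> = \<pi>" unfolding \<pi>_eq by (intro law_unique[OF \<rho>_in JX])
  qed
qed

end
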